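(* Let $(A,B)$ be a Katsura pair, let $(G_B,E_A)$ be the associated faithful KEP-groupoid, and let $K$ be any field. Then $K\mathcal G_{(G_B,E_A)}$ has a nontrivial (non-zero) singular ideal if and only if there is a vertex $v\in E_A^0$ with $(G_B)_v$ finite and a simple cycle $c\in vE_A^*v$ such that the unique maximal $c$-stable subgroup $G_c$ of $(G_B)_v$ has no free orbits on $vE_A^\omega$. In this case (for such $v$ and $c$), an element of $KG_c$ which is singular and not tight is $$a=\prod_{1\le d<m,\ d\mid m}\bigl(v-g_v^{dn}\bigr),$$ where $m=|G_c|$, $(G_B)_v=\langle g_v\rangle$ and $G_c=\langle g_v^n\rangle$.
   Context: Katsura pairs and graphs. Let $N\ge 1$. A Katsura pair $(A,B)$ consists of $N\times N$ integer matrices such that $A$ has nonnegative entries and no zero row, and $A_{u,v}=0$ implies $B_{u,v}=0$. The finite directed graph $E_A$ has vertex set $E_A^0=\{1,\dots,N\}$ and edges $E_A^1=\{e_{u,v,r}: 0\le r<A_{u,v}\}$, where $e_{u,v,r}$ has range $\mathbf r(e_{u,v,r})=u$ and source $\mathbf s(e_{u,v,r})=v$. A path $p=e_1\cdots e_n$ satisfies $\mathbf s(e_i)=\mathbf r(e_{i+1})$; $\mathbf r(p)=\mathbf r(e_1)$, $\mathbf s(p)=\mathbf s(e_n)$; vertices are the paths of length $0$. $E_A^*$ is the set of finite paths, $E_A^\omega$ the set of infinite paths $e_1e_2\cdots$; $pE_A^*$, $pE_A^\omega$ are the paths with prefix $p$ (so $vE_A^\omega$ is the set of infinite paths with range $v$),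 and $uE_A^*w$ is the set of finite paths with range $u$ and source $w$. A cycle is a path of positive length with equal range and source; a simple cycle is a cycle containing no cycle as a proper subsequence of edges. KEP-groupoids. $\widehat G_B$ is the disjoint union over $v\in E_A^0$ of infinite cyclic groups $(\widehat G_B)_v=\langle g_v\rangle$, a groupoid (group bundle) with unit space $E_A^0$, the identity of $(\widehat G_B)_v$ being $v$. For $k\in\mathbb Z$ and $e_{u,v,r}\in E_A^1$, let $\hat k\in\mathbb Z$, $0\le\hat r<A_{u,v}$ be unique with $kB_{u,v}+r=\hat kA_{u,v}+\hat r$; put $g_u^k(e_{u,v,r})=e_{u,v,\hat r}$ and section $g_u^k|_{e_{u,v,r}}=g_v^{\hat k}$. This extends to paths by $g(ep)=g(e)\,g|_e(p)$, $g|_{ep}=(g|_e)|_p$, giving an action of $(\widehat G_B)_v$ on $vE_A^*$ and on $vE_A^\omega$. The faithful KEP-groupoid $(G_B,E_A)$ is obtained by quotienting each $(\widehat G_B)_v$ by the subgroup of elements acting trivially on $vE_A^*$; it inherits the action and sections, and the generator of $(G_B)_v$ is still written $g_v$. Write $(G,E)=(G_B,E_A)$. Stable subgroups. Suppose $(G_B)_v$ is finite, $H\le (G_B)_v$ and $c\in vE_A^*v$ is a cycle. If $h(c)=c$ for all $h\in H$, then $h\mapsto h|_c$ is a group homomorphism $H\to H$. $H$ is $c$-stable if it stabilizes $c$ and this homomorphism is bijective. There is a unique maximal $c$-stable subgroup of $(G_B)_v$, denoted $G_c$. An orbit of a group action is free if all elements of the orbit have trivial stabilizer. Inverse semigroup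 and ample groupoid. $S=S_{(G,E)}$ is the inverse semigroup with zero generated by $E^0\cup E^1\cup\{e^*:e\in E^1\}\cup G\cup\{0\}$, with the multiplication of $G$ (undefined products being $0$; $g^*=g^{-1}$, $v^*=v$) and relations $e\,\mathbf s(e)=\mathbf r(e)e=e$ and correspondingly for $e^*$; $uv=0$ for distinct vertices; $e^*f=0$ for distinct edges; $e^*e=\mathbf s(e)$; $ge=g(e)\,g|_e$. Its nonzero elements are uniquely of the form $pgq^*$ with $p,q\in E^*$, $\mathbf s(p)=\mathbf s(q)$, $g\in (G)_{\mathbf s(p)}$. It acts by partial bijections $pgq^*:qE^\omega\to pE^\omega$, $qw\mapsto p\,g(w)$. The ample groupoid $\mathcal G_{(G,E)}$ has unit space $E^\omega$ (topology generated by the sets $pE^\omega$, $p\in E^*$) and consists of germs $[s,w]$, where $s=pgq^*\in S\setminus\{0\}$, $w\in qE^\omega$, and $[s,w]=[t,z]$ iff $w=z$ and $sx=tx$ in $S$ for some finite prefix $x$ of $w$; $[s,t(w)][t,w]=[st,w]$, $[s,w]^{-1}=[s^*,s(w)]$, source $w$, range $s(w)$; the topology is the quotient of the topology on the pairs $(s,w)$ with $S$ discrete. Algebras and ideals. $K\mathcal G$ is the Steinberg algebra: the $K$-algebra, under convolution, spanned by indicator functions of compact open bisections of $\mathcal G=\mathcal G_{(G,E)}$. Its singular ideal is $J_K=\{f\in K\mathcal G: \{\gamma:f(\gamma)\ne0\}\text{ has empty interior}\}$. $KS$ is the contracted semigroup algebra (basis $S\setminus\{0\}$); for $H\le (G)_v$,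 $KH\subseteq KS$ is the span of $H$. The surjective homomorphism $\varphi:KS\to K\mathcal G$ sends $s=pgq^*$ to the indicator function of $\{[s,w]:w\in qE^\omega\}$; its kernel is the tight ideal $T_K$, equal to the ideal generated by the elements $v-\sum_{e\in\mathbf r^{-1}(v)}ee^*$, $v\in E^0$. The singular ideal of $KS$ is $I_K=\varphi^{-1}(J_K)$. Elements of $T_K$ are called tight and elements of $I_K$ singular. *)

theory Defs
  imports
    "HOL-Analysis.Analysis"
    "HOL-Algebra.Elementary_Groups"
    "HOL-Algebra.Group_Action"
    "HOL-Algebra.Ring"
    "HOL-Library.Stream"
    "HOL-Library.Sublist"
begin

section \<open>Katsura pairs and their graphs\<close>

text \<open>
  The index set \<open>{1, \<dots>, N}\<close> is an arbitrary nonempty finite type \<open>'n\<close>, and matrices are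
  \<open>int^'n^'n\<close> with entry \<open>A $ u $ v\<close> in row \<open>u\<close> and column \<open>v\<close>.
\<close>

definition Katsura_pair :: "int^'n^'n \<Rightarrow> int^'n^'n \<Rightarrow> bool" where
  "Katsura_pair A B \<longleftrightarrow>
     (\<forall>u v. 0 \<le> A $ u $ v) \<and> (\<forall>u. \<exists>v. A $ u $ v \<noteq> 0) \<and>
     (\<forall>u v. A $ u $ v = 0 \<longrightarrow> B $ u $ v = 0)"

datatype 'n edge = Edge (rng: 'n) (src: 'n) (idx: int)

definition edges :: "int^'n^'n \<Rightarrow> 'n edge set" where
  "edges A = {Edge u v r | u v r. 0 \<le> r \<and> r < A $ u $ v}"

text \<open>
  A finite path is a pair of its range vertex and its list of edges, so that \<open>(v, [])\<close> is the
  vertex \<open>v\<close>.  Paths run from right to left: the source of an edge is the range of the next one.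
\<close>

type_synonym 'n path = "'n \<times> 'n edge list"

fun is_path :: "int^'n^'n \<Rightarrow> 'n path \<Rightarrow> bool" where
  "is_path A (v, []) \<longleftrightarrow> True"
| "is_path A (v, e # es) \<longleftrightarrow> e \<in> edges A \<and> rng e = v \<and> is_path A (src e, es)"

definition paths :: "int^'n^'n \<Rightarrow> 'n path set" where
  "paths A = {p. is_path A p}"

definition path_rng :: "'n path \<Rightarrow> 'n" where
  "path_rng p = fst p"

definition path_src :: "'n path \<Rightarrow> 'n" where
  "path_src p = (if snd p = [] then fst p else src (last (snd p)))"

definition vert :: "'n \<Rightarrow> 'n path" where
  "vert v = (v, [])"

definition path_append :: "'n path \<Rightarrow> 'n path \<Rightarrow> 'n path" where
  "path_append p q = (fst p, snd p @ snd q)"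

definition path_prefix :: "'n path \<Rightarrow> 'n path \<Rightarrow> bool" where
  "path_prefix p q \<longleftrightarrow> fst p = fst q \<and> prefix (snd p) (snd q)"

text \<open>If \<open>p\<close> is a prefix of \<open>q\<close>, then \<open>path_rest p q\<close> is the path \<open>x\<close> with \<open>q = p x\<close>.\<close>

definition path_rest :: "'n path \<Rightarrow> 'n path \<Rightarrow> 'n path" where
  "path_rest p q = (path_src p, drop (length (snd p)) (snd q))"

definition inf_paths :: "int^'n^'n \<Rightarrow> 'n edge stream set" where
  "inf_paths A = {w. \<forall>i. w !! i \<in> edges A \<and> src (w !! i) = rng (w !! Suc i)}"

text \<open>The set \<open>pE\<^sup>\<omega>\<close>; in particular \<open>cylinder A (vert v)\<close> is \<open>vE\<^sup>\<omega>\<close>.\<close>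

definition cylinder :: "int^'n^'n \<Rightarrow> 'n path \<Rightarrow> 'n edge stream set" where
  "cylinder A p =
     {w \<in> inf_paths A. rng (shd w) = fst p \<and> stake (length (snd p)) w = snd p}"

definition inf_prefix :: "nat \<Rightarrow> 'n edge stream \<Rightarrow> 'n path" where
  "inf_prefix k w = (rng (shd w), stake k w)"

definition cycle_path :: "int^'n^'n \<Rightarrow> 'n path \<Rightarrow> bool" where
  "cycle_path A c \<longleftrightarrow> c \<in> paths A \<and> snd c \<noteq> [] \<and> path_rng c = path_src c"

definition simple_cycle :: "int^'n^'n \<Rightarrow> 'n path \<Rightarrow> bool" where
  "simple_cycle A c \<longleftrightarrow>
     cycle_path A c \<and> \<not> (\<exists>d. cycle_path A d \<and> strict_subseq (snd d) (snd c))"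


section \<open>The faithful KEP-groupoid\<close>

text \<open>
  The element \<open>g\<^sub>u\<^sup>k\<close> of the cyclic group at \<open>u\<close> is represented by the integer \<open>k\<close>; the vertex
  is that of the path it acts on.  On an edge of the graph \<open>A $ u $ v\<close> is positive, so \<open>mod\<close>
  and \<open>div\<close> on \<open>int\<close> yield the unique remainder in \<open>{0..<A $ u $ v}\<close> and the matching quotient.
\<close>

definition edge_act :: "int^'n^'n \<Rightarrow> int^'n^'n \<Rightarrow> int \<Rightarrow> 'n edge \<Rightarrow> 'n edge" where
  "edge_act A B k e =
     Edge (rng e) (src e) ((k * B $ rng e $ src e + idx e) mod A $ rng e $ src e)"

definition edge_sect :: "int^'n^'n \<Rightarrow> int^'n^'n \<Rightarrow> int \<Rightarrow> 'n edge \<Rightarrow> int" where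
  "edge_sect A B k e = (k * B $ rng e $ src e + idx e) div A $ rng e $ src e"

primrec list_act :: "int^'n^'n \<Rightarrow> int^'n^'n \<Rightarrow> int \<Rightarrow> 'n edge list \<Rightarrow> 'n edge list" where
  "list_act A B k [] = []"
| "list_act A B k (e # es) = edge_act A B k e # list_act A B (edge_sect A B k e) es"

primrec list_sect :: "int^'n^'n \<Rightarrow> int^'n^'n \<Rightarrow> int \<Rightarrow> 'n edge list \<Rightarrow> int" where
  "list_sect A B k [] = k"
| "list_sect A B k (e # es) = list_sect A B (edge_sect A B k e) es"

definition int_act :: "int^'n^'n \<Rightarrow> int^'n^'n \<Rightarrow> int \<Rightarrow> 'n path \<Rightarrow> 'n path" where
  "int_act A B k p = (fst p, list_act A B k (snd p))"

primcorec stream_act :: "int^'n^'n \<Rightarrow> int^'n^'n \<Rightarrow> int \<Rightarrow> 'n edge stream \<Rightarrow> 'n edge stream" where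
  "stream_act A B k w =
     edge_act A B k (shd w) ## stream_act A B (edge_sect A B k (shd w)) (stl w)"

definition act_kernel :: "int^'n^'n \<Rightarrow> int^'n^'n \<Rightarrow> 'n \<Rightarrow> int set" where
  "act_kernel A B v = {k. \<forall>p\<in>paths A. path_rng p = v \<longrightarrow> int_act A B k p = p}"

text \<open>
  The vertex group \<open>(G\<^sub>B)\<^sub>v\<close>; its elements are cosets of integers, and the vertex \<open>v\<close>
  is carried along separately wherever these groups are used.
\<close>

definition vgroup :: "int^'n^'n \<Rightarrow> int^'n^'n \<Rightarrow> 'n \<Rightarrow> int set monoid" where
  "vgroup A B v = integer_group Mod act_kernel A B v"

definition to_vgroup :: "int^'n^'n \<Rightarrow> int^'n^'n \<Rightarrow> 'n \<Rightarrow> int \<Rightarrow> int set" where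
  "to_vgroup A B v k = act_kernel A B v #>\<^bsub>integer_group\<^esub> k"

definition vgen :: "int^'n^'n \<Rightarrow> int^'n^'n \<Rightarrow> 'n \<Rightarrow> int set" where
  "vgen A B v = to_vgroup A B v 1"

text \<open>
  The action and the sections descend to the quotients: for \<open>g \<in> (G\<^sub>B)\<^sub>v\<close> and a path with range
  \<open>v\<close> the images below are singletons.
\<close>

definition path_act :: "int^'n^'n \<Rightarrow> int^'n^'n \<Rightarrow> int set \<Rightarrow> 'n path \<Rightarrow> 'n path" where
  "path_act A B g p = the_elem ((\<lambda>k. int_act A B k p) ` g)"

definition sect :: "int^'n^'n \<Rightarrow> int^'n^'n \<Rightarrow> int set \<Rightarrow> 'n path \<Rightarrow> int set" where
  "sect A B g p = the_elem ((\<lambda>k. to_vgroup A B (path_src p) (list_sect A B k (snd p))) ` g)"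

definition inf_act :: "int^'n^'n \<Rightarrow> int^'n^'n \<Rightarrow> int set \<Rightarrow> 'n edge stream \<Rightarrow> 'n edge stream" where
  "inf_act A B g w = the_elem ((\<lambda>k. stream_act A B k w) ` g)"


section \<open>Stable subgroups and free orbits\<close>

text \<open>The path \<open>c\<close> is meant to be a cycle, with \<open>H\<close> contained in the group at its range.\<close>

definition stable_subgroup ::
    "int^'n^'n \<Rightarrow> int^'n^'n \<Rightarrow> 'n path \<Rightarrow> int set set \<Rightarrow> bool" where
  "stable_subgroup A B c H \<longleftrightarrow>
     subgroup H (vgroup A B (path_rng c)) \<and>
     (\<forall>h\<in>H. path_act A B h c = c) \<and>
     bij_betw (\<lambda>h. sect A B h c) H H"

definition max_stable :: "int^'n^'n \<Rightarrow> int^'n^'n \<Rightarrow> 'n path \<Rightarrow> int set set" where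
  "max_stable A B c =
     (THE H. stable_subgroup A B c H \<and>
             (\<forall>H'. stable_subgroup A B c H' \<and> H \<subseteq> H' \<longrightarrow> H' = H))"

definition free_orbit :: "('a, 'c) monoid_scheme \<Rightarrow> ('a \<Rightarrow> 'b \<Rightarrow> 'b) \<Rightarrow> 'b set \<Rightarrow> bool" where
  "free_orbit G \<phi> X \<longleftrightarrow> (\<forall>x\<in>X. stabilizer G \<phi> x = {\<one>\<^bsub>G\<^esub>})"

definition has_free_orbit :: "int^'n^'n \<Rightarrow> int^'n^'n \<Rightarrow> 'n \<Rightarrow> int set set \<Rightarrow> bool" where
  "has_free_orbit A B v H \<longleftrightarrow>
     (let G = (vgroup A B v)\<lparr>carrier := H\<rparr> in
      \<exists>X \<in> orbits G (cylinder A (vert v)) (inf_act A B). free_orbit G (inf_act A B) X)"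


section \<open>The inverse semigroup\<close>

text \<open>
  The inverse semigroup presented by vertices, edges, their adjoints and \<open>G\<close> is modelled by its
  normal forms: the nonzero element \<open>p g q\<^sup>*\<close> is the triple \<open>(p, g, q)\<close>.  The product of two such
  elements is an option, with \<open>None\<close> for zero.  Its two nonzero cases are
  \<open>p g q\<^sup>* (q x) h t\<^sup>* = p g(x) g|\<^sub>x h t\<^sup>*\<close> and, since \<open>x\<^sup>* h = (h\<^sup>-\<^sup>1 x)\<^sup>*\<close>,
  \<open>p g (r x)\<^sup>* r h t\<^sup>* = p g (h\<^sup>-\<^sup>1|\<^sub>x)\<^sup>-\<^sup>1 (t h\<^sup>-\<^sup>1(x))\<^sup>*\<close>; they agree when both apply.
\<close>

type_synonym 'n selt = "'n path \<times> int set \<times> 'n path"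

definition selts :: "int^'n^'n \<Rightarrow> int^'n^'n \<Rightarrow> 'n selt set" where
  "selts A B = {(p, g, q). p \<in> paths A \<and> q \<in> paths A \<and> path_src p = path_src q \<and>
                           g \<in> carrier (vgroup A B (path_src p))}"

fun selt_mult :: "int^'n^'n \<Rightarrow> int^'n^'n \<Rightarrow> 'n selt \<Rightarrow> 'n selt \<Rightarrow> 'n selt option" where
  "selt_mult A B (p, g, q) (r, h, t) =
     (if path_prefix q r then
        let x = path_rest q r in
        Some (path_append p (path_act A B g x),
              sect A B g x \<otimes>\<^bsub>vgroup A B (path_src x)\<^esub> h, t)
      else if path_prefix r q then
        let x = path_rest r q; h' = inv\<^bsub>vgroup A B (path_src r)\<^esub> h in
        Some (p, g \<otimes>\<^bsub>vgroup A B (path_src x)\<^esub> inv\<^bsub>vgroup A B (path_src x)\<^esub> (sect A B h' x),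
              path_append t (path_act A B h' x))
      else None)"

definition selt_of_path :: "int^'n^'n \<Rightarrow> int^'n^'n \<Rightarrow> 'n path \<Rightarrow> 'n selt" where
  "selt_of_path A B p =
     (p, \<one>\<^bsub>vgroup A B (path_src p)\<^esub>, vert (path_src p))"

definition selt_of_group :: "'n \<Rightarrow> int set \<Rightarrow> 'n selt" where
  "selt_of_group v g = (vert v, g, vert v)"

definition sdom :: "int^'n^'n \<Rightarrow> 'n selt \<Rightarrow> 'n edge stream set" where
  "sdom A s = cylinder A (snd (snd s))"

fun sapp :: "int^'n^'n \<Rightarrow> int^'n^'n \<Rightarrow> 'n selt \<Rightarrow> 'n edge stream \<Rightarrow> 'n edge stream" where
  "sapp A B (p, g, q) w = snd p @- inf_act A B g (sdrop (length (snd q)) w)"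


section \<open>The ample groupoid of germs\<close>

definition inf_topology :: "int^'n^'n \<Rightarrow> 'n edge stream topology" where
  "inf_topology A = topology_generated_by (cylinder A ` paths A)"

definition germ_pairs :: "int^'n^'n \<Rightarrow> int^'n^'n \<Rightarrow> ('n selt \<times> 'n edge stream) set" where
  "germ_pairs A B = Sigma (selts A B) (sdom A)"

definition germ_rel ::
    "int^'n^'n \<Rightarrow> int^'n^'n \<Rightarrow> (('n selt \<times> 'n edge stream) \<times> ('n selt \<times> 'n edge stream)) set" where
  "germ_rel A B =
     {((s, w), (t, z)). (s, w) \<in> germ_pairs A B \<and> (t, z) \<in> germ_pairs A B \<and> w = z \<and>
        (\<exists>k. selt_mult A B s (selt_of_path A B (inf_prefix k w)) =
             selt_mult A B t (selt_of_path A B (inf_prefix k w)))}"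

type_synonym 'n germ = "('n selt \<times> 'n edge stream) set"

definition germ :: "int^'n^'n \<Rightarrow> int^'n^'n \<Rightarrow> 'n selt \<Rightarrow> 'n edge stream \<Rightarrow> 'n germ" where
  "germ A B s w = germ_rel A B `` {(s, w)}"

definition germs :: "int^'n^'n \<Rightarrow> int^'n^'n \<Rightarrow> 'n germ set" where
  "germs A B = germ_pairs A B // germ_rel A B"

definition germ_src :: "'n germ \<Rightarrow> 'n edge stream" where
  "germ_src \<gamma> = the_elem (snd ` \<gamma>)"

definition germ_rng :: "int^'n^'n \<Rightarrow> int^'n^'n \<Rightarrow> 'n germ \<Rightarrow> 'n edge stream" where
  "germ_rng A B \<gamma> = the_elem ((\<lambda>(s, w). sapp A B s w) ` \<gamma>)"

text \<open>The product of composable germs, \<open>[s, t(w)] [t, w] = [st, w]\<close>.\<close>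

definition germ_mult :: "int^'n^'n \<Rightarrow> int^'n^'n \<Rightarrow> 'n germ \<Rightarrow> 'n germ \<Rightarrow> 'n germ" where
  "germ_mult A B \<alpha> \<beta> =
     the_elem {germ A B u w | s t u w.
                 (s, sapp A B t w) \<in> \<alpha> \<and> (t, w) \<in> \<beta> \<and> selt_mult A B s t = Some u}"

definition germ_units :: "int^'n^'n \<Rightarrow> int^'n^'n \<Rightarrow> 'n germ set" where
  "germ_units A B =
     {germ A B (selt_of_path A B (vert v)) w | v w. w \<in> cylinder A (vert v)}"

definition germ_pair_topology ::
    "int^'n^'n \<Rightarrow> int^'n^'n \<Rightarrow> ('n selt \<times> 'n edge stream) topology" where
  "germ_pair_topology A B =
     subtopology (prod_topology (discrete_topology (selts A B)) (inf_topology A)) (germ_pairs A B)"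

definition germ_topology :: "int^'n^'n \<Rightarrow> int^'n^'n \<Rightarrow> 'n germ topology" where
  "germ_topology A B =
     topology (\<lambda>U. U \<subseteq> germs A B \<and>
       openin (germ_pair_topology A B) {(s, w) \<in> germ_pairs A B. germ A B s w \<in> U})"

lemma openin_germ_topology:
  "openin (germ_topology A B) U \<longleftrightarrow>
     U \<subseteq> germs A B \<and>
     openin (germ_pair_topology A B) {(s, w) \<in> germ_pairs A B. germ A B s w \<in> U}"
proof -
  let ?pre = "\<lambda>U. {(s, w) \<in> germ_pairs A B. germ A B s w \<in> U}"
  have "istopology (\<lambda>U. U \<subseteq> germs A B \<and> openin (germ_pair_topology A B) (?pre U))"
    unfolding istopology_def
  proof (intro conjI allI impI)
    fix S T
    assume *: "S \<subseteq> germs A B \<and> openin (germ_pair_topology A B) (?pre S)"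
      "T \<subseteq> germs A B \<and> openin (germ_pair_topology A B) (?pre T)"
    then show "S \<inter> T \<subseteq> germs A B" by blast
    have eq: "?pre (S \<inter> T) = ?pre S \<inter> ?pre T" by auto
    show "openin (germ_pair_topology A B) (?pre (S \<inter> T))"
      unfolding eq using * by (intro openin_Int) auto
  next
    fix \<K>
    assume *: "\<forall>K\<in>\<K>. K \<subseteq> germs A B \<and> openin (germ_pair_topology A B) (?pre K)"
    then show "\<Union>\<K> \<subseteq> germs A B" by blast
    have eq: "?pre (\<Union>\<K>) = (\<Union>K\<in>\<K>. ?pre K)" by auto
    show "openin (germ_pair_topology A B) (?pre (\<Union>\<K>))"
      unfolding eq using * by (intro openin_Union) auto
  qed
  then show ?thesis
    by (simp add: germ_topology_def topology_inverse')
qed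


section \<open>The Steinberg algebra and the contracted semigroup algebra\<close>

text \<open>
  An open set on which source and range are injective is an open bisection.  The groupoid need
  not be Hausdorff, and \<open>compactin\<close> is the plain covering property.
\<close>

definition compact_open_bisection :: "int^'n^'n \<Rightarrow> int^'n^'n \<Rightarrow> 'n germ set \<Rightarrow> bool" where
  "compact_open_bisection A B U \<longleftrightarrow>
     openin (germ_topology A B) U \<and> compactin (germ_topology A B) U \<and>
     inj_on germ_src U \<and> inj_on (germ_rng A B) U"

definition convolution ::
    "int^'n^'n \<Rightarrow> int^'n^'n \<Rightarrow> ('n germ \<Rightarrow> 'k::field) \<Rightarrow> ('n germ \<Rightarrow> 'k) \<Rightarrow> 'n germ \<Rightarrow> 'k" where
  "convolution A B f1 f2 =
     (\<lambda>\<gamma>. \<Sum>(\<alpha>, \<beta>) | \<alpha> \<in> germs A B \<and> \<beta> \<in> germs A B \<and> germ_src \<alpha> = germ_rng A B \<beta> \<and>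
                      germ_mult A B \<alpha> \<beta> = \<gamma> \<and> f1 \<alpha> \<noteq> 0 \<and> f2 \<beta> \<noteq> 0.
            f1 \<alpha> * f2 \<beta>)"

definition steinberg :: "int^'n^'n \<Rightarrow> int^'n^'n \<Rightarrow> ('n germ \<Rightarrow> 'k::field) ring" where
  "steinberg A B =
     \<lparr>carrier = {\<lambda>\<gamma>. \<Sum>U\<in>F. c U * indicator U \<gamma> | F c.
                   finite F \<and> (\<forall>U\<in>F. compact_open_bisection A B U)},
      mult = convolution A B,
      one = indicator (germ_units A B),
      zero = (\<lambda>_. 0),
      add = (\<lambda>f1 f2 \<gamma>. f1 \<gamma> + f2 \<gamma>)\<rparr>"

definition singular_ideal :: "int^'n^'n \<Rightarrow> int^'n^'n \<Rightarrow> ('n germ \<Rightarrow> 'k::field) set" where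
  "singular_ideal A B =
     {f \<in> carrier (steinberg A B).
        germ_topology A B interior_of {\<gamma> \<in> germs A B. f \<gamma> \<noteq> 0} = {}}"

definition KS :: "int^'n^'n \<Rightarrow> int^'n^'n \<Rightarrow> ('n selt \<Rightarrow> 'k::field) set" where
  "KS A B = {a. finite {s. a s \<noteq> 0} \<and> {s. a s \<noteq> 0} \<subseteq> selts A B}"

definition KS_mult ::
    "int^'n^'n \<Rightarrow> int^'n^'n \<Rightarrow> ('n selt \<Rightarrow> 'k::field) \<Rightarrow> ('n selt \<Rightarrow> 'k) \<Rightarrow> 'n selt \<Rightarrow> 'k" where
  "KS_mult A B a b =
     (\<lambda>u. \<Sum>(s, t) | a s \<noteq> 0 \<and> b t \<noteq> 0 \<and> selt_mult A B s t = Some u. a s * b t)"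

definition basis_elt :: "'n selt \<Rightarrow> 'n selt \<Rightarrow> 'k::field" where
  "basis_elt s = (\<lambda>t. if t = s then 1 else 0)"

text \<open>
  The subalgebra \<open>KH\<close> of \<open>KS\<close> for a subgroup \<open>H\<close> of \<open>(G\<^sub>B)\<^sub>v\<close>.  Its identity is \<open>v\<close>, not that of
  \<open>KS\<close>.
\<close>

definition group_algebra ::
    "int^'n^'n \<Rightarrow> int^'n^'n \<Rightarrow> 'n \<Rightarrow> int set set \<Rightarrow> ('n selt \<Rightarrow> 'k::field) ring" where
  "group_algebra A B v H =
     \<lparr>carrier = {a \<in> KS A B. {s. a s \<noteq> 0} \<subseteq> selt_of_group v ` H},
      mult = KS_mult A B,
      one = basis_elt (selt_of_path A B (vert v)),
      zero = (\<lambda>_. 0),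
      add = (\<lambda>a b s. a s + b s)\<rparr>"

definition quotient_hom ::
    "int^'n^'n \<Rightarrow> int^'n^'n \<Rightarrow> ('n selt \<Rightarrow> 'k::field) \<Rightarrow> 'n germ \<Rightarrow> 'k" where
  "quotient_hom A B a =
     (\<lambda>\<gamma>. \<Sum>s | a s \<noteq> 0. a s * indicator (germ A B s ` sdom A s) \<gamma>)"

definition tight :: "int^'n^'n \<Rightarrow> int^'n^'n \<Rightarrow> ('n selt \<Rightarrow> 'k::field) set" where
  "tight A B = {a \<in> KS A B. quotient_hom A B a = \<zero>\<^bsub>steinberg A B\<^esub>}"

definition singular :: "int^'n^'n \<Rightarrow> int^'n^'n \<Rightarrow> ('n selt \<Rightarrow> 'k::field) set" where
  "singular A B = {a \<in> KS A B. quotient_hom A B a \<in> singular_ideal A B}"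

text \<open>
  The product of \<open>v - g\<^sub>v\<^sup>d\<^sup>n\<close> over the proper divisors \<open>d\<close> of the order \<open>m\<close> of a subgroup \<open>H\<close>,
  taken in the commutative algebra \<open>KH\<close>.
\<close>

definition divisor_product ::
    "int^'n^'n \<Rightarrow> int^'n^'n \<Rightarrow> 'n \<Rightarrow> int set set \<Rightarrow> int \<Rightarrow> 'n selt \<Rightarrow> 'k::field" where
  "divisor_product A B v H n =
     finprod (group_algebra A B v H)
       (\<lambda>d s. basis_elt (selt_of_path A B (vert v)) s -
              basis_elt (selt_of_group v (vgen A B v [^]\<^bsub>vgroup A B v\<^esub> (int d * n))) s)
       {d. 1 \<le> d \<and> d < card H \<and> d dvd card H}"

end

theory Submission
  imports Defs "HOL-Algebra.Algebraic_Closure_Type" "HOL-Number_Theory.Totient"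
begin

text \<open>
  Write \<open>N\<^sub>w\<close> for the subgroup of those elements of \<open>(G\<^sub>B)\<^sub>v\<close> that fix a prefix of \<open>w \<in> vE\<^sup>\<omega>\<close> with trivial
  section, that is, whose germ at \<open>w\<close> is a unit.  The image of \<open>a = \<Sum>\<^sub>g a\<^sub>g g \<in> K(G\<^sub>B)\<^sub>v\<close> in the Steinberg
  algebra takes at the germ of \<open>g\<close> at \<open>w\<close> the sum of \<open>a\<close> over the coset \<open>g N\<^sub>w\<close>.  So it vanishes if all
  these sums do, and it is singular if they all vanish for \<open>w\<close> in a dense set.  Throughout, an element
  of \<open>(G\<^sub>B)\<^sub>v\<close> is represented by an exponent of \<open>g\<^sub>v\<close>; the preimage of \<open>N\<^sub>w\<close> in \<open>\<int>\<close> is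
  \<open>inf_germ_kernel\<close>, and \<open>germ_eq_same_dom\<close> relates it to equality of germs.

  Suppose that a nonzero function \<open>f\<close> is singular.  Around an infinite path \<open>w\<close> that is the source of a
  germ with \<open>f \<noteq> 0\<close>, the compact open bisections that make up \<open>f\<close> are given by single elements
  \<open>p g x\<^sup>*\<close> with a common prefix \<open>x\<close> of \<open>w\<close> (\<open>bisection_near_path\<close>), so \<open>f\<close> is described there by an
  element of a group algebra (\<open>singular_ideal_imp_singular_data\<close>).  The argument now moves along \<open>w\<close>.
  If some finite path distinguishes all elements of the support, then a coefficient survives
  on an open set, which contradicts singularity (\<open>no_separating_path\<close>).  An infinite cyclic group always has
  such a path, hence all groups along \<open>w\<close> are finite.  The stabilizers of the prefixes of \<open>w\<close> decrease
  and their germ kernels increase, so beyond some point sections carry the stabilizer, modulo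
  the germ kernel, isomorphically from vertex to vertex.  Its images are the unique subgroups of a fixed order
  in finite cyclic groups and depend only on the vertex.  Two consecutive visits of \<open>w\<close> to one vertex, as
  close together as possible, bound a simple cycle \<open>c\<close> on which this subgroup is stable.  A free orbit of the
  larger group \<open>G\<^sub>c\<close> would again give a distinguishing path (\<open>singular_data_imp_cycle\<close>).

  Conversely let \<open>G\<^sub>c\<close> have no free orbit and order \<open>m\<close>.  Choose an extension of a given path whose
  stabilizer in \<open>G\<^sub>c\<close> is as small as possible.  The stabilizer is nontrivial and fixes all further
  extensions, so its sections act trivially and are trivial, because the groupoid is faithful.  Hence it lies
  in the germ kernel (\<open>no_free_orbit_kernel\<close>), and the factor of the product \<open>a\<close> that belongs to it
  kills all coset sums on an open set; so \<open>a\<close> is singular.  On the other hand, sections along \<open>c\<close> are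
  injective on \<open>G\<^sub>c\<close>, hence \<open>G\<^sub>c\<close> meets \<open>N\<^sub>w\<close> trivially for \<open>w = ccc\<dots>\<close>, and \<open>a\<close> is not tight if it
  is nonzero in \<open>KG\<^sub>c = K[t]/(t^m - 1)\<close>.  That is \<open>root_poly_not_dvd\<close>, which compares the multiplicities of a
  suitable root of unity and holds in every characteristic.
\<close>

no_notation fps_nth (infixl "$" 75)

section \<open>Integers acting on paths\<close>

lemma is_path_append:
  "is_path A (v, xs @ ys) \<longleftrightarrow> is_path A (v, xs) \<and> is_path A (path_src (v, xs), ys)"
  by (induction xs arbitrary: v) (auto simp: path_src_def)

lemma path_src_Nil [simp]: "path_src (v, []) = v"
  by (simp add: path_src_def)

lemma path_src_Cons [simp]: "path_src (v, e # es) = path_src (src e, es)"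
  by (simp add: path_src_def)

lemma path_src_append [simp]: "path_src (v, xs @ ys) = path_src (path_src (v, xs), ys)"
  by (induction xs arbitrary: v) auto

lemma list_act_append:
  "list_act A B k (xs @ ys) = list_act A B k xs @ list_act A B (list_sect A B k xs) ys"
  by (induction xs arbitrary: k) auto

lemma list_sect_append:
  "list_sect A B k (xs @ ys) = list_sect A B (list_sect A B k xs) ys"
  by (induction xs arbitrary: k) auto

lemma length_list_act [simp]: "length (list_act A B k xs) = length xs"
  by (induction xs arbitrary: k) auto

lemma edge_act_simps [simp]:
  "rng (edge_act A B k e) = rng e" "src (edge_act A B k e) = src e"
  by (simp_all add: edge_act_def)

lemma path_src_list_act [simp]: "path_src (v, list_act A B k xs) = path_src (v, xs)"
  by (induction xs arbitrary: v k) auto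

lemma stake_stream_act: "stake n (stream_act A B k w) = list_act A B k (stake n w)"
  by (induction n arbitrary: k w) auto

lemma stream_eqI_stake:
  assumes "\<And>n. stake n w = stake n z"
  shows "w = z"
proof -
  have "w !! n = z !! n" for n
    using assms[of "Suc n"] by (metis lessI stake_nth)
  then show ?thesis
    by (metis smap_alt stream.map_id0 eq_id_iff)
qed

lemma stream_act_shift:
  "stream_act A B k (xs @- w) = list_act A B k xs @- stream_act A B (list_sect A B k xs) w"
proof (induction xs arbitrary: k)
  case (Cons x xs)
  then show ?case
    by (subst stream_act.code) simp
qed simp

lemma ex_edge_index: "e \<in> edges A \<longleftrightarrow> 0 \<le> idx e \<and> idx e < A $ rng e $ src e"
  by (cases e) (auto simp: edges_def)

lemma finite_edges: "finite (edges (A :: int^'n^'n))"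
proof -
  have "edges A \<subseteq> (\<Union>u. \<Union>v. Edge u v ` {0..<A $ u $ v})"
    by (force simp: edges_def)
  then show ?thesis
    by (rule finite_subset) auto
qed

lemma int_subgroup_generator:
  fixes S :: "int set"
  assumes "0 \<in> S" "\<And>a b. a \<in> S \<Longrightarrow> b \<in> S \<Longrightarrow> a - b \<in> S"
  obtains d where "d \<ge> 0" "S = {k. d dvd k}"
proof (cases "S = {0}")
  case True
  then show ?thesis
    using that[of 0] by auto
next
  case False
  have neg: "- a \<in> S" if "a \<in> S" for a
    using assms(2)[OF assms(1) that] by simp
  have add: "a + b \<in> S" if "a \<in> S" "b \<in> S" for a b
    using assms(2)[OF that(1) neg[OF that(2)]] by simp
  obtain s where "s \<in> S" "s > 0"
    using False assms(1) neg by (metis neg_0_less_iff_less not_less_iff_gr_or_eq subsetI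
        subset_singletonD empty_iff insert_iff)
  then have "\<exists>n::nat. n > 0 \<and> int n \<in> S"
    by (intro exI[of _ "nat s"]) auto
  then obtain n :: nat where n: "n > 0" "int n \<in> S" "\<forall>m<n. \<not> (m > 0 \<and> int m \<in> S)"
    using exists_least_iff[of "\<lambda>n. n > 0 \<and> int n \<in> S"] by blast
  have least: "n \<le> m" if "m > 0" "int m \<in> S" for m
    using n(3) that by (metis not_le)
  have mult: "int n * q \<in> S" for q
  proof (induction q rule: int_induct[where k = 0])
    case (step1 i)
    then show ?case
      using add[OF _ n(2)] by (simp add: distrib_left)
  next
    case (step2 i)
    then show ?case
      using assms(2)[OF _ n(2)] by (simp add: right_diff_distrib)
  qed (simp add: assms(1))
  have "k \<in> S \<longleftrightarrow> int n dvd k" for k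
  proof
    assume k: "k \<in> S"
    have "k mod int n = k - int n * (k div int n)"
      by (simp add: minus_mult_div_eq_mod)
    then have "k mod int n \<in> S"
      using assms(2)[OF k mult] by simp
    moreover have "0 \<le> k mod int n" "k mod int n < int n"
      using n by auto
    ultimately have "k mod int n = 0"
      using least[of "nat (k mod int n)"] by (cases "k mod int n = 0") auto
    then show "int n dvd k"
      by auto
  qed (use mult in auto)
  then show ?thesis
    using that[of "int n"] by auto
qed

text \<open>
  These elements of \<open>(G\<^sub>B)\<^sub>v\<close>, given by exponents of \<open>g\<^sub>v\<close>, have the germ of the unit \<open>v\<close> at every infinite
  path that starts with \<open>xs\<close>.
\<close>

definition germ_kernel :: "int^'n^'n \<Rightarrow> int^'n^'n \<Rightarrow> 'n \<Rightarrow> 'n edge list \<Rightarrow> int set" where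
  "germ_kernel A B v xs =
     {k. list_act A B k xs = xs \<and> list_sect A B k xs \<in> act_kernel A B (path_src (v, xs))}"

definition inf_germ_kernel :: "int^'n^'n \<Rightarrow> int^'n^'n \<Rightarrow> 'n \<Rightarrow> 'n edge stream \<Rightarrow> int set" where
  "inf_germ_kernel A B v w = (\<Union>n. germ_kernel A B v (stake n w))"

locale katsura =
  fixes A B :: "int^'n^'n"
  assumes Katsura: "Katsura_pair A B"
begin

abbreviation "act \<equiv> list_act A B"
abbreviation "sec \<equiv> list_sect A B"
abbreviation "ker \<equiv> act_kernel A B"
abbreviation "fpath v xs \<equiv> is_path A (v, xs)"
abbreviation "ipath v w \<equiv> w \<in> cylinder A (vert v)"
abbreviation "N \<equiv> germ_kernel A B"
abbreviation "Ninf \<equiv> inf_germ_kernel A B"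

lemma edge_pos: "e \<in> edges A \<Longrightarrow> 0 < A $ rng e $ src e"
  by (auto simp: ex_edge_index)

lemma edge_act_edges: "e \<in> edges A \<Longrightarrow> edge_act A B k e \<in> edges A"
  using edge_pos by (auto simp: ex_edge_index edge_act_def)

lemma edge_div_mod:
  "k * B $ rng e $ src e + idx e =
     edge_sect A B k e * A $ rng e $ src e + idx (edge_act A B k e)"
  by (simp add: edge_act_def edge_sect_def div_mult_mod_eq)

lemma edge_add:
  assumes "e \<in> edges A"
  shows "edge_act A B (j + k) e = edge_act A B j (edge_act A B k e)"
    and "edge_sect A B (j + k) e = edge_sect A B j (edge_act A B k e) + edge_sect A B k e"
proof -
  define a where "a = A $ rng e $ src e"
  define b where "b = B $ rng e $ src e"
  have a: "a > 0"
    using edge_pos[OF assms] by (simp add: a_def)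
  have eq: "(j + k) * b + idx e = (j * b + idx (edge_act A B k e)) + edge_sect A B k e * a"
    using edge_div_mod[of k e] by (simp add: a_def b_def algebra_simps)
  show "edge_act A B (j + k) e = edge_act A B j (edge_act A B k e)"
    using eq by (simp add: edge_act_def[of A B "j + k"] edge_act_def[of A B j] a_def b_def)
  show "edge_sect A B (j + k) e = edge_sect A B j (edge_act A B k e) + edge_sect A B k e"
    using eq a by (simp add: edge_sect_def[of A B "j + k"] edge_sect_def[of A B j] a_def b_def)
qed

lemma edge_zero:
  assumes "e \<in> edges A"
  shows "edge_act A B 0 e = e" "edge_sect A B 0 e = 0"
  using assms by (cases e; simp add: ex_edge_index edge_act_def edge_sect_def)+

lemma path_act: "fpath v xs \<Longrightarrow> fpath v (act k xs)"
  by (induction xs arbitrary: v k) (auto simp: edge_act_edges)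

lemma act_add: "fpath v xs \<Longrightarrow> act (j + k) xs = act j (act k xs)"
  and sec_add: "fpath v xs \<Longrightarrow> sec (j + k) xs = sec j (act k xs) + sec k xs"
  by (induction xs arbitrary: v j k) (auto simp: edge_add)

lemma act_zero: "fpath v xs \<Longrightarrow> act 0 xs = xs"
  and sec_zero: "fpath v xs \<Longrightarrow> sec 0 xs = 0"
  by (induction xs arbitrary: v) (auto simp: edge_zero)

lemma act_diff_fix:
  assumes "fpath v xs"
  shows "act (j - k) xs = xs \<longleftrightarrow> act j xs = act k xs"
    and "act k xs = xs \<Longrightarrow> sec (j - k) xs = sec j xs - sec k xs"
proof -
  show "act (j - k) xs = xs \<longleftrightarrow> act j xs = act k xs"
    using act_add[OF assms, of k "j - k"] act_add[OF assms, of "- k" k]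
      act_add[OF assms, of "- k" j] act_zero[OF assms] by (metis add.commute diff_add_cancel
        left_minus uminus_add_conv_diff)
  show "sec (j - k) xs = sec j xs - sec k xs" if "act k xs = xs"
    using sec_add[OF assms, of "j - k" k] that by simp
qed

lemma act_mult_fix:
  assumes "fpath v xs" "act k xs = xs"
  shows "act (i * k) xs = xs \<and> sec (i * k) xs = i * sec k xs"
proof (induction i rule: int_induct[where k = 0])
  case base
  then show ?case
    using act_zero sec_zero assms by simp
next
  case (step1 i)
  have "(i + 1) * k = i * k + k"
    by (simp add: algebra_simps)
  with step1 show ?case
    using act_add[OF assms(1), of "i * k" k] sec_add[OF assms(1), of "i * k" k] assms(2)
    by (simp add: distrib_right)
next
  case (step2 i)
  have "(i - 1) * k = i * k - k"
    by (simp add: algebra_simps)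
  moreover have "act (i * k - k) xs = xs"
    using act_diff_fix(1)[OF assms(1)] step2 assms(2) by presburger
  moreover have "sec (i * k - k) xs = i * sec k xs - sec k xs"
    using act_diff_fix(2)[OF assms] step2 by presburger
  ultimately show ?case
    by (simp only: left_diff_distrib mult_1)
qed

text \<open>
  Sections of \<open>j\<close> and \<open>k\<close> along a path with equal images differ by the section of \<open>j - k\<close>, since
  \<open>k + (j - k)\<close> first applies \<open>j - k\<close>, which fixes the path.
\<close>

lemma sec_diff:
  assumes "fpath v xs" "act j xs = act k xs"
  shows "sec j xs - sec k xs = sec (j - k) xs"
  using sec_add[OF assms(1), of k "j - k"] act_diff_fix(1)[OF assms(1), of j k] assms(2) by simp

lemma ker_iff: "k \<in> ker v \<longleftrightarrow> (\<forall>xs. fpath v xs \<longrightarrow> act k xs = xs)"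
  by (auto simp: act_kernel_def paths_def path_rng_def int_act_def)

lemma ker_zero [simp]: "0 \<in> ker v"
  by (auto simp: ker_iff act_zero)

lemma ker_diff: "j \<in> ker v \<Longrightarrow> k \<in> ker v \<Longrightarrow> j - k \<in> ker v"
  by (auto simp: ker_iff act_diff_fix)

lemma ker_uminus: "k \<in> ker v \<Longrightarrow> - k \<in> ker v"
  using ker_diff[OF ker_zero] by simp

lemma ker_add: "j \<in> ker v \<Longrightarrow> k \<in> ker v \<Longrightarrow> j + k \<in> ker v"
  using ker_diff[of j v "- k"] ker_uminus by simp

lemma ker_mult: "k \<in> ker v \<Longrightarrow> i * k \<in> ker v"
  by (auto simp: ker_iff dest: act_mult_fix)

lemma ker_generator:
  obtains d where "d \<ge> 0" "ker v = {k. d dvd k}"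
  using int_subgroup_generator[of "ker v"] ker_diff ker_zero by metis

lemma ker_sec:
  assumes "k \<in> ker v" "fpath v xs"
  shows "sec k xs \<in> ker (path_src (v, xs))"
  unfolding ker_iff
proof (intro allI impI)
  fix ys assume "fpath (path_src (v, xs)) ys"
  then have "fpath v (xs @ ys)"
    using assms(2) by (simp add: is_path_append)
  then have "act k (xs @ ys) = xs @ ys"
    using assms(1) by (auto simp: ker_iff)
  then show "act (sec k xs) ys = ys"
    by (simp add: list_act_append)
qed

lemma ker_subset_N: "fpath v xs \<Longrightarrow> ker v \<subseteq> N v xs"
  by (auto simp: germ_kernel_def ker_sec) (auto simp: ker_iff)

lemma N_append: "fpath v (xs @ ys) \<Longrightarrow> N v xs \<subseteq> N v (xs @ ys)"
  by (auto simp: germ_kernel_def list_act_append list_sect_append is_path_append ker_sec)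
     (auto simp: ker_iff)

lemma N_diff:
  assumes "fpath v xs" "j \<in> N v xs" "k \<in> N v xs"
  shows "j - k \<in> N v xs"
  using assms by (auto simp: germ_kernel_def act_diff_fix ker_diff)

lemma N_mult:
  assumes "fpath v xs" "k \<in> N v xs"
  shows "i * k \<in> N v xs"
  using assms act_mult_fix[OF assms(1), of k i] by (auto simp: germ_kernel_def ker_mult)

section \<open>Infinite paths\<close>

lemma ipath_iff: "ipath v w \<longleftrightarrow> (\<forall>n. fpath v (stake n w))"
proof
  assume w: "ipath v w"
  show "\<forall>n. fpath v (stake n w)"
  proof
    fix n
    have "fpath v (stake n w) \<and> path_src (v, stake n w) = rng (w !! n)"
    proof (induction n)
      case 0
      then show ?case
        using w by (simp add: cylinder_def vert_def)
    next
      case (Suc n)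
      then show ?case
        using w by (auto simp: stake_Suc is_path_append cylinder_def inf_paths_def
            simp del: stake.simps(2))
    qed
    then show "fpath v (stake n w)" by blast
  qed
next
  assume w: "\<forall>n. fpath v (stake n w)"
  have e: "w !! n \<in> edges A \<and> rng (w !! n) = path_src (v, stake n w)" for n
    using w[rule_format, of "Suc n"]
    by (auto simp: stake_Suc is_path_append simp del: stake.simps(2))
  have "src (w !! n) = rng (w !! Suc n)" for n
    using e[of "Suc n"] by (simp add: stake_Suc del: stake.simps(2))
  with e have "w \<in> inf_paths A"
    by (auto simp: inf_paths_def)
  moreover have "rng (shd w) = v"
    using e[of 0] by simp
  ultimately show "ipath v w"
    by (simp add: cylinder_def vert_def)
qed

lemma ipath_stake: "ipath v w \<Longrightarrow> fpath v (stake n w)"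
  by (simp add: ipath_iff)

lemma cylinder_iff: "w \<in> cylinder A (v, xs) \<longleftrightarrow> ipath v w \<and> stake (length xs) w = xs"
  by (auto simp: cylinder_def vert_def)

lemma ipath_sdrop:
  assumes "ipath v w"
  shows "ipath (path_src (v, stake n w)) (sdrop n w)"
  unfolding ipath_iff
proof
  fix m
  have "fpath v (stake n w @ stake m (sdrop n w))"
    using ipath_stake[OF assms] by simp
  then show "fpath (path_src (v, stake n w)) (stake m (sdrop n w))"
    by (simp add: is_path_append del: stake_add)
qed

lemma ipath_shift:
  assumes "fpath v xs"
  shows "ipath v (xs @- w) \<longleftrightarrow> ipath (path_src (v, xs)) w"
proof
  assume "ipath v (xs @- w)"
  from ipath_sdrop[OF this, of "length xs"] show "ipath (path_src (v, xs)) w"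
    by (simp add: stake_shift sdrop_shift)
next
  assume w: "ipath (path_src (v, xs)) w"
  show "ipath v (xs @- w)"
    unfolding ipath_iff
  proof
    fix n
    have "fpath v (xs @ stake n w)"
      using assms w by (auto simp: is_path_append ipath_iff)
    moreover have "xs @ stake n w = stake (length xs + n) (xs @- w)"
      by (simp add: stake_shift)
    moreover have "\<dots> = stake n (xs @- w) @ stake (length xs) (sdrop n (xs @- w))"
      by (simp add: add.commute)
    ultimately show "fpath v (stake n (xs @- w))"
      by (simp add: is_path_append del: stake_add)
  qed
qed

lemma cylinderE:
  assumes "w \<in> cylinder A (v, xs)"
  obtains z where "w = xs @- z" "fpath v xs" "ipath (path_src (v, xs)) z"
  using assms ipath_sdrop[of w v "length xs"] ipath_stake[of w v "length xs"]
  by (metis cylinder_iff stake_sdrop)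

lemma shift_in_cylinder:
  "fpath v xs \<Longrightarrow> ipath (path_src (v, xs)) z \<Longrightarrow> xs @- z \<in> cylinder A (v, xs)"
  by (simp add: cylinder_iff ipath_shift stake_shift)

text \<open>Since \<open>A\<close> has no zero row, every vertex is the range of an edge, so paths can be prolonged.\<close>

lemma ex_edge: "\<exists>e\<in>edges A. rng e = v"
proof -
  obtain u where "A $ v $ u \<noteq> 0" "0 \<le> A $ v $ u"
    using Katsura unfolding Katsura_pair_def by blast
  then have "Edge v u 0 \<in> edges A"
    by (auto simp: edges_def)
  then show ?thesis
    by force
qed

text \<open>
  Infinite paths arise from finite ones by repeatedly adding an edge that preserves a property: mere
  existence of an edge for \<open>ex_ipath\<close>, the lack of a finite subcover for compactness.
\<close>

lemma limit_of_paths: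
  assumes P: "P []" "\<And>xs. P xs \<Longrightarrow> fpath v xs"
    and step: "\<And>xs. P xs \<Longrightarrow> \<exists>e. P (xs @ [e])"
  obtains w where "ipath v w" "\<And>n. P (stake n w)"
proof -
  obtain f where f: "f 0 = []" "\<And>n. P (f n)" "\<And>n. \<exists>e. f (Suc n) = f n @ [e]"
    using dependent_nat_choice[of "\<lambda>n xs. P xs \<and> (n = 0 \<longrightarrow> xs = [])" "\<lambda>n xs ys. \<exists>e. ys = xs @ [e]"]
      P(1) step by (metis nat.distinct(1))
  define w where "w = smap (\<lambda>n. last (f (Suc n))) nats"
  have len: "length (f n) = n" for n
    by (induction n) (use f in \<open>auto, metis length_append_singleton\<close>)
  have w: "stake n w = f n" for n
  proof (induction n)
    case (Suc n)
    have "w !! n = last (f (Suc n))"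
      by (simp add: w_def)
    with Suc f(3)[of n] show ?case
      by (auto simp: stake_Suc simp del: stake.simps(2))
  qed (simp add: f)
  show ?thesis
  proof
    show "ipath v w"
      using f(2) P(2) w by (simp add: ipath_iff)
    show "P (stake n w)" for n
      using f(2) w by simp
  qed
qed

lemma ex_ipath: "\<exists>w. ipath v w"
proof -
  obtain w where "ipath v w"
  proof (rule limit_of_paths[of "fpath v" v])
    show "\<exists>e. fpath v (xs @ [e])" if "fpath v xs" for xs
      using ex_edge[of "path_src (v, xs)"] that by (auto simp: is_path_append)
  qed auto
  then show ?thesis
    by blast
qed

lemma cylinder_nonempty:
  assumes "fpath v xs"
  shows "\<exists>w. w \<in> cylinder A (v, xs)"
  using ex_ipath[of "path_src (v, xs)"] shift_in_cylinder[OF assms] by blast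

lemma cylinder_antimono: "cylinder A (v, xs @ ys) \<subseteq> cylinder A (v, xs)"
proof
  fix w assume w: "w \<in> cylinder A (v, xs @ ys)"
  then have "take (length xs) (stake (length (xs @ ys)) w) = xs"
    by (simp add: cylinder_iff)
  then show "w \<in> cylinder A (v, xs)"
    using w by (simp add: cylinder_iff take_stake)
qed

lemma stake_prefix:
  assumes "m \<le> n"
  obtains ys where "stake n w = stake m w @ ys"
proof
  show "stake n w = stake m w @ stake (n - m) (sdrop m w)"
    using assms by simp
qed

lemma N_stake_mono:
  assumes "ipath v w" "m \<le> n"
  shows "N v (stake m w) \<subseteq> N v (stake n w)"
proof -
  obtain ys where "stake n w = stake m w @ ys"
    using assms(2) by (rule stake_prefix)
  then show ?thesis
    using N_append[of v "stake m w" ys] ipath_stake[OF assms(1), of n] by simp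
qed

text \<open>Germ kernels grow with the prefix, so only prefixes that contain \<open>xs\<close> have to be considered.\<close>

lemma Ninf_shift:
  assumes "fpath v xs" "ipath (path_src (v, xs)) z"
  shows "k \<in> Ninf v (xs @- z) \<longleftrightarrow> act k xs = xs \<and> sec k xs \<in> Ninf (path_src (v, xs)) z"
proof -
  have w: "ipath v (xs @- z)"
    using assms by (simp add: ipath_shift)
  have "k \<in> Ninf v (xs @- z) \<longleftrightarrow> (\<exists>n. k \<in> N v (stake (length xs + n) (xs @- z)))"
    unfolding inf_germ_kernel_def using N_stake_mono[OF w, OF le_add2] by blast
  also have "\<dots> \<longleftrightarrow> (\<exists>n. k \<in> N v (xs @ stake n z))"
    by (simp add: stake_shift)
  also have "\<dots> \<longleftrightarrow> act k xs = xs \<and> sec k xs \<in> Ninf (path_src (v, xs)) z"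
    by (auto simp: germ_kernel_def inf_germ_kernel_def list_act_append list_sect_append)
  finally show ?thesis .
qed

lemma Ninf_fixes:
  assumes "ipath v w" "k \<in> Ninf v w"
  shows "act k (stake n w) = stake n w"
proof -
  obtain m where "k \<in> N v (stake m w)"
    using assms(2) by (auto simp: inf_germ_kernel_def)
  then have "k \<in> N v (stake (max m n) w)"
    using N_stake_mono[OF assms(1), of m "max m n"] by auto
  then have "act k (stake (max m n) w) = stake (max m n) w"
    by (simp add: germ_kernel_def)
  moreover obtain ys where "stake (max m n) w = stake n w @ ys"
    using stake_prefix[of n "max m n" w] by auto
  ultimately show ?thesis
    by (simp add: list_act_append)
qed

lemma N_subset_Ninf: "N v (stake n w) \<subseteq> Ninf v w"
  by (auto simp: inf_germ_kernel_def)

lemma ker_subset_Ninf: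
  assumes "ipath v w"
  shows "ker v \<subseteq> Ninf v w"
  using ker_subset_N[OF ipath_stake[OF assms, of 0]] N_subset_Ninf by blast

lemma Ninf_diff:
  assumes "ipath v w" "j \<in> Ninf v w" "k \<in> Ninf v w"
  shows "j - k \<in> Ninf v w"
proof -
  obtain m n where "j \<in> N v (stake m w)" "k \<in> N v (stake n w)"
    using assms by (auto simp: inf_germ_kernel_def)
  then have "j - k \<in> N v (stake (max m n) w)"
    using N_stake_mono[OF assms(1), of m "max m n"] N_stake_mono[OF assms(1), of n "max m n"]
    by (intro N_diff[OF ipath_stake[OF assms(1)]]) auto
  then show ?thesis
    using N_subset_Ninf by blast
qed

lemma Ninf_add:
  assumes "ipath v w" "j \<in> Ninf v w" "k \<in> Ninf v w"
  shows "j + k \<in> Ninf v w"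
proof -
  have "0 \<in> Ninf v w"
    using ker_subset_Ninf[OF assms(1)] by auto
  then show ?thesis
    using Ninf_diff[OF assms(1,2), of "0 - k"] Ninf_diff[OF assms(1) _ assms(3), of 0] by simp
qed

section \<open>The vertex groups as quotients of the integers\<close>

abbreviation "grp \<equiv> vgroup A B"
abbreviation "to_grp \<equiv> to_vgroup A B"

lemma ker_subgroup: "subgroup (ker v) integer_group"
  by (rule group.subgroupI[OF group_integer_group]) (auto simp: ker_uminus ker_add intro: ker_zero)

lemma ker_normal: "normal (ker v) integer_group"
  using comm_group.normal_iff_subgroup[OF abelian_integer_group] ker_subgroup by blast

lemma comm_group_grp: "comm_group (grp v)"
  unfolding vgroup_def
  by (rule comm_group.abelian_FactGroup[OF abelian_integer_group ker_subgroup])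

lemma group_grp: "group (grp v)"
  using comm_group_grp by (rule comm_group.axioms)

lemma in_to_grp: "x \<in> to_grp v k \<longleftrightarrow> x - k \<in> ker v"
  by (auto simp: to_vgroup_def r_coset_def intro!: bexI[of _ "x - k"])

lemma to_grp_self: "k \<in> to_grp v k"
  by (simp add: in_to_grp)

lemma to_grp_eq_iff: "to_grp v j = to_grp v k \<longleftrightarrow> j - k \<in> ker v"
proof
  assume "to_grp v j = to_grp v k"
  then show "j - k \<in> ker v"
    using to_grp_self[of j v] by (simp add: in_to_grp)
next
  assume jk: "j - k \<in> ker v"
  have "x - j \<in> ker v \<longleftrightarrow> x - k \<in> ker v" for x
    using ker_add[OF _ jk, of "x - j"] ker_diff[OF _ jk, of "x - k"] by auto
  then show "to_grp v j = to_grp v k"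
    by (auto simp: in_to_grp)
qed

lemma carrier_grp: "carrier (grp v) = range (to_grp v)"
  by (auto simp: vgroup_def to_vgroup_def[abs_def] carrier_FactGroup)

lemma to_grp_carrier [simp]: "to_grp v k \<in> carrier (grp v)"
  by (simp add: carrier_grp)

lemma mult_to_grp: "to_grp v j \<otimes>\<^bsub>grp v\<^esub> to_grp v k = to_grp v (j + k)"
  by (simp add: vgroup_def to_vgroup_def normal.rcos_sum[OF ker_normal])

lemma one_grp: "\<one>\<^bsub>grp v\<^esub> = to_grp v 0"
  by (auto simp: vgroup_def in_to_grp)

lemma inv_to_grp: "inv\<^bsub>grp v\<^esub> (to_grp v k) = to_grp v (- k)"
  by (rule group.inv_equality[OF group_grp]) (simp_all add: mult_to_grp one_grp)

lemma hom_to_grp: "group_hom integer_group (grp v) (to_grp v)"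
  by (intro group_hom.intro group_hom_axioms.intro homI) (simp_all add: group_grp mult_to_grp)

lemma int_pow_to_grp: "to_grp v k [^]\<^bsub>grp v\<^esub> (i :: int) = to_grp v (i * k)"
  using group_hom.hom_int_pow[OF hom_to_grp, of k v i] by simp

lemma to_grp_eq_one_iff: "to_grp v k = \<one>\<^bsub>grp v\<^esub> \<longleftrightarrow> k \<in> ker v"
  by (simp add: one_grp to_grp_eq_iff)

lemma the_elem_to_grp:
  assumes "\<And>x. x - k \<in> ker v \<Longrightarrow> f x = f k"
  shows "the_elem (f ` to_grp v k) = f k"
proof -
  have "f ` to_grp v k = {f k}"
    using assms to_grp_self[of k v] in_to_grp by blast
  then show ?thesis
    by simp
qed

lemma act_cong_ker:
  assumes "j - k \<in> ker v" "fpath v xs"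
  shows "act j xs = act k xs" "sec j xs - sec k xs \<in> ker (path_src (v, xs))"
proof -
  show eq: "act j xs = act k xs"
    using assms act_diff_fix(1)[OF assms(2)] by (auto simp: ker_iff)
  show "sec j xs - sec k xs \<in> ker (path_src (v, xs))"
    using sec_diff[OF assms(2) eq] ker_sec[OF assms] by simp
qed

lemma path_act_to_grp:
  "fpath v xs \<Longrightarrow> path_act A B (to_grp v k) (v, xs) = (v, act k xs)"
  unfolding path_act_def int_act_def by (subst the_elem_to_grp) (auto intro: act_cong_ker)

lemma sect_to_grp:
  "fpath v xs \<Longrightarrow> sect A B (to_grp v k) (v, xs) = to_grp (path_src (v, xs)) (sec k xs)"
  unfolding sect_def by (subst the_elem_to_grp) (auto simp: to_grp_eq_iff intro: act_cong_ker)

lemma stream_act_cong_ker: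
  assumes "j - k \<in> ker v" "ipath v w"
  shows "stream_act A B j w = stream_act A B k w"
  by (rule stream_eqI_stake)
     (use assms ipath_stake in \<open>auto simp: stake_stream_act intro: act_cong_ker\<close>)

lemma inf_act_to_grp:
  "ipath v w \<Longrightarrow> inf_act A B (to_grp v k) w = stream_act A B k w"
  unfolding inf_act_def by (subst the_elem_to_grp) (auto intro: stream_act_cong_ker)

lemma ipath_stream_act: "ipath v w \<Longrightarrow> ipath v (stream_act A B k w)"
  by (simp add: ipath_iff stake_stream_act path_act)

lemma stream_act_add:
  assumes "ipath v w"
  shows "stream_act A B (j + k) w = stream_act A B j (stream_act A B k w)"
  by (rule stream_eqI_stake) (simp add: stake_stream_act act_add[OF ipath_stake[OF assms]])

lemma stream_act_zero: "ipath v w \<Longrightarrow> stream_act A B 0 w = w"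
  by (rule stream_eqI_stake) (simp add: stake_stream_act act_zero[OF ipath_stake])

lemma stream_act_inj:
  assumes "ipath v w" "ipath v z" "stream_act A B k w = stream_act A B k z"
  shows "w = z"
  using stream_act_add[OF assms(1), of "- k" k] stream_act_add[OF assms(2), of "- k" k]
    stream_act_zero assms by simp

lemma stream_act_fix_iff:
  "stream_act A B k w = w \<longleftrightarrow> (\<forall>n. act k (stake n w) = stake n w)"
  by (metis stake_stream_act stream_eqI_stake)

section \<open>Normal forms acting on germs\<close>

text \<open>
  The element \<open>p g\<^sub>u\<^sup>a q\<^sup>*\<close> with \<open>p = (v, xs)\<close> and \<open>q = (z, ys)\<close>, where \<open>u\<close> is the common source.
\<close>

definition elt :: "'n \<Rightarrow> 'n edge list \<Rightarrow> int \<Rightarrow> 'n \<Rightarrow> 'n edge list \<Rightarrow> 'n selt" where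
  "elt v xs a z ys = ((v, xs), to_grp (path_src (z, ys)) a, (z, ys))"

definition valid :: "'n \<Rightarrow> 'n edge list \<Rightarrow> 'n \<Rightarrow> 'n edge list \<Rightarrow> bool" where
  "valid v xs z ys \<longleftrightarrow> fpath v xs \<and> fpath z ys \<and> path_src (v, xs) = path_src (z, ys)"

lemma elt_in_selts: "elt v xs a z ys \<in> selts A B \<longleftrightarrow> valid v xs z ys"
  by (auto simp: elt_def selts_def valid_def paths_def)

lemma selts_cases:
  assumes "s \<in> selts A B"
  obtains v xs a z ys where "s = elt v xs a z ys" "valid v xs z ys"
proof -
  obtain v xs g z ys where s: "s = ((v, xs), g, (z, ys))"
    by (metis surj_pair)
  with assms have "valid v xs z ys" and "g \<in> range (to_grp (path_src (z, ys)))"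
    by (auto simp: selts_def valid_def paths_def carrier_grp)
  with s that show ?thesis
    by (auto simp: elt_def)
qed

lemma sdom_elt: "sdom A (elt v xs a z ys) = cylinder A (z, ys)"
  by (simp add: sdom_def elt_def)

text \<open>The product \<open>s x\<close> with a path \<open>x\<close> that extends the path \<open>q\<close> of \<open>s = p g q\<^sup>*\<close>.\<close>

lemma selt_mult_path_long:
  assumes "valid v xs z ys" "fpath z (ys @ t)"
  shows "selt_mult A B (elt v xs a z ys) (selt_of_path A B (z, ys @ t)) =
    Some (elt v (xs @ act a t) (sec a t) (path_src (z, ys @ t)) [])"
proof -
  have t: "fpath (path_src (z, ys)) t"
    using assms(2) by (simp add: is_path_append)
  show ?thesis
    using path_act_to_grp[OF t] sect_to_grp[OF t]
    by (simp add: elt_def selt_of_path_def path_prefix_def path_rest_def path_append_def one_grp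
        mult_to_grp vert_def Let_def)
qed

text \<open>
  For a proper prefix \<open>x\<close> of \<open>q = x y\<close> the product is \<open>p g y\<^sup>*\<close>, whose last component is not a
  vertex; this separates the two cases.
\<close>

lemma selt_mult_path_short:
  assumes "valid v xs z (t @ t')" "t' \<noteq> []"
  shows "selt_mult A B (elt v xs a z (t @ t')) (selt_of_path A B (z, t)) =
    Some (elt v xs a (path_src (z, t)) t')"
proof -
  have t': "fpath (path_src (z, t)) t'"
    using assms(1) by (simp add: valid_def is_path_append)
  show ?thesis
    using path_act_to_grp[OF t'] sect_to_grp[OF t'] assms(2) sec_zero[OF t'] act_zero[OF t']
    by (simp add: elt_def selt_of_path_def path_prefix_def path_rest_def path_append_def one_grp
        mult_to_grp vert_def inv_to_grp Let_def)
qed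

lemma elt_eq_iff:
  "elt v xs a z ys = elt v' xs' a' z' ys' \<longleftrightarrow>
     v = v' \<and> xs = xs' \<and> z = z' \<and> ys = ys' \<and> a - a' \<in> ker (path_src (z, ys))"
  by (cases "z = z' \<and> ys = ys'") (auto simp: elt_def to_grp_eq_iff)

lemma rng_shd_ipath: "ipath z w \<Longrightarrow> rng (shd w) = z"
  by (simp add: cylinder_def vert_def)

abbreviation "mult_prefix s n w \<equiv> selt_mult A B s (selt_of_path A B (inf_prefix n w))"

lemma mult_prefix_long:
  assumes "valid v xs z ys" "w \<in> cylinder A (z, ys)" "length ys \<le> n"
  shows "mult_prefix (elt v xs a z ys) n w =
    Some (elt v (xs @ act a (stake (n - length ys) (sdrop (length ys) w)))
      (sec a (stake (n - length ys) (sdrop (length ys) w))) (path_src (z, stake n w)) [])"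
proof -
  have w: "ipath z w" "stake (length ys) w = ys"
    using assms(2) by (simp_all add: cylinder_iff)
  have eq: "stake n w = ys @ stake (n - length ys) (sdrop (length ys) w)"
    using w(2) assms(3) by (metis le_add_diff_inverse stake_add)
  show ?thesis
    using selt_mult_path_long[OF assms(1), of "stake (n - length ys) (sdrop (length ys) w)" a]
      ipath_stake[OF w(1), of n] rng_shd_ipath[OF w(1)] eq
    by (simp add: inf_prefix_def)
qed

lemma mult_prefix_short:
  assumes "valid v xs z ys" "w \<in> cylinder A (z, ys)" "n < length ys"
  shows "mult_prefix (elt v xs a z ys) n w =
    Some (elt v xs a (path_src (z, stake n w)) (drop n ys))"
proof -
  have w: "ipath z w" "stake (length ys) w = ys"
    using assms(2) by (simp_all add: cylinder_iff)
  have eq: "ys = stake n w @ drop n ys"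
    using w(2) assms(3) by (metis append_take_drop_id min.strict_order_iff take_stake)
  show ?thesis
    using selt_mult_path_short[of v xs z "stake n w" "drop n ys" a] assms(1,3)
      rng_shd_ipath[OF w(1)] eq
    by (simp add: inf_prefix_def)
qed

text \<open>
  This makes equality of germs transitive: two prefixes that witness it can be replaced by the longer one.
  If \<open>x\<close> is shorter than one of the paths \<open>q\<close>, then \<open>s x = t x\<close> is possible only for \<open>s = t\<close>.
\<close>

lemma mult_prefix_mono:
  assumes s: "s \<in> selts A B" "w \<in> sdom A s" and t: "t \<in> selts A B" "w \<in> sdom A t"
    and eq: "mult_prefix s m w =
             mult_prefix t m w" and mn: "m \<le> n"
  shows "mult_prefix s n w =
         mult_prefix t n w"
proof -
  obtain v xs a z ys where s': "s = elt v xs a z ys" "valid v xs z ys"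
    using s(1) by (rule selts_cases)
  obtain v' xs' a' z' ys' where t': "t = elt v' xs' a' z' ys'" "valid v' xs' z' ys'"
    using t(1) by (rule selts_cases)
  have ws: "w \<in> cylinder A (z, ys)" and wt: "w \<in> cylinder A (z', ys')"
    using s t by (simp_all add: s' t' sdom_elt)
  then have z: "z' = z" and w: "ipath z w"
    by (auto simp: cylinder_def vert_def)
  note ml = mult_prefix_long[OF s'(2) ws, where a = a] mult_prefix_long[OF t'(2)[unfolded z] wt[unfolded z], where a = a']
  note ms = mult_prefix_short[OF s'(2) ws, where a = a] mult_prefix_short[OF t'(2)[unfolded z] wt[unfolded z], where a = a']
  show ?thesis
  proof (cases "length ys \<le> m"; cases "length ys' \<le> m")
    assume l: "length ys \<le> m" "length ys' \<le> m"
    define r where "r = stake (n - m) (sdrop m w)"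
    define y where "y = stake (m - length ys) (sdrop (length ys) w)"
    define y' where "y' = stake (m - length ys') (sdrop (length ys') w)"
    have "stake (n - l) (sdrop l w) = stake (m - l) (sdrop l w) @ r" if "l \<le> m" for l
      using that mn stake_add[of "m - l" "sdrop l w" "n - m"] by (simp add: r_def)
    then have r: "stake (n - length ys) (sdrop (length ys) w) = y @ r"
      "stake (n - length ys') (sdrop (length ys') w) = y' @ r"
      using l by (simp_all add: y_def y'_def)
    have rp: "fpath (path_src (z, stake m w)) r"
      using ipath_stake[OF ipath_sdrop[OF w], of m "n - m"] by (simp add: r_def)
    have e: "v = v'" "xs @ act a y = xs' @ act a' y'"
      "sec a y - sec a' y' \<in> ker (path_src (z, stake m w))"
      using eq l by (simp_all add: s' t' ml elt_eq_iff y_def y'_def z)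
    have "stake n w = stake m w @ r"
      using mn by (simp add: r_def)
    moreover have l2: "length ys \<le> n" "length ys' \<le> n"
      using l mn by auto
    ultimately show ?thesis
      unfolding s'(1) t'(1) z ml(1)[OF l2(1)] ml(2)[OF l2(2)] r
      using e act_cong_ker[OF e(3) rp]
      by (simp only: elt_eq_iff list_act_append list_sect_append path_src_append option.inject
          append_assoc[symmetric] path_src_Nil simp_thms)
  next
    assume l: "\<not> length ys \<le> m" "\<not> length ys' \<le> m"
    then have "v = v' \<and> xs = xs' \<and> drop m ys = drop m ys' \<and>
      a - a' \<in> ker (path_src (path_src (z, stake m w), drop m ys))"
      using eq unfolding s'(1) t'(1) z by (auto simp: ms elt_eq_iff)
    moreover have "ys = stake m w @ drop m ys" "ys' = stake m w @ drop m ys'"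
      using ws wt l by (metis append_take_drop_id cylinder_iff min.absorb1 nat_le_linear take_stake)+
    ultimately have "s = t"
      by (metis elt_eq_iff path_src_append s'(1) t'(1) z)
    then show ?thesis
      by simp
  qed (use eq in \<open>auto simp: s' t' z ml ms elt_eq_iff\<close>)
qed

lemma germ_rel_iff:
  "((s, w), (t, z)) \<in> germ_rel A B \<longleftrightarrow>
    s \<in> selts A B \<and> w \<in> sdom A s \<and> t \<in> selts A B \<and> z = w \<and> w \<in> sdom A t \<and>
    (\<exists>k. mult_prefix s k w =
         mult_prefix t k w)"
  by (auto simp: germ_rel_def germ_pairs_def)

lemma equiv_germ_rel: "equiv (germ_pairs A B) (germ_rel A B)"
proof (rule equivI)
  show "germ_rel A B \<subseteq> germ_pairs A B \<times> germ_pairs A B"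
    by (auto simp: germ_rel_def)
  show "refl_on (germ_pairs A B) (germ_rel A B)"
    by (auto simp: refl_on_def germ_rel_def)
  show "sym (germ_rel A B)"
    by (auto simp: sym_def germ_rel_def) metis+
  show "trans (germ_rel A B)"
  proof (rule transI)
    fix x y z assume *: "(x, y) \<in> germ_rel A B" "(y, z) \<in> germ_rel A B"
    obtain s w t w' r w'' where xyz: "x = (s, w)" "y = (t, w')" "z = (r, w'')"
      by (metis surj_pair)
    have w: "w' = w" "w'' = w" and dom: "s \<in> selts A B" "w \<in> sdom A s" "t \<in> selts A B"
      "w \<in> sdom A t" "r \<in> selts A B" "w \<in> sdom A r"
      using * unfolding xyz germ_rel_iff by metis+
    obtain j where j: "mult_prefix s j w =
          mult_prefix t j w"
      using *(1) unfolding xyz germ_rel_iff by metis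
    obtain k where k: "mult_prefix t k w =
          mult_prefix r k w"
      using *(2) unfolding xyz w germ_rel_iff by metis
    have "mult_prefix s (max j k) w =
          mult_prefix t (max j k) w"
      by (rule mult_prefix_mono[OF dom(1-4) j]) simp
    moreover have "mult_prefix t (max j k) w =
          mult_prefix r (max j k) w"
      by (rule mult_prefix_mono[OF dom(3-6) k]) simp
    ultimately show "(x, z) \<in> germ_rel A B"
      using dom w unfolding xyz germ_rel_iff by metis
  qed
qed

lemma germ_eq_iff:
  assumes "s \<in> selts A B" "w \<in> sdom A s" "t \<in> selts A B" "z \<in> sdom A t"
  shows "germ A B s w = germ A B t z \<longleftrightarrow>
    z = w \<and> (\<exists>k. mult_prefix s k w =
                 mult_prefix t k w)"
  unfolding germ_def
  by (subst eq_equiv_class_iff[OF equiv_germ_rel])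
     (use assms in \<open>auto simp: germ_rel_iff germ_pairs_def\<close>)

lemma germ_restrict:
  assumes "valid v xs z ys" "w \<in> cylinder A (z, ys @ t)"
  shows "germ A B (elt v xs a z ys) w = germ A B (elt v (xs @ act a t) (sec a t) z (ys @ t)) w"
    and "valid v (xs @ act a t) z (ys @ t)"
proof -
  have w: "ipath z w" "stake (length (ys @ t)) w = ys @ t"
    using assms(2) unfolding cylinder_iff by blast+
  have p: "fpath z (ys @ t)"
    using w ipath_stake by metis
  then show v: "valid v (xs @ act a t) z (ys @ t)"
    using assms(1) by (auto simp: valid_def is_path_append path_act)
  have "inf_prefix (length (ys @ t)) w = (z, ys @ t)"
    unfolding inf_prefix_def w(2) rng_shd_ipath[OF w(1)] ..
  moreover have "selt_mult A B (elt v (xs @ act a t) (sec a t) z (ys @ t))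
      (selt_of_path A B (z, ys @ t)) = Some (elt v (xs @ act a t) (sec a t) (path_src (z, ys @ t)) [])"
    using selt_mult_path_long[OF v, of "[]"] p by simp
  ultimately have "selt_mult A B (elt v xs a z ys) (selt_of_path A B (inf_prefix (length (ys @ t)) w)) =
      selt_mult A B (elt v (xs @ act a t) (sec a t) z (ys @ t))
        (selt_of_path A B (inf_prefix (length (ys @ t)) w))"
    using selt_mult_path_long[OF assms(1) p, of a] by simp
  moreover have "w \<in> cylinder A (z, ys)"
    using assms(2) cylinder_antimono by blast
  ultimately show "germ A B (elt v xs a z ys) w =
      germ A B (elt v (xs @ act a t) (sec a t) z (ys @ t)) w"
    using assms(2) v assms(1) by (subst germ_eq_iff) (auto simp: elt_in_selts sdom_elt)
qed

text \<open>
  Two exponents \<open>a\<close> and \<open>a'\<close> map a path to the same path if \<open>a - a'\<close> fixes it, and then their sections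
  differ by that of \<open>a - a'\<close>.  So equality of germs becomes membership in the germ kernel.
\<close>

lemma germ_eq_same_dom:
  assumes "valid v xs z ys" "valid v' xs' z ys" "ipath (path_src (z, ys)) w"
  shows "germ A B (elt v xs a z ys) (ys @- w) = germ A B (elt v' xs' a' z ys) (ys @- w) \<longleftrightarrow>
    v = v' \<and> xs = xs' \<and> a - a' \<in> Ninf (path_src (z, ys)) w"
proof -
  define u where "u = path_src (z, ys)"
  define T where "T n = (mult_prefix (elt v xs a z ys) n (ys @- w) =
         mult_prefix (elt v' xs' a' z ys) n (ys @- w))" for n
  have yw: "ys @- w \<in> cylinder A (z, ys)"
    using assms by (intro shift_in_cylinder) (auto simp: valid_def)
  have "germ A B (elt v xs a z ys) (ys @- w) = germ A B (elt v' xs' a' z ys) (ys @- w) \<longleftrightarrow> (\<exists>n. T n)"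
    unfolding T_def
    by (subst germ_eq_iff) (use assms yw in \<open>auto simp: elt_in_selts sdom_elt\<close>)
  also have "\<dots> \<longleftrightarrow> (\<exists>n. T (length ys + n))"
  proof
    assume "\<exists>n. T n"
    then obtain n where n: "T n" ..
    have "elt v xs a z ys \<in> selts A B" "ys @- w \<in> sdom A (elt v xs a z ys)"
      "elt v' xs' a' z ys \<in> selts A B" "ys @- w \<in> sdom A (elt v' xs' a' z ys)"
      using assms yw by (simp_all add: elt_in_selts sdom_elt)
    then have "T (length ys + n)"
      unfolding T_def by (rule mult_prefix_mono[OF _ _ _ _ n[unfolded T_def]]) simp
    then show "\<exists>n. T (length ys + n)" ..
  qed auto
  also have "\<dots> \<longleftrightarrow> (\<exists>n. v = v' \<and> xs @ act a (stake n w) = xs' @ act a' (stake n w) \<and>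
      sec a (stake n w) - sec a' (stake n w) \<in> ker (path_src (u, stake n w)))"
    using mult_prefix_long[OF assms(1) yw, where a = a] mult_prefix_long[OF assms(2) yw, where a = a']
    by (simp add: T_def elt_eq_iff sdrop_shift stake_shift u_def)
  also have "\<dots> \<longleftrightarrow> (\<exists>n. v = v' \<and> xs = xs' \<and> a - a' \<in> N u (stake n w))"
  proof -
    have "fpath u (stake n w)" for n
      using assms(3) by (simp add: ipath_stake u_def)
    note d = act_diff_fix(1)[OF this] sec_diff[OF this]
    show ?thesis
      by (auto simp: germ_kernel_def d(1)) (metis d(2))+
  qed
  finally show ?thesis
    by (auto simp: inf_germ_kernel_def u_def)
qed

lemma germ_in_germs: "s \<in> selts A B \<Longrightarrow> w \<in> sdom A s \<Longrightarrow> germ A B s w \<in> germs A B"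
  by (auto simp: germs_def germ_def germ_pairs_def intro: quotientI)

lemma germs_cases:
  assumes "\<gamma> \<in> germs A B"
  obtains s w where "s \<in> selts A B" "w \<in> sdom A s" "\<gamma> = germ A B s w"
  using assms by (auto simp: germs_def germ_def germ_pairs_def elim!: quotientE)

lemma in_germ:
  assumes "s \<in> selts A B" "w \<in> sdom A s"
  shows "(t, z) \<in> germ A B s w \<longleftrightarrow>
    z = w \<and> t \<in> selts A B \<and> w \<in> sdom A t \<and> germ A B t w = germ A B s w"
  using assms germ_eq_iff[of s w t w] by (auto simp: germ_def germ_rel_iff)

lemma germ_src_germ:
  assumes "s \<in> selts A B" "w \<in> sdom A s"
  shows "germ_src (germ A B s w) = w"
proof -
  have s: "(s, w) \<in> germ A B s w"
    using in_germ[OF assms] assms by blast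
  have "snd p = snd (s, w)" if "p \<in> germ A B s w" for p
    using that in_germ[OF assms, of "fst p" "snd p"] by simp
  then have "the_elem (snd ` germ A B s w) = snd (s, w)"
    using s by (intro the_elem_image_unique) auto
  then show ?thesis
    by (simp add: germ_src_def)
qed

section \<open>The topology on infinite paths\<close>

abbreviation "cyl n w \<equiv> cylinder A (inf_prefix n w)"

lemma in_cyl: "z \<in> cyl n w \<longleftrightarrow> z \<in> inf_paths A \<and> rng (shd z) = rng (shd w) \<and> stake n z = stake n w"
  unfolding cylinder_def inf_prefix_def by auto

lemma cyl_self: "w \<in> inf_paths A \<Longrightarrow> w \<in> cyl n w"
  by (simp add: in_cyl)

lemma inf_prefix_cyl: "z \<in> cyl n w \<Longrightarrow> inf_prefix n z = inf_prefix n w"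
  unfolding in_cyl by (simp add: inf_prefix_def)

lemma cyl_antimono: "m \<le> n \<Longrightarrow> cyl n w \<subseteq> cyl m w"
  unfolding in_cyl subset_iff by (metis min.absorb1 take_stake)

lemma inf_paths_iff: "w \<in> inf_paths A \<longleftrightarrow> ipath (rng (shd w)) w"
  by (simp add: cylinder_def vert_def)

lemma ipath_inf_paths: "ipath v w \<Longrightarrow> w \<in> inf_paths A"
  by (simp add: cylinder_def)

lemma cyl_eq: "ipath v w \<Longrightarrow> cyl n w = cylinder A (v, stake n w)"
  by (simp add: inf_prefix_def rng_shd_ipath)

lemma cylinder_subset_inf_paths: "cylinder A p \<subseteq> inf_paths A"
  by (auto simp: cylinder_def)

lemma cyl_subset_cylinder:
  assumes "w \<in> cylinder A (v, xs)"
  shows "cyl (length xs) w = cylinder A (v, xs)"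
  using assms by (auto simp: cylinder_def inf_prefix_def)

lemma inf_prefix_paths: "w \<in> inf_paths A \<Longrightarrow> inf_prefix n w \<in> paths A"
  by (simp add: inf_prefix_def paths_def inf_paths_iff ipath_stake)

text \<open>
  The cylinders of the prefixes of \<open>w\<close> form a chain, so the finite intersections of a subbasis do not
  produce smaller neighbourhoods.
\<close>

lemma openin_inf_topology:
  "openin (inf_topology A) U \<longleftrightarrow> U \<subseteq> inf_paths A \<and> (\<forall>w\<in>U. \<exists>n. cyl n w \<subseteq> U)"
proof
  assume "openin (inf_topology A) U"
  then have "generate_topology_on (cylinder A ` paths A) U"
    unfolding inf_topology_def by (rule openin_topology_generated_by)
  then show "U \<subseteq> inf_paths A \<and> (\<forall>w\<in>U. \<exists>n. cyl n w \<subseteq> U)"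
  proof induction
    case (Int a b)
    have "\<exists>n. cyl n w \<subseteq> a \<inter> b" if w: "w \<in> a \<inter> b" for w
    proof -
      obtain m n where "cyl m w \<subseteq> a" "cyl n w \<subseteq> b"
        using Int w by blast
      then have "cyl (max m n) w \<subseteq> a \<inter> b"
        using cyl_antimono[of m "max m n" w] cyl_antimono[of n "max m n" w] by auto
      then show ?thesis ..
    qed
    with Int show ?case
      by blast
  next
    case (UN K)
    then show ?case
      by (meson Sup_least Sup_upper UnionE subset_trans)
  next
    case (Basis s)
    then obtain v xs where s: "s = cylinder A (v, xs)"
      by force
    then show ?case
      unfolding s using cyl_subset_cylinder[of _ v xs] cylinder_subset_inf_paths[of "(v, xs)"]
      by (metis order_refl)
  qed simp
next
  assume U: "U \<subseteq> inf_paths A \<and> (\<forall>w\<in>U. \<exists>n. cyl n w \<subseteq> U)"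
  have "openin (inf_topology A) (\<Union>{cyl n w | n w. w \<in> U \<and> cyl n w \<subseteq> U})"
  proof (rule openin_Union)
    fix C assume "C \<in> {cyl n w | n w. w \<in> U \<and> cyl n w \<subseteq> U}"
    then show "openin (inf_topology A) C"
      unfolding inf_topology_def using U inf_prefix_paths
      by (auto intro!: topology_generated_by_Basis)
  qed
  moreover have "\<Union>{cyl n w | n w. w \<in> U \<and> cyl n w \<subseteq> U} = U"
    using U cyl_self by blast
  ultimately show "openin (inf_topology A) U"
    by simp
qed

lemma openin_cylinder: "openin (inf_topology A) (cylinder A (v, xs))"
  unfolding openin_inf_topology using cyl_subset_cylinder[of _ v xs] cylinder_subset_inf_paths
  by blast

lemma openin_cyl: "openin (inf_topology A) (cyl n w)"
  unfolding inf_prefix_def by (rule openin_cylinder)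

lemma topspace_inf_topology: "topspace (inf_topology A) = inf_paths A"
proof
  show "topspace (inf_topology A) \<subseteq> inf_paths A"
    using openin_inf_topology openin_topspace by blast
  show "inf_paths A \<subseteq> topspace (inf_topology A)"
    by (rule openin_subset) (auto simp: openin_inf_topology cylinder_def)
qed

text \<open>
  Compactness is Koenig's lemma: if a cylinder has no finite subcover, then neither has one of
  the finitely many cylinders of its one-edge extensions, and the infinite path obtained in this
  way lies in a member of the cover, which contains the cylinder of a prefix.
\<close>

lemma compactin_cylinder:
  assumes p: "fpath v xs"
  shows "compactin (inf_topology A) (cylinder A (v, xs))"
  unfolding compactin_def topspace_inf_topology
proof (intro conjI allI impI cylinder_subset_inf_paths)
  fix \<U> assume U: "Ball \<U> (openin (inf_topology A)) \<and> cylinder A (v, xs) \<subseteq> \<Union>\<U>"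
  define covered where "covered ys \<longleftrightarrow> (\<exists>\<F>. finite \<F> \<and> \<F> \<subseteq> \<U> \<and> cylinder A (v, xs @ ys) \<subseteq> \<Union>\<F>)" for ys
  show "\<exists>\<F>. finite \<F> \<and> \<F> \<subseteq> \<U> \<and> cylinder A (v, xs) \<subseteq> \<Union>\<F>"
  proof (rule ccontr)
    assume "\<not> ?thesis"
    then have nil: "\<not> covered []"
      by (simp add: covered_def)
    have step: "\<exists>e. fpath v (xs @ ys @ [e]) \<and> \<not> covered (ys @ [e])"
      if ys: "fpath v (xs @ ys)" "\<not> covered ys" for ys
    proof (rule ccontr)
      assume "\<not> ?thesis"
      then have all: "\<forall>e. fpath v (xs @ ys @ [e]) \<longrightarrow> covered (ys @ [e])"
        by blast
      define E where "E = {e. fpath v (xs @ ys @ [e])}"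
      have fin: "finite E"
        by (rule finite_subset[OF _ finite_edges[of A]]) (auto simp: E_def is_path_append)
      have "\<forall>e\<in>E. \<exists>\<F>. finite \<F> \<and> \<F> \<subseteq> \<U> \<and> cylinder A (v, xs @ ys @ [e]) \<subseteq> \<Union>\<F>"
        using all by (auto simp: E_def covered_def)
      then obtain F where F: "\<And>e. e \<in> E \<Longrightarrow>
          finite (F e) \<and> F e \<subseteq> \<U> \<and> cylinder A (v, xs @ ys @ [e]) \<subseteq> \<Union>(F e)"
        by metis
      have "cylinder A (v, xs @ ys) \<subseteq> \<Union>(\<Union>(F ` E))"
      proof
        fix w assume w: "w \<in> cylinder A (v, xs @ ys)"
        define e where "e = w !! length (xs @ ys)"
        have "stake (length (xs @ ys @ [e])) w = xs @ ys @ [e]"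
          using w stake_Suc[of "length (xs @ ys)" w] by (simp add: cylinder_iff e_def del: stake.simps)
        moreover have "ipath v w"
          using w by (simp add: cylinder_iff)
        ultimately have "w \<in> cylinder A (v, xs @ ys @ [e])" "fpath v (xs @ ys @ [e])"
          unfolding cylinder_iff by (auto dest: ipath_stake[of w v "length (xs @ ys @ [e])"])
        then have "e \<in> E" "w \<in> \<Union>(F e)"
          using F[of e] by (auto simp: E_def)
        then show "w \<in> \<Union>(\<Union>(F ` E))"
          by blast
      qed
      moreover have "finite (\<Union>(F ` E))" "\<Union>(F ` E) \<subseteq> \<U>"
        using F fin by auto
      ultimately have "covered ys"
        unfolding covered_def by blast
      with ys show False
        by simp
    qed
    obtain w where w: "ipath (path_src (v, xs)) w"
      "\<And>n. fpath v (xs @ stake n w) \<and> \<not> covered (stake n w)"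
    proof (rule limit_of_paths[where P = "\<lambda>ys. fpath v (xs @ ys) \<and> \<not> covered ys"])
      show "fpath v (xs @ []) \<and> \<not> covered []"
        using p nil by simp
      show "fpath (path_src (v, xs)) ys" if "fpath v (xs @ ys) \<and> \<not> covered ys" for ys
        using that by (simp add: is_path_append)
      show "\<exists>e. fpath v (xs @ ys @ [e]) \<and> \<not> covered (ys @ [e])"
        if "fpath v (xs @ ys) \<and> \<not> covered ys" for ys
        using step that by simp
    qed blast
    have xw: "xs @- w \<in> cylinder A (v, xs)"
      using p w(1) by (rule shift_in_cylinder)
    then obtain V where V: "V \<in> \<U>" "xs @- w \<in> V"
      using U by blast
    then obtain n where n: "cyl n (xs @- w) \<subseteq> V"
      using U openin_inf_topology by metis
    have "cylinder A (v, xs @ stake n w) \<subseteq> cyl n (xs @- w)"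
    proof -
      have "cyl (length xs + n) (xs @- w) \<subseteq> cyl n (xs @- w)"
        by (rule cyl_antimono) simp
      moreover have "ipath v (xs @- w)"
        using xw by (simp add: cylinder_iff)
      ultimately show ?thesis
        by (simp add: cyl_eq stake_shift)
    qed
    then have "covered (stake n w)"
      unfolding covered_def using n V by (intro exI[of _ "{V}"]) auto
    with w show False
      by blast
  qed
qed

section \<open>The topology on germs\<close>

lemma sdom_cyl:
  assumes "s \<in> selts A B" "w \<in> sdom A s"
  obtains n where "cyl n w \<subseteq> sdom A s"
  using assms cyl_subset_cylinder[of w "fst (snd (snd s))" "snd (snd (snd s))"]
  unfolding sdom_def by (metis order_refl prod.collapse)

lemma sdom_inf_paths: "w \<in> sdom A s \<Longrightarrow> w \<in> inf_paths A"
  using cylinder_subset_inf_paths unfolding sdom_def by blast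

lemma openin_sdom: "openin (inf_topology A) (sdom A s)"
  unfolding sdom_def by (metis openin_cylinder prod.collapse)

lemma compactin_sdom:
  assumes "s \<in> selts A B"
  shows "compactin (inf_topology A) (sdom A s)"
  using assms by (cases rule: selts_cases) (auto simp: sdom_elt valid_def intro: compactin_cylinder)

lemma openin_germ_pair_topology:
  "openin (germ_pair_topology A B) W \<longleftrightarrow> W \<subseteq> germ_pairs A B \<and>
     (\<forall>s w. (s, w) \<in> W \<longrightarrow> (\<exists>n. \<forall>z \<in> cyl n w \<inter> sdom A s. (s, z) \<in> W))"
  (is "?open W \<longleftrightarrow> _ \<and> ?loc W")
proof (intro iffI conjI)
  assume "?open W"
  then obtain T where T: "openin (prod_topology (discrete_topology (selts A B)) (inf_topology A)) T"
    and W: "W = T \<inter> germ_pairs A B"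
    by (auto simp: germ_pair_topology_def openin_subtopology)
  show "W \<subseteq> germ_pairs A B"
    using W by blast
  show "?loc W"
  proof (intro allI impI)
    fix s w assume sw: "(s, w) \<in> W"
    then have "(s, w) \<in> T"
      using W by simp
    then obtain U V where UV: "openin (inf_topology A) V" "s \<in> U" "w \<in> V" "U \<times> V \<subseteq> T"
      using T[unfolded openin_prod_topology_alt, rule_format, of s w] by metis
    then obtain n where "cyl n w \<subseteq> V"
      unfolding openin_inf_topology by metis
    moreover have "s \<in> selts A B"
      using sw W by (auto simp: germ_pairs_def)
    ultimately have "\<forall>z \<in> cyl n w \<inter> sdom A s. (s, z) \<in> W"
      using UV W by (auto simp: germ_pairs_def)
    then show "\<exists>n. \<forall>z \<in> cyl n w \<inter> sdom A s. (s, z) \<in> W" ..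
  qed
next
  assume W: "W \<subseteq> germ_pairs A B \<and> ?loc W"
  define \<T> where "\<T> = {{s} \<times> cyl n w | s n w.
    (s, w) \<in> W \<and> (\<forall>z \<in> cyl n w \<inter> sdom A s. (s, z) \<in> W)}"
  define T where "T = \<Union>\<T>"
  have "openin (prod_topology (discrete_topology (selts A B)) (inf_topology A)) T"
    unfolding T_def
  proof (rule openin_Union)
    fix Q assume "Q \<in> \<T>"
    then obtain s n w where "Q = {s} \<times> cyl n w" "(s, w) \<in> W"
      unfolding \<T>_def by blast
    then show "openin (prod_topology (discrete_topology (selts A B)) (inf_topology A)) Q"
      using W openin_cyl by (auto simp: openin_prod_Times_iff germ_pairs_def)
  qed
  moreover have "W = T \<inter> germ_pairs A B"
  proof (intro equalityI subsetI)
    fix x assume x: "x \<in> W"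
    then obtain s w n where swn: "x = (s, w)" "\<forall>z \<in> cyl n w \<inter> sdom A s. (s, z) \<in> W"
      using W by (metis surj_pair)
    have "w \<in> cyl n w"
      using x W swn by (intro cyl_self sdom_inf_paths[of _ s]) (auto simp: germ_pairs_def)
    then have "x \<in> T"
      unfolding T_def \<T>_def using x swn by blast
    then show "x \<in> T \<inter> germ_pairs A B"
      using W x by blast
  qed (auto simp: T_def \<T>_def germ_pairs_def)
  ultimately show "?open W"
    unfolding germ_pair_topology_def openin_subtopology by blast
qed

text \<open>
  The form in which the quotient topology is used: a set of germs is open if with a germ of \<open>s\<close> at
  \<open>w\<close> it contains those at all infinite paths close to \<open>w\<close>.
\<close>

lemma openin_germs_iff:
  "openin (germ_topology A B) V \<longleftrightarrow> V \<subseteq> germs A B \<and>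
    (\<forall>s\<in>selts A B. \<forall>w\<in>sdom A s. germ A B s w \<in> V \<longrightarrow>
       (\<exists>n. \<forall>z \<in> cyl n w \<inter> sdom A s. germ A B s z \<in> V))"
  unfolding openin_germ_topology openin_germ_pair_topology
  by (auto simp: germ_pairs_def)

lemma topspace_germ_topology: "topspace (germ_topology A B) = germs A B"
proof
  show "topspace (germ_topology A B) \<subseteq> germs A B"
    using openin_germs_iff openin_topspace by blast
  show "germs A B \<subseteq> topspace (germ_topology A B)"
    by (rule openin_subset) (auto simp: openin_germs_iff intro: germ_in_germs)
qed

text \<open>Equality of two germs at \<open>w\<close> is decided by a finite prefix, which nearby paths share.\<close>

lemma germ_eq_nearby:
  assumes s: "s \<in> selts A B" "w \<in> sdom A s" and t: "t \<in> selts A B" "w \<in> sdom A t"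
    and eq: "germ A B s w = germ A B t w"
  obtains n where "cyl n w \<subseteq> sdom A s" "cyl n w \<subseteq> sdom A t"
    "\<And>z. z \<in> cyl n w \<Longrightarrow> germ A B s z = germ A B t z"
proof -
  obtain k where k: "mult_prefix s k w =
                 mult_prefix t k w"
    using eq unfolding germ_eq_iff[OF s t] by blast
  obtain m where m: "cyl m w \<subseteq> sdom A s"
    using s by (rule sdom_cyl)
  obtain n where n: "cyl n w \<subseteq> sdom A t"
    using t by (rule sdom_cyl)
  define j where "j = max k (max m n)"
  have "k \<le> j" "m \<le> j" "n \<le> j"
    by (auto simp: j_def)
  then have sub: "cyl j w \<subseteq> cyl k w" "cyl j w \<subseteq> sdom A s" "cyl j w \<subseteq> sdom A t"
    using cyl_antimono m n by (meson subset_trans)+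
  show ?thesis
  proof (rule that[OF sub(2,3)])
    fix z assume z: "z \<in> cyl j w"
    then have "inf_prefix k z = inf_prefix k w"
      using sub inf_prefix_cyl by blast
    then have "mult_prefix s k z =
                 mult_prefix t k z"
      using k by metis
    moreover have "z \<in> sdom A s" "z \<in> sdom A t"
      using z sub by blast+
    ultimately show "germ A B s z = germ A B t z"
      using germ_eq_iff[of s z t z] s(1) t(1) by blast
  qed
qed

lemma openin_germ_image:
  assumes s: "s \<in> selts A B" and C: "openin (inf_topology A) C" "C \<subseteq> sdom A s"
  shows "openin (germ_topology A B) (germ A B s ` C)"
  unfolding openin_germs_iff
proof (intro conjI ballI impI)
  show "germ A B s ` C \<subseteq> germs A B"
    using s C germ_in_germs by blast
  fix t w assume t: "t \<in> selts A B" "w \<in> sdom A t" and "germ A B t w \<in> germ A B s ` C"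
  then obtain z where z: "z \<in> C" "germ A B t w = germ A B s z"
    by blast
  then have "z = w"
    using germ_src_germ t s C by (metis subsetD)
  then have w: "w \<in> C" "w \<in> sdom A s" "germ A B t w = germ A B s w"
    using z C by blast+
  obtain n where n: "cyl n w \<subseteq> sdom A t" "\<And>z. z \<in> cyl n w \<Longrightarrow> germ A B t z = germ A B s z"
    using germ_eq_nearby[OF t s w(2,3)] by metis
  obtain m where m: "cyl m w \<subseteq> C"
    using C w unfolding openin_inf_topology by blast
  have "germ A B t z \<in> germ A B s ` C" if "z \<in> cyl (max m n) w" for z
    using n m that cyl_antimono[of n "max m n" w] cyl_antimono[of m "max m n" w]
    by (metis image_eqI max.cobounded1 max.cobounded2 subsetD)
  then show "\<exists>n. \<forall>z\<in>cyl n w \<inter> sdom A t. germ A B t z \<in> germ A B s ` C"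
    by blast
qed

lemma continuous_map_germ:
  assumes "s \<in> selts A B"
  shows "continuous_map (subtopology (inf_topology A) (sdom A s)) (germ_topology A B) (germ A B s)"
  unfolding continuous_map_def
proof (intro conjI allI impI)
  have top: "topspace (subtopology (inf_topology A) (sdom A s)) = sdom A s"
    using sdom_inf_paths[of _ s] by (simp add: topspace_inf_topology Int_absorb1 subset_iff)
  show "germ A B s \<in> topspace (subtopology (inf_topology A) (sdom A s)) \<rightarrow> topspace (germ_topology A B)"
    unfolding top topspace_germ_topology using germ_in_germs[OF assms] by blast
  fix V assume V: "openin (germ_topology A B) V"
  have "openin (inf_topology A) {w \<in> sdom A s. germ A B s w \<in> V}"
    unfolding openin_inf_topology
  proof (intro conjI ballI)
    show "{w \<in> sdom A s. germ A B s w \<in> V} \<subseteq> inf_paths A"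
      using sdom_inf_paths by blast
    fix w assume w: "w \<in> {w \<in> sdom A s. germ A B s w \<in> V}"
    then obtain m n where m: "\<forall>z \<in> cyl m w \<inter> sdom A s. germ A B s z \<in> V" and n: "cyl n w \<subseteq> sdom A s"
      using V assms sdom_cyl[OF assms] unfolding openin_germs_iff by (metis (lifting) mem_Collect_eq)
    then have "cyl (max m n) w \<subseteq> {w \<in> sdom A s. germ A B s w \<in> V}"
      using cyl_antimono[of n "max m n" w] cyl_antimono[of m "max m n" w] by auto
    then show "\<exists>n. cyl n w \<subseteq> {w \<in> sdom A s. germ A B s w \<in> V}" ..
  qed
  then show "openin (subtopology (inf_topology A) (sdom A s))
      {x \<in> topspace (subtopology (inf_topology A) (sdom A s)). germ A B s x \<in> V}"
    unfolding top openin_subtopology by (intro exI[of _ "{w \<in> sdom A s. germ A B s w \<in> V}"]) auto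
qed

lemma interior_of_empty_iff:
  assumes "T \<subseteq> germs A B"
  shows "germ_topology A B interior_of T = {} \<longleftrightarrow>
    (\<forall>s\<in>selts A B. \<forall>w\<in>sdom A s. \<forall>n. \<exists>z \<in> cyl n w \<inter> sdom A s. germ A B s z \<notin> T)"
proof
  assume empty: "germ_topology A B interior_of T = {}"
  show "\<forall>s\<in>selts A B. \<forall>w\<in>sdom A s. \<forall>n. \<exists>z \<in> cyl n w \<inter> sdom A s. germ A B s z \<notin> T"
  proof (intro ballI allI, rule ccontr)
    fix s w n assume s: "s \<in> selts A B" "w \<in> sdom A s"
      and "\<not> (\<exists>z \<in> cyl n w \<inter> sdom A s. germ A B s z \<notin> T)"
    then have "germ A B s ` (cyl n w \<inter> sdom A s) \<subseteq> T"
      by blast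
    moreover have "openin (germ_topology A B) (germ A B s ` (cyl n w \<inter> sdom A s))"
      using openin_germ_image[OF s(1), of "cyl n w \<inter> sdom A s"] openin_Int[OF openin_cyl openin_sdom]
      by blast
    ultimately have "germ A B s ` (cyl n w \<inter> sdom A s) = {}"
      using interior_of_maximal empty by blast
    then show False
      using s cyl_self sdom_inf_paths by blast
  qed
next
  assume dense: "\<forall>s\<in>selts A B. \<forall>w\<in>sdom A s. \<forall>n. \<exists>z \<in> cyl n w \<inter> sdom A s. germ A B s z \<notin> T"
  show "germ_topology A B interior_of T = {}"
  proof (rule ccontr)
    assume "\<not> ?thesis"
    then obtain \<gamma> V where V: "openin (germ_topology A B) V" "V \<subseteq> T" "\<gamma> \<in> V"
      unfolding interior_of_def by blast
    then obtain s w where s: "s \<in> selts A B" "w \<in> sdom A s" "\<gamma> = germ A B s w"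
      using assms germs_cases by (metis subsetD)
    moreover have "germ A B s w \<in> V"
      using V(3) s(3) by simp
    ultimately obtain n where n: "\<forall>z \<in> cyl n w \<inter> sdom A s. germ A B s z \<in> V"
      using V(1)[unfolded openin_germs_iff, THEN conjunct2, rule_format, of s w] by metis
    obtain z where "z \<in> cyl n w \<inter> sdom A s" "germ A B s z \<notin> T"
      using dense[rule_format, OF s(1,2), of n] by metis
    with n V(2) show False
      by (metis subsetD)
  qed
qed

section \<open>Compact open bisections\<close>

lemma sapp_elt:
  assumes "w \<in> cylinder A (z, ys)"
  shows "sapp A B (elt v xs a z ys) w = xs @- stream_act A B a (sdrop (length ys) w)"
proof -
  have "ipath (path_src (z, ys)) (sdrop (length ys) w)"
    using assms ipath_sdrop[of w z "length ys"] by (simp add: cylinder_iff)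
  then show ?thesis
    by (simp add: elt_def inf_act_to_grp)
qed

lemma sapp_restrict:
  assumes "w \<in> cylinder A (z, ys @ t)"
  shows "sapp A B (elt v xs a z ys) w = sapp A B (elt v (xs @ act a t) (sec a t) z (ys @ t)) w"
proof -
  obtain r where r: "w = (ys @ t) @- r"
    using assms by (rule cylinderE)
  have "w \<in> cylinder A (z, ys)"
    using assms cylinder_antimono by blast
  then show ?thesis
    by (simp add: sapp_elt assms) (simp add: r sdrop_shift stream_act_shift)
qed

text \<open>
  Near \<open>w\<close>, the element \<open>s\<close> acts like \<open>p g x\<^sup>*\<close> with \<open>p = (v, xs)\<close>, where \<open>x\<close> is the prefix of \<open>w\<close> of
  length \<open>n\<close>.  This brings several elements to the same \<open>x\<close>, so that their germs can be compared.
\<close>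

definition local_form :: "'n selt \<Rightarrow> 'n edge stream \<Rightarrow> nat \<Rightarrow> 'n \<Rightarrow> 'n edge list \<Rightarrow> int \<Rightarrow> bool" where
  "local_form s w n v xs a \<longleftrightarrow> (let t = elt v xs a (rng (shd w)) (stake n w) in
     valid v xs (rng (shd w)) (stake n w) \<and>
     (\<forall>y\<in>cyl n w. germ A B s y = germ A B t y \<and> sapp A B s y = sapp A B t y))"

lemma ex_local_form:
  assumes "s \<in> selts A B" "w \<in> sdom A s"
  obtains m v where "\<And>n. n \<ge> m \<Longrightarrow> \<exists>xs a. local_form s w n v xs a"
proof -
  obtain v xs a z ys where s: "s = elt v xs a z ys" "valid v xs z ys"
    using assms(1) by (rule selts_cases)
  have w: "ipath z w" "stake (length ys) w = ys" "w \<in> cylinder A (z, ys)"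
    using assms(2) by (simp_all add: s sdom_elt cylinder_iff)
  have z: "rng (shd w) = z"
    using w by (simp add: rng_shd_ipath)
  show ?thesis
  proof (rule that)
    fix n assume "n \<ge> length ys"
    then obtain t where t: "stake n w = ys @ t"
      using stake_prefix[of "length ys" n w] w(2) by metis
    have c: "cyl n w = cylinder A (z, ys @ t)"
      by (simp add: cyl_eq[OF w(1)] t)
    have "w \<in> cylinder A (z, ys @ t)"
      using c cyl_self ipath_inf_paths[OF w(1)] by metis
    then have "valid v (xs @ act a t) z (ys @ t)"
      using germ_restrict(2)[OF s(2)] by blast
    then show "\<exists>xs a. local_form s w n v xs a"
      unfolding local_form_def Let_def z c t s(1)
      using germ_restrict(1)[OF s(2)] sapp_restrict by blast
  qed
qed

text \<open>
  This makes the range of a germ well defined: elements with the same germ at \<open>w = ys r\<close> differ by an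
  element of the germ kernel along \<open>r\<close>, which fixes all prefixes of \<open>r\<close>.
\<close>

lemma sapp_cong_germ:
  assumes s: "s \<in> selts A B" "w \<in> sdom A s" and t: "t \<in> selts A B" "w \<in> sdom A t"
    and eq: "germ A B s w = germ A B t w"
  shows "sapp A B s w = sapp A B t w"
proof -
  define z where "z = rng (shd w)"
  have w: "ipath z w"
    using sdom_inf_paths[OF s(2)] by (simp add: inf_paths_iff z_def)
  obtain m v where m: "\<And>n. n \<ge> m \<Longrightarrow> \<exists>xs a. local_form s w n v xs a"
    using ex_local_form[OF s] by metis
  obtain m' v' where m': "\<And>n. n \<ge> m' \<Longrightarrow> \<exists>xs a. local_form t w n v' xs a"
    using ex_local_form[OF t] by metis
  define n where "n = max m m'"
  define ys where "ys = stake n w"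
  define u where "u = path_src (z, ys)"
  define r where "r = sdrop n w"
  have wc: "w \<in> cyl n w"
    using cyl_self ipath_inf_paths[OF w] by blast
  obtain xs a where s': "valid v xs z ys" "germ A B s w = germ A B (elt v xs a z ys) w"
      "sapp A B s w = sapp A B (elt v xs a z ys) w"
    using m[of n] wc unfolding n_def ys_def z_def local_form_def Let_def by (metis max.cobounded1)
  obtain xs' a' where t': "valid v' xs' z ys" "germ A B t w = germ A B (elt v' xs' a' z ys) w"
      "sapp A B t w = sapp A B (elt v' xs' a' z ys) w"
    using m'[of n] wc unfolding n_def ys_def z_def local_form_def Let_def by (metis max.cobounded2)
  have r: "ipath u r"
    unfolding u_def r_def ys_def by (rule ipath_sdrop[OF w])
  have wr: "w = ys @- r"
    by (simp add: r_def ys_def stake_sdrop)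
  have e: "xs = xs'" "a - a' \<in> Ninf u r"
    using eq germ_eq_same_dom[OF s'(1) t'(1), of r a a'] r s'(2) t'(2) wr
    unfolding u_def by metis+
  have "stream_act A B a r = stream_act A B a' r"
  proof (rule stream_eqI_stake)
    fix k
    have "act (a - a') (stake k r) = stake k r"
      using Ninf_fixes[OF r e(2)] .
    then show "stake k (stream_act A B a r) = stake k (stream_act A B a' r)"
      using act_diff_fix(1)[OF ipath_stake[OF r]] by (simp add: stake_stream_act)
  qed
  moreover have "w \<in> cylinder A (z, ys)" "length ys = n"
    using wc cyl_eq[OF w, of n] unfolding ys_def by simp_all
  ultimately show ?thesis
    using s'(3) t'(3) e(1) by (simp add: sapp_elt r_def)
qed

lemma germ_rng_germ:
  assumes s: "s \<in> selts A B" "w \<in> sdom A s"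
  shows "germ_rng A B (germ A B s w) = sapp A B s w"
proof -
  have mem: "(s, w) \<in> germ A B s w"
    using in_germ[OF s] s by blast
  have "(\<lambda>(s, w). sapp A B s w) p = (\<lambda>(s, w). sapp A B s w) (s, w)" if "p \<in> germ A B s w" for p
  proof -
    have "snd p = w" "fst p \<in> selts A B" "w \<in> sdom A (fst p)" "germ A B (fst p) w = germ A B s w"
      using that in_germ[OF s, of "fst p" "snd p"] by auto
    then show ?thesis
      using sapp_cong_germ[OF _ _ s, of "fst p"] by (simp add: case_prod_beta)
  qed
  then have "the_elem ((\<lambda>(s, w). sapp A B s w) ` germ A B s w) = (\<lambda>(s, w). sapp A B s w) (s, w)"
    using mem by (intro the_elem_image_unique) auto
  then show ?thesis
    by (simp add: germ_rng_def)
qed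

lemma sapp_inj:
  assumes "s \<in> selts A B"
  shows "inj_on (sapp A B s) (sdom A s)"
proof (rule inj_onI)
  obtain v xs a z ys where s: "s = elt v xs a z ys"
    using assms by (rule selts_cases)
  fix w w' assume w: "w \<in> sdom A s" "w' \<in> sdom A s" "sapp A B s w = sapp A B s w'"
  then have c: "w \<in> cylinder A (z, ys)" "w' \<in> cylinder A (z, ys)"
    by (simp_all add: s sdom_elt)
  obtain r r' where r: "w = ys @- r" "w' = ys @- r'" "ipath (path_src (z, ys)) r"
      "ipath (path_src (z, ys)) r'"
    using c by (metis cylinderE)
  have "stream_act A B a r = stream_act A B a r'"
    using w(3) sapp_elt[OF c(1)] sapp_elt[OF c(2)] by (simp add: s r sdrop_shift)
  then show "w = w'"
    using stream_act_inj r by blast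
qed

lemma compact_open_bisection_germ_image:
  assumes "s \<in> selts A B"
  shows "compact_open_bisection A B (germ A B s ` sdom A s)"
  unfolding compact_open_bisection_def
proof (intro conjI)
  show "openin (germ_topology A B) (germ A B s ` sdom A s)"
    using assms openin_sdom by (rule openin_germ_image) simp
  have "compactin (subtopology (inf_topology A) (sdom A s)) (sdom A s)"
    using compactin_sdom[OF assms] by (simp add: compactin_subtopology)
  then show "compactin (germ_topology A B) (germ A B s ` sdom A s)"
    using continuous_map_germ[OF assms] by (rule image_compactin)
  show "inj_on germ_src (germ A B s ` sdom A s)"
    using germ_src_germ[OF assms] by (auto simp: inj_on_def)
  show "inj_on (germ_rng A B) (germ A B s ` sdom A s)"
    using germ_rng_germ[OF assms] sapp_inj[OF assms] by (auto simp: inj_on_def)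
qed

text \<open>
  Near a given infinite path, a compact open bisection is either empty or the set of germs of a
  single element of the inverse semigroup: it is a finite union of such sets over cylinders, and
  prefixes that are longer than all those of the cylinders decide between the two cases.
\<close>

lemma bisection_near_path:
  assumes "compact_open_bisection A B U"
  obtains n0 where "\<And>n. n \<ge> n0 \<Longrightarrow> (\<forall>\<gamma>\<in>U. germ_src \<gamma> \<notin> cyl n w) \<or>
    (\<exists>s\<in>selts A B. cyl n w \<subseteq> sdom A s \<and> (\<forall>z\<in>cyl n w. germ A B s z \<in> U))"
proof -
  have op: "openin (germ_topology A B) U" and comp: "compactin (germ_topology A B) U"
    using assms by (auto simp: compact_open_bisection_def)
  define basic where "basic F s n y \<longleftrightarrow> s \<in> selts A B \<and> cyl n y \<subseteq> sdom A s \<and>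
      F = germ A B s ` cyl n y \<and> F \<subseteq> U" for F s n y
  have "\<exists>\<F>. finite \<F> \<and> \<F> \<subseteq> {F. \<exists>s n y. basic F s n y} \<and> U \<subseteq> \<Union>\<F>"
  proof (rule compactinD[OF comp])
    show "openin (germ_topology A B) F" if "F \<in> {F. \<exists>s n y. basic F s n y}" for F
      using that openin_germ_image openin_cyl by (auto simp: basic_def)
    show "U \<subseteq> \<Union>{F. \<exists>s n y. basic F s n y}"
    proof
      fix \<gamma> assume g: "\<gamma> \<in> U"
      then have "\<gamma> \<in> germs A B"
        using op by (auto simp: openin_germs_iff)
      then obtain s y where s: "s \<in> selts A B" "y \<in> sdom A s" "\<gamma> = germ A B s y"
        by (rule germs_cases)
      then obtain m where m: "\<forall>z \<in> cyl m y \<inter> sdom A s. germ A B s z \<in> U"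
        using op g unfolding openin_germs_iff by metis
      obtain n where n: "cyl n y \<subseteq> sdom A s"
        using s(1,2) by (rule sdom_cyl)
      have "cyl (max m n) y \<subseteq> cyl m y \<inter> sdom A s"
        using n cyl_antimono[of n "max m n" y] cyl_antimono[of m "max m n" y] by auto
      then have "basic (germ A B s ` cyl (max m n) y) s (max m n) y"
        unfolding basic_def using s m by blast
      moreover have "\<gamma> \<in> germ A B s ` cyl (max m n) y"
        using s cyl_self sdom_inf_paths by blast
      ultimately show "\<gamma> \<in> \<Union>{F. \<exists>s n y. basic F s n y}"
        by blast
    qed
  qed
  then obtain \<F> where \<F>: "finite \<F>" "U \<subseteq> \<Union>\<F>" "\<forall>F\<in>\<F>. \<exists>s n y. basic F s n y"
    by blast
  then obtain S n Y where snY: "\<And>F. F \<in> \<F> \<Longrightarrow> basic F (S F) (n F) (Y F)"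
    by metis
  show ?thesis
  proof (rule that[of "Max (insert 0 (n ` \<F>))"])
    fix k assume "k \<ge> Max (insert 0 (n ` \<F>))"
    then have k: "n F \<le> k" if "F \<in> \<F>" for F
      using that \<F>(1) by (meson Max_ge finite_imageI finite_insert imageI insertI2 order_trans)
    show "(\<forall>\<gamma>\<in>U. germ_src \<gamma> \<notin> cyl k w) \<or>
      (\<exists>s\<in>selts A B. cyl k w \<subseteq> sdom A s \<and> (\<forall>z\<in>cyl k w. germ A B s z \<in> U))"
    proof (cases "\<exists>F\<in>\<F>. cyl k w \<subseteq> cyl (n F) (Y F)")
      case True
      then obtain F where F: "F \<in> \<F>" "cyl k w \<subseteq> cyl (n F) (Y F)"
        by blast
      then have "S F \<in> selts A B" "cyl k w \<subseteq> sdom A (S F)" "\<forall>z\<in>cyl k w. germ A B (S F) z \<in> U"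
        using snY[OF F(1)] unfolding basic_def by blast+
      then show ?thesis
        by blast
    next
      case False
      have "germ_src \<gamma> \<notin> cyl k w" if g: "\<gamma> \<in> U" for \<gamma>
      proof
        assume z: "germ_src \<gamma> \<in> cyl k w"
        obtain F where F: "F \<in> \<F>" "\<gamma> \<in> F"
          using \<F> g by blast
        then obtain y where y: "y \<in> cyl (n F) (Y F)" "\<gamma> = germ A B (S F) y"
          using snY[OF F(1)] unfolding basic_def by blast
        then have "germ_src \<gamma> = y"
          using snY[OF F(1)] germ_src_germ unfolding basic_def by blast
        with z have "y \<in> cyl (n F) w"
          using cyl_antimono[OF k[OF F(1)]] by blast
        then have "inf_prefix (n F) w = inf_prefix (n F) (Y F)"
          using y(1) inf_prefix_cyl by metis
        then have "cyl k w \<subseteq> cyl (n F) (Y F)"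
          using cyl_antimono[OF k[OF F(1)], of w] by simp
        with False F show False
          by blast
      qed
      then show ?thesis
        by blast
    qed
  qed
qed

end


section \<open>Simple cycles\<close>

text \<open>
  Consecutive edges of a path that is a subsequence of \<open>es\<close> are consecutive in \<open>es\<close>, because an
  edge of \<open>es\<close> is determined by its range.
\<close>

lemma subpath_contiguous:
  assumes "is_path A (u, es)" "distinct (map rng es)" "is_path A (u', ds)" "subseq ds es"
  shows "\<exists>pre post. es = pre @ ds @ post"
  using assms
proof (induction es arbitrary: u u' ds)
  case Nil
  then show ?case
    by auto
next
  case (Cons e es)
  show ?case
  proof (cases "ds = [] \<or> subseq ds es")
    case True
    then have "\<exists>pre post. es = pre @ ds @ post"
    proof
      assume "ds = []"
      then show ?thesis
        by auto
    next
      assume "subseq ds es"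
      then show ?thesis
        using Cons.IH[of "src e" u' ds] Cons.prems by auto
    qed
    then obtain pre post where "es = pre @ ds @ post"
      by blast
    then have "e # es = (e # pre) @ ds @ post"
      by simp
    then show ?thesis
      by blast
  next
    case False
    then obtain ds' where ds: "ds = e # ds'" "subseq ds' es"
      using Cons.prems(4) by (metis list_emb.simps neq_Nil_conv subseq_Cons2_neq subseq_Cons2')
    then obtain pre post where es: "es = pre @ ds' @ post"
      using Cons.IH[of "src e" "src e" ds'] Cons.prems by auto
    show ?thesis
    proof (cases "ds' = [] \<or> pre = []")
      case True
      then show ?thesis
      proof
        assume "ds' = []"
        then have "e # es = [] @ ds @ es"
          using ds by simp
        then show ?thesis by blast
      next
        assume "pre = []"
        then have "e # es = [] @ ds @ post"
          using ds es by simp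
        then show ?thesis by blast
      qed
    next
      case False
      then obtain d ds'' p pre' where *: "ds' = d # ds''" "pre = p # pre'"
        by (meson neq_Nil_conv)
      have "rng d = src e" "rng p = src e"
        using Cons.prems * ds es by auto
      then show ?thesis
        using Cons.prems(2) * es by auto
    qed
  qed
qed

lemma simple_cycleI:
  assumes "is_path A (v, es)" "es \<noteq> []" "path_src (v, es) = v" "distinct (map rng es)"
  shows "simple_cycle A (v, es)"
  unfolding simple_cycle_def
proof (intro conjI notI)
  show "cycle_path A (v, es)"
    using assms by (simp add: cycle_path_def paths_def path_rng_def)
  assume "\<exists>d. cycle_path A d \<and> strict_subseq (snd d) (snd (v, es))"
  then obtain v' ds where ds: "is_path A (v', ds)" "ds \<noteq> []" "path_src (v', ds) = v'"
    "subseq ds es" "ds \<noteq> es"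
    by (auto simp: cycle_path_def paths_def path_rng_def)
  then obtain pre post where es: "es = pre @ ds @ post"
    using subpath_contiguous[OF assms(1,4)] by metis
  obtain d ds' where d: "ds = d # ds'"
    using ds(2) by (meson neq_Nil_conv)
  have v': "rng d = v'" "path_src (v, pre) = v'"
    using ds(1) assms(1) by (auto simp: d es is_path_append)
  show False
  proof (cases post)
    case (Cons f post')
    then have "rng f = v'"
      using assms(1) v' ds(3) by (auto simp: es is_path_append)
    then show False
      using assms(4) v' by (auto simp: es Cons d)
  next
    case Nil
    then have v: "v' = v"
      using assms(3) v' ds(3) by (auto simp: es)
    obtain p pre' where p: "pre = p # pre'"
      using ds(5) Nil by (cases pre) (auto simp: es)
    have "rng p = v"
      using assms(1) by (simp add: es p)
    then show False
      using assms(4) v' v by (auto simp: es p d)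
  qed
qed

section \<open>Arithmetic of finite cyclic groups\<close>

text \<open>
  In \<open>\<int>/M\<int>\<close>, two elements of the same order have the same greatest common divisor with \<open>M\<close>, which by
  Bezout's identity is a multiple of each of them modulo \<open>M\<close>; so they generate the same subgroup.
\<close>

lemma same_order_imp_multiple:
  fixes M a b :: int
  assumes "M > 0" "\<And>k. M dvd k * a \<longleftrightarrow> M dvd k * b"
  obtains t where "M dvd b - t * a"
proof -
  have dvd: "M dvd k * c \<longleftrightarrow> M div gcd M c dvd k" for k c
  proof -
    have g: "gcd M c \<noteq> 0"
      using assms(1) by simp
    have "M dvd k * c \<longleftrightarrow> (M div gcd M c) * gcd M c dvd (k * (c div gcd M c)) * gcd M c"
      by (simp add: mult.assoc)
    also have "\<dots> \<longleftrightarrow> M div gcd M c dvd k * (c div gcd M c)"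
      using g by (simp only: dvd_mult_cancel_right simp_thms)
    also have "\<dots> \<longleftrightarrow> M div gcd M c dvd k"
      using assms(1) by (intro coprime_dvd_mult_left_iff div_gcd_coprime) simp
    finally show ?thesis .
  qed
  have pos: "M div gcd M c > 0" for c
    using assms(1) by (simp add: pos_imp_zdiv_pos_iff zdvd_imp_le)
  have "M div gcd M a = M div gcd M b"
    using assms(2) pos[of a] pos[of b] unfolding dvd by (metis dvd_refl zdvd_antisym_nonneg less_imp_le)
  then have "gcd M a = gcd M b"
    by (metis dvd_div_eq_iff dvd_mult_div_cancel gcd_dvd1 assms(1) less_irrefl
        mult_cancel_left pos mult.commute)
  then have "gcd M a dvd b"
    by simp
  then obtain r where r: "b = gcd M a * r" ..
  obtain x y where "x * M + y * a = gcd M a"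
    using bezout_int by blast
  then have "b = (x * M + y * a) * r"
    using r by simp
  then have "b - (y * r) * a = M * (x * r)"
    by (simp add: algebra_simps)
  then show ?thesis
    using that[of "y * r"] by (metis dvd_triv_left)
qed

context katsura
begin

section \<open>The maximal stable subgroup\<close>

lemma finite_grp:
  assumes "ker v \<noteq> {0}"
  shows "finite (carrier (grp v))"
proof -
  obtain M where M: "M \<ge> 0" "ker v = {k. M dvd k}"
    by (rule ker_generator)
  have "M > 0"
    using assms M by (cases "M = 0") auto
  have "carrier (grp v) \<subseteq> to_grp v ` {0..<M}"
  proof
    fix g assume "g \<in> carrier (grp v)"
    then obtain k where k: "g = to_grp v k"
      by (auto simp: carrier_grp)
    have "g = to_grp v (k mod M)"
      unfolding k to_grp_eq_iff M by (simp add: minus_mod_eq_mult_div)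
    then show "g \<in> to_grp v ` {0..<M}"
      using \<open>M > 0\<close> by auto
  qed
  then show ?thesis
    by (rule finite_subset) auto
qed

lemma stable_subgroup_iff:
  assumes "fpath v es" "path_src (v, es) = v"
  shows "stable_subgroup A B (v, es) H \<longleftrightarrow> subgroup H (grp v) \<and>
    (\<forall>k. to_grp v k \<in> H \<longrightarrow> act k es = es) \<and> bij_betw (\<lambda>h. sect A B h (v, es)) H H"
proof -
  have "(\<forall>h\<in>H. path_act A B h (v, es) = (v, es)) \<longleftrightarrow> (\<forall>k. to_grp v k \<in> H \<longrightarrow> act k es = es)"
    if "subgroup H (grp v)"
  proof -
    have "H \<subseteq> range (to_grp v)"
      using subgroup.subset[OF that] by (simp add: carrier_grp)
    then show ?thesis
      using path_act_to_grp[OF assms(1)] by (auto simp: subset_iff image_iff)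
  qed
  then show ?thesis
    by (auto simp: stable_subgroup_def path_rng_def)
qed

text \<open>
  The section map is a homomorphism on elements fixing the cycle, so it maps \<open>H K\<close> onto \<open>H K\<close>;
  finiteness turns this into a bijection.
\<close>

lemma stable_subgroup_mult:
  assumes c: "fpath v es" "path_src (v, es) = v" and fin: "finite (carrier (grp v))"
    and H: "stable_subgroup A B (v, es) H" and K: "stable_subgroup A B (v, es) K"
  shows "stable_subgroup A B (v, es) (H <#>\<^bsub>grp v\<^esub> K)"
proof -
  interpret comm_group "grp v"
    by (rule comm_group_grp)
  let ?f = "\<lambda>h. sect A B h (v, es)"
  have HK: "subgroup H (grp v)" "subgroup K (grp v)" "?f ` H = H" "?f ` K = K"
    and Hfix: "\<And>k. to_grp v k \<in> H \<Longrightarrow> act k es = es" and Kfix: "\<And>k. to_grp v k \<in> K \<Longrightarrow> act k es = es"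
    using H K unfolding stable_subgroup_iff[OF c] by (auto simp: bij_betw_def)
  have sub: "subgroup (H <#>\<^bsub>grp v\<^esub> K) (grp v)"
    using HK by (intro mult_subgroups)
  have rep: "\<exists>k. h = to_grp v k" if "h \<in> H \<union> K" for h
    using that HK(1,2) subgroup.subset by (fastforce simp: carrier_grp)
  have fixes_prod: "act k es = es" if k: "to_grp v k \<in> H <#>\<^bsub>grp v\<^esub> K" for k
  proof -
    obtain a b where ab: "to_grp v a \<in> H" "to_grp v b \<in> K" "to_grp v k = to_grp v a \<otimes>\<^bsub>grp v\<^esub> to_grp v b"
      using k rep by (auto simp: set_mult_def) (metis UnI1 UnI2)
    have "k - (a + b) \<in> ker v"
      using ab(3) by (simp add: mult_to_grp to_grp_eq_iff)
    then have "act k es = act (a + b) es"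
      using act_cong_ker c(1) by blast
    also have "\<dots> = es"
      using act_add[OF c(1), of a b] Hfix[OF ab(1)] Kfix[OF ab(2)] by simp
    finally show ?thesis .
  qed
  have hom: "?f (h \<otimes>\<^bsub>grp v\<^esub> k) = ?f h \<otimes>\<^bsub>grp v\<^esub> ?f k" if hk: "h \<in> H" "k \<in> K" for h k
  proof -
    obtain a where "h = to_grp v a"
      using rep[of h] hk(1) by blast
    moreover obtain b where "k = to_grp v b"
      using rep[of k] hk(2) by blast
    ultimately show ?thesis
      using hk Kfix[of b] sec_add[OF c(1), of a b] sect_to_grp[OF c(1)] c(2)
      by (simp add: mult_to_grp)
  qed
  have "?f ` (H <#>\<^bsub>grp v\<^esub> K) = (?f ` H) <#>\<^bsub>grp v\<^esub> (?f ` K)"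
  proof (intro equalityI subsetI)
    fix g assume "g \<in> ?f ` (H <#>\<^bsub>grp v\<^esub> K)"
    then obtain h k where "h \<in> H" "k \<in> K" "g = ?f (h \<otimes>\<^bsub>grp v\<^esub> k)"
      by (auto simp: set_mult_def)
    then show "g \<in> (?f ` H) <#>\<^bsub>grp v\<^esub> (?f ` K)"
      using hom by (auto simp: set_mult_def)
  next
    fix g assume "g \<in> (?f ` H) <#>\<^bsub>grp v\<^esub> (?f ` K)"
    then obtain h k where "h \<in> H" "k \<in> K" "g = ?f h \<otimes>\<^bsub>grp v\<^esub> ?f k"
      by (auto simp: set_mult_def)
    then show "g \<in> ?f ` (H <#>\<^bsub>grp v\<^esub> K)"
      using hom[of h k] by (force simp: set_mult_def)
  qed
  then have surj: "?f ` (H <#>\<^bsub>grp v\<^esub> K) = H <#>\<^bsub>grp v\<^esub> K"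
    by (simp add: HK)
  moreover have "finite (H <#>\<^bsub>grp v\<^esub> K)"
    using fin subgroup.subset[OF sub] finite_subset by blast
  ultimately have "bij_betw ?f (H <#>\<^bsub>grp v\<^esub> K) (H <#>\<^bsub>grp v\<^esub> K)"
    by (simp add: bij_betw_def eq_card_imp_inj_on)
  then show ?thesis
    unfolding stable_subgroup_iff[OF c] using sub fixes_prod by blast
qed

text \<open>
  Together with a maximal stable subgroup \<open>M\<close>, every stable \<open>H\<close> gives a stable product \<open>H M\<close>, whence
  \<open>H \<subseteq> M\<close>.  So \<open>M\<close> is the largest one, and the definite description denotes it.
\<close>

lemma max_stable:
  assumes c: "fpath v es" "path_src (v, es) = v" and fin: "finite (carrier (grp v))"
  shows "stable_subgroup A B (v, es) (max_stable A B (v, es))"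
    and "\<And>H. stable_subgroup A B (v, es) H \<Longrightarrow> H \<subseteq> max_stable A B (v, es)"
proof -
  interpret comm_group "grp v"
    by (rule comm_group_grp)
  let ?S = "{H. stable_subgroup A B (v, es) H}"
  have one: "act k es = es" "sec k es \<in> ker v" if "k \<in> ker v" for k
    using that c ker_sec[OF that c(1)] by (simp_all add: ker_iff)
  have "stable_subgroup A B (v, es) {\<one>\<^bsub>grp v\<^esub>}"
    unfolding stable_subgroup_iff[OF c]
  proof (intro conjI allI impI)
    show "subgroup {\<one>\<^bsub>grp v\<^esub>} (grp v)"
      by (rule triv_subgroup)
    show "act k es = es" if "to_grp v k \<in> {\<one>\<^bsub>grp v\<^esub>}" for k
      using that one by (simp add: to_grp_eq_one_iff)
    have "sect A B \<one>\<^bsub>grp v\<^esub> (v, es) = \<one>\<^bsub>grp v\<^esub>"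
      using one(2)[of 0] unfolding one_grp sect_to_grp[OF c(1)] c(2) to_grp_eq_iff by simp
    then show "bij_betw (\<lambda>h. sect A B h (v, es)) {\<one>\<^bsub>grp v\<^esub>} {\<one>\<^bsub>grp v\<^esub>}"
      by (simp add: bij_betw_def)
  qed
  moreover have "?S \<subseteq> Pow (carrier (grp v))"
    using subgroup.subset by (auto simp: stable_subgroup_iff[OF c])
  then have "finite ?S"
    using fin by (meson finite_Pow_iff finite_subset)
  ultimately obtain M where M: "M \<in> ?S" "\<And>K. K \<in> ?S \<Longrightarrow> M \<subseteq> K \<Longrightarrow> M = K"
    using finite_has_maximal[of ?S] by blast
  have le: "H \<subseteq> M" if "H \<in> ?S" for H
  proof -
    have sub: "subgroup H (grp v)" "subgroup M (grp v)"
      using that M by (simp_all add: stable_subgroup_iff[OF c])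
    have "H <#>\<^bsub>grp v\<^esub> M \<in> ?S"
      using stable_subgroup_mult[OF c fin] that M by blast
    moreover have "M \<subseteq> H <#>\<^bsub>grp v\<^esub> M"
    proof
      fix x assume x: "x \<in> M"
      then have "x = \<one>\<^bsub>grp v\<^esub> \<otimes>\<^bsub>grp v\<^esub> x"
        using subgroup.mem_carrier[OF sub(2)] by simp
      then show "x \<in> H <#>\<^bsub>grp v\<^esub> M"
        unfolding set_mult_def using x subgroup.one_closed[OF sub(1)] by blast
    qed
    moreover have "H \<subseteq> H <#>\<^bsub>grp v\<^esub> M"
    proof
      fix x assume x: "x \<in> H"
      then have "x = x \<otimes>\<^bsub>grp v\<^esub> \<one>\<^bsub>grp v\<^esub>"
        using subgroup.mem_carrier[OF sub(1)] by simp
      then show "x \<in> H <#>\<^bsub>grp v\<^esub> M"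
        unfolding set_mult_def using x subgroup.one_closed[OF sub(2)] by blast
    qed
    ultimately show ?thesis
      using M(2) by blast
  qed
  have "max_stable A B (v, es) = M"
    unfolding max_stable_def by (rule the_equality) (use M le in blast)+
  then show "stable_subgroup A B (v, es) (max_stable A B (v, es))"
    "\<And>H. stable_subgroup A B (v, es) H \<Longrightarrow> H \<subseteq> max_stable A B (v, es)"
    using M le by auto
qed

section \<open>Free orbits\<close>

text \<open>Since the groups are abelian, all points of an orbit have the same stabilizer.\<close>

lemma has_free_orbit_iff:
  assumes H: "subgroup H (grp v)"
  shows "has_free_orbit A B v H \<longleftrightarrow>
    (\<exists>w. ipath v w \<and> (\<forall>k. to_grp v k \<in> H \<longrightarrow> stream_act A B k w = w \<longrightarrow> k \<in> ker v))"
proof -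
  have rep: "\<exists>k. h = to_grp v k" if "h \<in> H" for h
    using that subgroup.subset[OF H] by (fastforce simp: carrier_grp)
  have zero: "to_grp v 0 \<in> H"
    using subgroup.one_closed[OF H] by (simp add: one_grp)
  have *: "has_free_orbit A B v H \<longleftrightarrow> (\<exists>w. ipath v w \<and>
      (\<forall>g\<in>H. {h \<in> H. inf_act A B h (inf_act A B g w) = inf_act A B g w} = {\<one>\<^bsub>grp v\<^esub>}))"
    by (auto simp: has_free_orbit_def orbits_def orbit_def free_orbit_def stabilizer_def Let_def)
  show ?thesis
    unfolding *
  proof (intro ex_cong1 conj_cong refl iffI allI impI ballI)
    fix w k assume w: "ipath v w"
      and stab: "\<forall>g\<in>H. {h \<in> H. inf_act A B h (inf_act A B g w) = inf_act A B g w} = {\<one>\<^bsub>grp v\<^esub>}"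
      and k: "to_grp v k \<in> H" "stream_act A B k w = w"
    have "inf_act A B (to_grp v 0) w = w"
      using w by (simp add: inf_act_to_grp stream_act_zero)
    then have "{h \<in> H. inf_act A B h w = w} = {\<one>\<^bsub>grp v\<^esub>}"
      using stab zero by metis
    moreover have "to_grp v k \<in> {h \<in> H. inf_act A B h w = w}"
      using k w by (simp add: inf_act_to_grp)
    ultimately have "to_grp v k = \<one>\<^bsub>grp v\<^esub>"
      by blast
    then show "k \<in> ker v"
      by (simp add: to_grp_eq_one_iff)
  next
    fix w g assume w: "ipath v w"
      and free: "\<forall>k. to_grp v k \<in> H \<longrightarrow> stream_act A B k w = w \<longrightarrow> k \<in> ker v" and g: "g \<in> H"
    obtain b where b: "g = to_grp v b"
      using rep g by blast
    have w': "ipath v (stream_act A B b w)"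
      using w by (rule ipath_stream_act)
    have "h = \<one>\<^bsub>grp v\<^esub>" if h: "h \<in> H" "inf_act A B h (inf_act A B g w) = inf_act A B g w" for h
    proof -
      obtain k where k: "h = to_grp v k"
        using rep h by blast
      have "stream_act A B b (stream_act A B k w) = stream_act A B b w"
        using h(2) w w' stream_act_add[OF w, of b k] stream_act_add[OF w, of k b]
        by (simp add: b k inf_act_to_grp add.commute)
      then have "stream_act A B k w = w"
        using stream_act_inj ipath_stream_act w by blast
      then show ?thesis
        using free h(1) by (simp add: k to_grp_eq_one_iff)
    qed
    moreover have "inf_act A B \<one>\<^bsub>grp v\<^esub> (inf_act A B g w) = inf_act A B g w"
      using w w' by (simp add: one_grp b inf_act_to_grp stream_act_zero)
    ultimately show "{h \<in> H. inf_act A B h (inf_act A B g w) = inf_act A B g w} = {\<one>\<^bsub>grp v\<^esub>}"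
      using subgroup.one_closed[OF H] by blast
  qed
qed

text \<open>
  Each nontrivial element moves some prefix of a point of a free orbit, and the longest of these
  finitely many prefixes is moved by all.
\<close>

lemma free_orbit_prefix:
  assumes H: "subgroup H (grp v)" and fin: "finite H" and free: "has_free_orbit A B v H"
  obtains y where "fpath v y" "\<And>k. to_grp v k \<in> H \<Longrightarrow> act k y = y \<Longrightarrow> k \<in> ker v"
proof -
  obtain w where w: "ipath v w"
    and wfree: "\<And>k. to_grp v k \<in> H \<Longrightarrow> stream_act A B k w = w \<Longrightarrow> k \<in> ker v"
    using free unfolding has_free_orbit_iff[OF H] by blast
  have "\<exists>n. \<forall>k. to_grp v k = h \<longrightarrow> act k (stake n w) = stake n w \<longrightarrow> k \<in> ker v" if h: "h \<in> H" for h
  proof (rule ccontr)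
    assume "\<not> ?thesis"
    then have all: "\<And>n. \<exists>k. to_grp v k = h \<and> act k (stake n w) = stake n w \<and> k \<notin> ker v"
      by blast
    then obtain a where a: "to_grp v a = h" "a \<notin> ker v"
      by blast
    have "act a (stake n w) = stake n w" for n
    proof -
      obtain k where "to_grp v k = h" "act k (stake n w) = stake n w"
        using all by blast
      then show ?thesis
        using a act_cong_ker(1)[of a k v "stake n w"] ipath_stake[OF w] by (metis to_grp_eq_iff)
    qed
    then have "stream_act A B a w = w"
      by (simp add: stream_act_fix_iff)
    then show False
      using wfree a h by blast
  qed
  then obtain n where n: "\<And>h k. h \<in> H \<Longrightarrow> to_grp v k = h \<Longrightarrow> act k (stake (n h) w) = stake (n h) w \<Longrightarrow>
      k \<in> ker v"
    by metis
  define m where "m = Max (n ` H)"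
  show ?thesis
  proof (rule that)
    show "fpath v (stake m w)"
      using w by (rule ipath_stake)
    fix k assume k: "to_grp v k \<in> H" "act k (stake m w) = stake m w"
    have "n (to_grp v k) \<le> m"
      using k fin by (simp add: m_def)
    then obtain ys where "stake m w = stake (n (to_grp v k)) w @ ys"
      by (rule stake_prefix)
    then have "act k (stake (n (to_grp v k)) w) = stake (n (to_grp v k)) w"
      using k(2) by (simp add: list_act_append)
    then show "k \<in> ker v"
      using n k(1) by blast
  qed
qed

section \<open>From singular coefficients to a simple cycle\<close>

text \<open>
  This is singularity of an element \<open>\<Sum>i\<in>I. c i g\<^sub>u^k i\<close> of the group algebra at \<open>u\<close>, with
  a nonzero value at the germ of the unit \<open>u\<close> at \<open>w\<close>.  The family is indexed and not collected
  into coefficients, because restriction to a tail of \<open>w\<close> keeps \<open>c\<close> and merely shrinks \<open>I\<close> and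
  replaces the exponents by their sections.
\<close>

definition singular_data ::
    "'n \<Rightarrow> 'n edge stream \<Rightarrow> 'i set \<Rightarrow> ('i \<Rightarrow> 'k::field) \<Rightarrow> ('i \<Rightarrow> int) \<Rightarrow> bool" where
  "singular_data u w I c k \<longleftrightarrow> finite I \<and> ipath u w \<and>
     (\<Sum>i | i \<in> I \<and> k i \<in> Ninf u w. c i) \<noteq> 0 \<and>
     (\<forall>j y. fpath u y \<longrightarrow> (\<exists>z \<in> cylinder A (u, y). (\<Sum>i | i \<in> I \<and> k i - j \<in> Ninf u z. c i) = 0))"

text \<open>
  If a path \<open>y\<close> separates the exponents, then on the whole cylinder of \<open>y\<close> different group elements
  have different germs, so a nonzero coefficient is seen on an open set.
\<close>

lemma no_separating_path:
  assumes sd: "singular_data u w I c k" and y: "fpath u y"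
    and sep: "\<And>i j. i \<in> I \<Longrightarrow> j \<in> I \<Longrightarrow> act (k i - k j) y = y \<Longrightarrow> k i - k j \<in> ker u"
  shows False
proof -
  have fin: "finite I" and w: "ipath u w"
    and nz: "(\<Sum>i | i \<in> I \<and> k i \<in> Ninf u w. c i) \<noteq> 0"
    and zero: "\<And>j. \<exists>z \<in> cylinder A (u, y). (\<Sum>i | i \<in> I \<and> k i - j \<in> Ninf u z. c i) = 0"
    using sd y by (auto simp: singular_data_def)
  define S where "S = {i \<in> I. k i \<in> Ninf u w}"
  define g where "g i = to_grp u (k i)" for i
  have S: "finite S"
    using fin by (simp add: S_def)
  have "sum c S = (\<Sum>b\<in>g ` S. \<Sum>i | i \<in> S \<and> g i = b. c i)"
    using S by (rule sum.image_gen)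
  with nz have "(\<Sum>b\<in>g ` S. \<Sum>i | i \<in> S \<and> g i = b. c i) \<noteq> 0"
    by (simp add: S_def)
  then obtain b where b: "b \<in> g ` S" "(\<Sum>i | i \<in> S \<and> g i = b. c i) \<noteq> 0"
    by (rule sum.not_neutral_contains_not_neutral)
  then obtain l where l: "l \<in> S" "b = g l"
    by blast
  obtain z where z: "z \<in> cylinder A (u, y)" "(\<Sum>i | i \<in> I \<and> k i - k l \<in> Ninf u z. c i) = 0"
    using zero[of "k l"] by blast
  have zp: "ipath u z" "stake (length y) z = y"
    using z(1) by (simp_all add: cylinder_iff)
  have "{i. i \<in> I \<and> k i - k l \<in> Ninf u z} = {i. i \<in> S \<and> g i = b}"
  proof (intro Collect_cong)
    fix i
    show "i \<in> I \<and> k i - k l \<in> Ninf u z \<longleftrightarrow> i \<in> S \<and> g i = b"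
    proof
      assume i: "i \<in> I \<and> k i - k l \<in> Ninf u z"
      then have "act (k i - k l) y = y"
        using Ninf_fixes[OF zp(1), of "k i - k l" "length y"] zp(2) by simp
      then have d: "k i - k l \<in> ker u"
        using sep i l by (simp add: S_def)
      then have "k i - k l + k l \<in> Ninf u w"
        using l ker_subset_Ninf[OF w] by (intro Ninf_add[OF w]) (auto simp: S_def)
      with i d show "i \<in> S \<and> g i = b"
        by (simp add: S_def g_def l to_grp_eq_iff)
    next
      assume "i \<in> S \<and> g i = b"
      then show "i \<in> I \<and> k i - k l \<in> Ninf u z"
        using ker_subset_Ninf[OF zp(1)] by (auto simp: S_def g_def l to_grp_eq_iff)
    qed
  qed
  with z(2) b(2) show False
    by simp
qed

lemma singular_data_tail:
  fixes n
  assumes sd: "singular_data u w I c k"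
  defines "y \<equiv> stake n w"
  shows "singular_data (path_src (u, y)) (sdrop n w) {i \<in> I. act (k i) y = y} c (\<lambda>i. sec (k i) y)"
proof -
  define u' where "u' = path_src (u, y)"
  have fin: "finite I" and w: "ipath u w"
    and nz: "(\<Sum>i | i \<in> I \<and> k i \<in> Ninf u w. c i) \<noteq> 0"
    and zero: "\<And>j y. fpath u y \<Longrightarrow>
      \<exists>z \<in> cylinder A (u, y). (\<Sum>i | i \<in> I \<and> k i - j \<in> Ninf u z. c i) = 0"
    using sd by (auto simp: singular_data_def)
  have y: "fpath u y"
    unfolding y_def using w by (rule ipath_stake)
  have w': "ipath u' (sdrop n w)" "w = y @- sdrop n w"
    unfolding u'_def y_def using w by (simp_all add: ipath_sdrop stake_sdrop)
  let ?I = "{i \<in> I. act (k i) y = y}"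
  have "\<exists>z \<in> cylinder A (u', y'). (\<Sum>i | i \<in> ?I \<and> sec (k i) y - j \<in> Ninf u' z. c i) = 0"
    if y': "fpath u' y'" for j y'
  \<comment> \<open>An exponent \<open>j\<close> at the later vertex need not be a section of one at \<open>u\<close>.  Either its coset sum is
    empty, or near some path its coset contains a section \<open>sec (k l) y\<close>, and \<open>k l\<close> can take its place.\<close>
  proof (cases "\<exists>z \<in> cylinder A (u', y'). \<exists>l\<in>?I. sec (k l) y - j \<in> Ninf u' z")
    case False
    obtain z where z: "z \<in> cylinder A (u', y')"
      using cylinder_nonempty[OF y'] by blast
    then have empty: "{i. i \<in> ?I \<and> sec (k i) y - j \<in> Ninf u' z} = {}"
      using False by blast
    have "(\<Sum>i | i \<in> ?I \<and> sec (k i) y - j \<in> Ninf u' z. c i) = 0"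
      unfolding empty by simp
    with z show ?thesis
      by blast
  next
    case True
    then obtain z l where z: "z \<in> cylinder A (u', y')" and l: "l \<in> ?I" "sec (k l) y - j \<in> Ninf u' z"
      by blast
    have zp: "ipath u' z" "stake (length y') z = y'"
      using z by (simp_all add: cylinder_iff)
    obtain m where m: "sec (k l) y - j \<in> N u' (stake m z)"
      using l by (auto simp: inf_germ_kernel_def)
    define m' where "m' = max m (length y')"
    define x where "x = stake m' z"
    have x: "fpath u' x" "sec (k l) y - j \<in> N u' x"
      using m N_stake_mono[OF zp(1), of m m'] ipath_stake[OF zp(1)] by (auto simp: x_def m'_def)
    obtain x' where x': "x = y' @ x'"
      unfolding x_def using stake_prefix[of "length y'" m' z] zp(2) by (auto simp: m'_def)
    have yx: "fpath u (y @ x)"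
      using y x(1) by (simp add: is_path_append u'_def)
    obtain t where t: "t \<in> cylinder A (u, y @ x)"
      "(\<Sum>i | i \<in> I \<and> k i - k l \<in> Ninf u t. c i) = 0"
      using zero[OF yx, of "k l"] by blast
    obtain r where r: "t = y @- r" "ipath u' r"
      using t(1) cylinder_antimono cylinderE[of t u y] unfolding u'_def by (metis subsetD)
    have "stake (length (y @ x)) t = y @ x"
      using t(1) unfolding cylinder_iff by blast
    then have rx: "stake (length x) r = x"
      by (simp add: r(1) stake_shift)
    then have "r \<in> cylinder A (u', x)"
      using r(2) by (simp add: cylinder_iff)
    then have ry: "r \<in> cylinder A (u', y')"
      unfolding x' using cylinder_antimono by blast
    have lj: "sec (k l) y - j \<in> Ninf u' r"
      using x(2) rx N_subset_Ninf[of u' "length x" r] by auto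
    have eq: "{i. i \<in> I \<and> k i - k l \<in> Ninf u t} = {i. i \<in> ?I \<and> sec (k i) y - j \<in> Ninf u' r}"
    proof (intro Collect_cong)
      fix i
      have "k i - k l \<in> Ninf u t \<longleftrightarrow> act (k i - k l) y = y \<and> sec (k i - k l) y \<in> Ninf u' r"
        using Ninf_shift[OF y, of r] r unfolding u'_def by simp
      also have "\<dots> \<longleftrightarrow> act (k i) y = y \<and> sec (k i) y - sec (k l) y \<in> Ninf u' r"
        using act_diff_fix[OF y, of "k i" "k l"] act_diff_fix(2)[OF y, of "k l" "k i"] l(1) by auto
      also have "\<dots> \<longleftrightarrow> act (k i) y = y \<and> sec (k i) y - j \<in> Ninf u' r"
        using Ninf_add[OF r(2) _ lj, of "sec (k i) y - sec (k l) y"]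
          Ninf_diff[OF r(2) _ lj, of "sec (k i) y - j"] by auto
      finally show "i \<in> I \<and> k i - k l \<in> Ninf u t \<longleftrightarrow> i \<in> ?I \<and> sec (k i) y - j \<in> Ninf u' r"
        by blast
    qed
    have "(\<Sum>i | i \<in> ?I \<and> sec (k i) y - j \<in> Ninf u' r. c i) = 0"
      using t(2) unfolding eq .
    with ry show ?thesis
      by blast
  qed
  moreover have "{i. i \<in> ?I \<and> sec (k i) y \<in> Ninf u' (sdrop n w)} = {i. i \<in> I \<and> k i \<in> Ninf u w}"
    using Ninf_shift[OF y, of "sdrop n w"] w' unfolding u'_def by auto
  ultimately show ?thesis
    unfolding singular_data_def u'_def[symmetric] using fin w' nz by auto
qed

text \<open>
  In an infinite cyclic group, take as exponent the product of all nonzero differences.  A path moved by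
  this element is moved by all the differences, so it separates the exponents.
\<close>

lemma singular_data_finite:
  assumes sd: "singular_data u w I c k"
  shows "ker u \<noteq> {0}"
proof
  assume ker: "ker u = {0}"
  define D where "D = (\<Prod>(i, j) \<in> {(i, j). i \<in> I \<and> j \<in> I \<and> k i \<noteq> k j}. k i - k j)"
  have fin: "finite {(i, j). i \<in> I \<and> j \<in> I \<and> k i \<noteq> k j}"
    by (rule finite_subset[of _ "I \<times> I"]) (use sd in \<open>auto simp: singular_data_def\<close>)
  then have "D \<noteq> 0"
    by (auto simp: D_def)
  then obtain y where y: "fpath u y" "act D y \<noteq> y"
    using ker by (metis ker_iff singletonD)
  have "k i - k j \<in> ker u" if ij: "i \<in> I" "j \<in> I" "act (k i - k j) y = y" for i j
  proof (rule ccontr)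
    assume "k i - k j \<notin> ker u"
    then have "k i \<noteq> k j"
      by (auto simp: ker)
    then have "(case (i, j) of (i, j) \<Rightarrow> k i - k j) dvd D"
      unfolding D_def using ij fin by (intro dvd_prodI) auto
    then obtain q where "D = q * (k i - k j)"
      by (metis case_prod_conv dvdE mult.commute)
    then show False
      using act_mult_fix[OF y(1) ij(3)] y(2) by simp
  qed
  then show False
    using no_separating_path[OF sd y(1)] by blast
qed

lemma ipath_vertex:
  assumes "ipath u w"
  shows "rng (w !! n) = path_src (u, stake n w)"
  using ipath_stake[OF assms, of "Suc n"]
  by (simp add: stake_Suc is_path_append del: stake.simps)

text \<open>
  The stabilizers in \<open>\<int>\<close> of the prefixes of \<open>w\<close> decrease and their germ kernels increase, and both
  contain the nonzero \<open>ker u\<close>; so both are eventually constant.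
\<close>

lemma stabilizers_eventually_constant:
  assumes w: "ipath u w" and fin: "ker u \<noteq> {0}"
  obtains n0 where "\<And>n k. n \<ge> n0 \<Longrightarrow> act k (stake n w) = stake n w \<longleftrightarrow> act k (stake n0 w) = stake n0 w"
    "\<And>n k. n \<ge> n0 \<Longrightarrow> k \<in> N u (stake n w) \<longleftrightarrow> k \<in> N u (stake n0 w)"
proof -
  obtain M where M: "M \<ge> 0" "ker u = {k. M dvd k}"
    by (rule ker_generator)
  have pos: "M > 0"
    using fin M by (cases "M = 0") auto
  define S where "S n = {k. act k (stake n w) = stake n w}" for n
  \<comment> \<open>As the germ kernel lies in the stabilizer, one grows and the other shrinks, both are constant once
    their difference is.  The difference is a union of classes modulo \<open>M\<close>, hence finite data.\<close>
  define Q where "Q n = (S n - N u (stake n w)) \<inter> {0..<M}" for n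
  have p: "fpath u (stake n w)" for n
    using w by (rule ipath_stake)
  have NS: "N u (stake n w) \<subseteq> S n" for n
    by (auto simp: S_def germ_kernel_def)
  have Smono: "S n \<subseteq> S m" if mn: "m \<le> n" for m n
  proof -
    obtain ys where "stake n w = stake m w @ ys"
      using mn by (rule stake_prefix)
    then show ?thesis
      by (auto simp: S_def list_act_append)
  qed
  have Qmono: "Q n \<subseteq> Q m" if "m \<le> n" for m n
    using Smono[OF that] N_stake_mono[OF w that] by (auto simp: Q_def)
  have finQ: "finite (Q n)" for n
    by (simp add: Q_def)
  obtain m where m: "\<And>n. card (Q m) \<le> card (Q n)"
    using ex_has_least_nat[of "\<lambda>_. True" 0 "\<lambda>n. card (Q n)"] by auto
  have Qeq: "Q n = Q m" if "n \<ge> m" for n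
    using card_subset_eq[OF finQ Qmono[OF that]] m[of n] card_mono[OF finQ Qmono[OF that]] by simp
  have modM: "k mod M - k \<in> ker u" for k
    by (simp add: M minus_mod_eq_mult_div mod_eq_dvd_iff[symmetric])
  have SN_mod: "k mod M \<in> S n \<longleftrightarrow> k \<in> S n" "k mod M \<in> N u (stake n w) \<longleftrightarrow> k \<in> N u (stake n w)" for k n
  proof -
    show "k mod M \<in> S n \<longleftrightarrow> k \<in> S n"
      using act_cong_ker(1)[OF modM p] by (simp add: S_def)
    have "k mod M - k \<in> N u (stake n w)"
      using modM ker_subset_N[OF p] by blast
    then show "k mod M \<in> N u (stake n w) \<longleftrightarrow> k \<in> N u (stake n w)"
      using N_diff[OF p, of "k mod M" n "k mod M - k"] N_diff[OF p, of k n "k - k mod M"]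
        N_mult[OF p, of "k mod M - k" n "- 1"] by auto
  qed
  have SN: "k \<in> S n - N u (stake n w) \<longleftrightarrow> k \<in> S m - N u (stake m w)" if "n \<ge> m" for n k
  proof -
    have "k mod M \<in> Q n \<longleftrightarrow> k mod M \<in> Q m"
      using Qeq[OF that] by simp
    then show ?thesis
      using pos by (simp add: Q_def SN_mod)
  qed
  show ?thesis
  proof (rule that[of m])
    fix n k assume n: "m \<le> n"
    have "S n = S m" "N u (stake n w) = N u (stake m w)"
      using SN[OF n] NS[of n] NS[of m] Smono[OF n] N_stake_mono[OF w n] by blast+
    then show "act k (stake n w) = stake n w \<longleftrightarrow> act k (stake m w) = stake m w"
      "k \<in> N u (stake n w) \<longleftrightarrow> k \<in> N u (stake m w)"
      by (auto simp: S_def)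
  qed
qed

text \<open>
  Beyond the point where stabilizers and germ kernels of the prefixes of \<open>w\<close> are constant, the
  sections of the stabilizer form a subgroup of the same order \<open>m\<close> at every vertex of \<open>w\<close>.
  A cyclic group has only one subgroup of order \<open>m\<close>, so the stretch of \<open>w\<close> between two visits to
  the same vertex maps this subgroup bijectively to itself.  If the visits are as close as
  possible, then the stretch is a simple cycle.  Were there a free orbit of the maximal stable
  subgroup, then its defining path would separate the exponents.
\<close>

lemma singular_data_imp_cycle:
  assumes sd: "singular_data u w I c k"
  shows "\<exists>v e. finite (carrier (grp v)) \<and> simple_cycle A e \<and> path_rng e = v \<and>
    \<not> has_free_orbit A B v (max_stable A B e)"
proof -
  have w: "ipath u w"
    using sd by (simp add: singular_data_def)
  define V where "V n = path_src (u, stake n w)" for n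
  have p: "fpath u (stake n w)" for n
    using w by (rule ipath_stake)
  have kerV: "ker (V n) \<noteq> {0}" for n
    unfolding V_def using singular_data_finite[OF singular_data_tail[OF sd]] .
  obtain n0 where Sc: "\<And>n k. n \<ge> n0 \<Longrightarrow> act k (stake n w) = stake n w \<longleftrightarrow> act k (stake n0 w) = stake n0 w"
    and Nc: "\<And>n k. n \<ge> n0 \<Longrightarrow> k \<in> N u (stake n w) \<longleftrightarrow> k \<in> N u (stake n0 w)"
    using stabilizers_eventually_constant[OF w singular_data_finite[OF sd]] by metis
  define S0 where "S0 = {k. act k (stake n0 w) = stake n0 w}"
  have "0 \<in> S0" and "\<And>a b. a \<in> S0 \<Longrightarrow> b \<in> S0 \<Longrightarrow> a - b \<in> S0"
    using act_zero[OF p] act_diff_fix(1)[OF p] by (simp_all add: S0_def)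
  then obtain s where s: "S0 = {k. s dvd k}"
    using int_subgroup_generator[of S0] by metis
  have S: "act k (stake n w) = stake n w \<longleftrightarrow> s dvd k" if "n \<ge> n0" for n k
    using Sc[OF that] s unfolding S0_def by blast
  \<comment> \<open>The subgroup transported along \<open>w\<close> is generated at the vertex \<open>V n\<close> by \<open>\<sigma> n\<close>.\<close>
  define \<sigma> where "\<sigma> n = sec s (stake n w)" for n
  have sec_mult: "act (a * s) (stake n w) = stake n w" "sec (a * s) (stake n w) = a * \<sigma> n"
    if "n \<ge> n0" for a n
    using act_mult_fix[OF p, of s n a] S[OF that, of s] by (simp_all add: \<sigma>_def)
  have \<sigma>_ker: "a * \<sigma> n \<in> ker (V n) \<longleftrightarrow> a * s \<in> N u (stake n0 w)" if "n \<ge> n0" for a n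
    using Nc[OF that, of "a * s"] sec_mult[OF that, of a] by (simp add: germ_kernel_def V_def)
  have repeat: "\<exists>d i. d > 0 \<and> n0 \<le> i \<and> V i = V (i + d)"
  proof -
    have "\<not> inj_on V {n0..n0 + CARD('n)}"
    proof
      assume "inj_on V {n0..n0 + CARD('n)}"
      then have "card {n0..n0 + CARD('n)} \<le> CARD('n)"
        by (intro card_inj_on_le) auto
      then show False
        by simp
    qed
    then obtain i j where ij: "n0 \<le> i" "n0 \<le> j" "V i = V j" "i \<noteq> j"
      by (auto simp: inj_on_def)
    show ?thesis
    proof (cases "i < j")
      case True
      then show ?thesis
        using ij by (intro exI[of _ "j - i"] exI[of _ i]) auto
    next
      case False
      then show ?thesis
        using ij by (intro exI[of _ "i - j"] exI[of _ j]) auto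
    qed
  qed
  define P where "P d \<longleftrightarrow> d > 0 \<and> (\<exists>i. n0 \<le> i \<and> V i = V (i + d))" for d
  \<comment> \<open>The least distance between two visits to a vertex makes the vertices in between distinct.\<close>
  define d where "d = (LEAST d. P d)"
  have "\<exists>d. P d"
    using repeat unfolding P_def by blast
  then have "P d"
    unfolding d_def by (rule LeastI_ex)
  then obtain i where d: "d > 0" and i: "n0 \<le> i" "V i = V (i + d)"
    unfolding P_def by blast
  have least: "d \<le> d'" if "P d'" for d'
    unfolding d_def using that by (rule Least_le)
  define v where "v = V i"
  define es where "es = stake d (sdrop i w)"
  have split: "stake (i + d) w = stake i w @ es"
    by (simp add: es_def)
  have es: "fpath v es" "path_src (v, es) = v" "es \<noteq> []"
  proof -
    show "fpath v es"
      using p[of "i + d"] unfolding split by (simp add: is_path_append v_def V_def)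
    show "path_src (v, es) = v"
      using i(2) unfolding V_def split by (simp add: v_def V_def)
    show "es \<noteq> []"
      using d by (simp add: es_def)
  qed
  have nth: "rng (es ! t) = V (i + t)" if "t < d" for t
    using that ipath_vertex[OF w, of "i + t"] by (simp add: es_def V_def sdrop_snth)
  have "distinct (map rng es)"
  proof -
    have "V (i + a) \<noteq> V (i + b)" if "a < b" "b < d" for a b
    proof
      assume "V (i + a) = V (i + b)"
      then have "P (b - a)"
        unfolding P_def using that i(1) by (intro conjI exI[of _ "i + a"]) auto
      then show False
        using least that by fastforce
    qed
    then show ?thesis
      unfolding distinct_conv_nth using nth
      by (auto simp: es_def) (metis nat_neq_iff)
  qed
  then have simple: "simple_cycle A (v, es)"
    using es by (intro simple_cycleI)
  have fin: "finite (carrier (grp v))"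
    using kerV finite_grp unfolding v_def by blast
  obtain M where M: "M \<ge> 0" "ker v = {k. M dvd k}"
    by (rule ker_generator)
  have "M > 0"
    using kerV[of i] M unfolding v_def by (cases "M = 0") auto
  moreover have "M dvd a * \<sigma> i \<longleftrightarrow> M dvd a * \<sigma> (i + d)" for a
    using \<sigma>_ker[of i a] \<sigma>_ker[of "i + d" a] i M(2) unfolding v_def by auto
  ultimately obtain t where t: "M dvd \<sigma> (i + d) - t * \<sigma> i"
    using same_order_imp_multiple by blast
  define H where "H = {to_grp v (a * \<sigma> i) | a. True}"
  have sec_es: "act (a * \<sigma> i) es = es" "sec (a * \<sigma> i) es = a * \<sigma> (i + d)" for a
    using sec_mult[of i a] sec_mult[of "i + d" a] i(1) unfolding split
    by (simp_all add: list_act_append list_sect_append)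
  have "stable_subgroup A B (v, es) H"
    unfolding stable_subgroup_iff[OF es(1,2)]
  proof (intro conjI allI impI)
    show "subgroup H (grp v)"
    proof (rule group.subgroupI[OF group_grp])
      show "H \<subseteq> carrier (grp v)" "H \<noteq> {}"
        by (auto simp: H_def)
      show "inv\<^bsub>grp v\<^esub> g \<in> H" if "g \<in> H" for g
        using that by (auto simp: H_def inv_to_grp) (metis mult_minus_left)
      show "g \<otimes>\<^bsub>grp v\<^esub> h \<in> H" if "g \<in> H" "h \<in> H" for g h
        using that by (auto simp: H_def mult_to_grp) (metis distrib_right)
    qed
    show "act k es = es" if k: "to_grp v k \<in> H" for k
    proof -
      obtain a where "k - a * \<sigma> i \<in> ker v"
        using k by (auto simp: H_def to_grp_eq_iff)
      then show ?thesis
        using act_cong_ker(1)[OF _ es(1)] sec_es by metis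
    qed
    have sect: "sect A B (to_grp v (a * \<sigma> i)) (v, es) = to_grp v (a * \<sigma> (i + d))" for a
      using sect_to_grp[OF es(1), of "a * \<sigma> i"] sec_es es(2) by simp
    have "inj_on (\<lambda>h. sect A B h (v, es)) H"
    proof (rule inj_onI)
      fix g h assume gh: "g \<in> H" "h \<in> H" "sect A B g (v, es) = sect A B h (v, es)"
      then obtain a b where ab: "g = to_grp v (a * \<sigma> i)" "h = to_grp v (b * \<sigma> i)"
        by (auto simp: H_def)
      then have "a * \<sigma> (i + d) - b * \<sigma> (i + d) \<in> ker v"
        using gh(3) by (simp add: sect to_grp_eq_iff)
      then have "(a - b) * \<sigma> (i + d) \<in> ker (V (i + d))"
        using i(2) by (simp add: v_def left_diff_distrib)
      then have "(a - b) * \<sigma> i \<in> ker v"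
        using \<sigma>_ker[of i "a - b"] \<sigma>_ker[of "i + d" "a - b"] i(1) by (simp add: v_def)
      then show "g = h"
        by (simp add: ab to_grp_eq_iff left_diff_distrib)
    qed
    moreover have "(\<lambda>h. sect A B h (v, es)) ` H \<subseteq> H"
    proof
      fix g assume "g \<in> (\<lambda>h. sect A B h (v, es)) ` H"
      then obtain a where a: "g = to_grp v (a * \<sigma> (i + d))"
        by (auto simp: H_def sect)
      have "M dvd a * (\<sigma> (i + d) - t * \<sigma> i)"
        using t by (rule dvd_mult)
      then have "g = to_grp v ((a * t) * \<sigma> i)"
        by (simp add: a to_grp_eq_iff M right_diff_distrib mult.assoc)
      then show "g \<in> H"
        by (auto simp: H_def)
    qed
    moreover have "finite H"
      using fin by (rule finite_subset[rotated]) (auto simp: H_def)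
    ultimately show "bij_betw (\<lambda>h. sect A B h (v, es)) H H"
      by (simp add: bij_betw_def endo_inj_surj)
  qed
  then have H_le: "H \<subseteq> max_stable A B (v, es)"
    using max_stable(2)[OF es(1,2) fin] by blast
  have sub: "subgroup (max_stable A B (v, es)) (grp v)"
    using max_stable(1)[OF es(1,2) fin] by (simp add: stable_subgroup_iff[OF es(1,2)])
  have "\<not> has_free_orbit A B v (max_stable A B (v, es))"
  proof
    assume free: "has_free_orbit A B v (max_stable A B (v, es))"
    have "finite (max_stable A B (v, es))"
      using fin subgroup.subset[OF sub] finite_subset by blast
    then obtain y where y: "fpath v y"
      "\<And>k. to_grp v k \<in> max_stable A B (v, es) \<Longrightarrow> act k y = y \<Longrightarrow> k \<in> ker v"
      using free_orbit_prefix[OF sub _ free] by metis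
    have sd': "singular_data v (sdrop i w) {l \<in> I. act (k l) (stake i w) = stake i w} c
        (\<lambda>l. sec (k l) (stake i w))"
      using singular_data_tail[OF sd, of i] by (simp add: v_def V_def)
    show False
    proof (rule no_separating_path[OF sd' y(1)])
      fix l j assume l: "l \<in> {l \<in> I. act (k l) (stake i w) = stake i w}"
        and j: "j \<in> {l \<in> I. act (k l) (stake i w) = stake i w}"
        and fixed: "act (sec (k l) (stake i w) - sec (k j) (stake i w)) y = y"
      have "s dvd k l" "s dvd k j"
        using l j S[OF i(1)] by blast+
      moreover define a b where "a = k l div s" and "b = k j div s"
      ultimately have "k l = a * s" "k j = b * s"
        by simp_all
      then have eq: "sec (k l) (stake i w) - sec (k j) (stake i w) = (a - b) * \<sigma> i"
        using sec_mult(2)[OF i(1)] by (simp add: left_diff_distrib)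
      have "to_grp v ((a - b) * \<sigma> i) \<in> max_stable A B (v, es)"
        using H_le by (auto simp: H_def)
      then show "sec (k l) (stake i w) - sec (k j) (stake i w) \<in> ker v"
        using y(2) fixed unfolding eq by blast
    qed
  qed
  then show ?thesis
    using fin simple by (intro exI[of _ v] exI[of _ "(v, es)"]) (simp add: path_rng_def)
qed

section \<open>Local form of functions in the Steinberg algebra\<close>

text \<open>
  Near \<open>w\<close> each bisection \<open>U\<close> in a linear combination is empty or given by one element
  \<open>p\<^sub>U g\<^sub>u\<^sup>k x\<^sup>*\<close>, where \<open>x\<close> is a long prefix of \<open>w\<close>.  Only those with the path
  \<open>p\<^sub>U\<close> of the germ at which the function is nonzero matter, and dividing by the group element of
  that germ moves the germ to the unit \<open>u\<close>.
\<close>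

lemma singular_ideal_imp_singular_data:
  fixes f :: "'n germ \<Rightarrow> 'k::field"
  assumes f: "f \<in> singular_ideal A B" and nz: "f \<noteq> (\<lambda>_. 0)"
  obtains u w and I :: "'n germ set set" and c :: "'n germ set \<Rightarrow> 'k" and k
  where "singular_data u w I c k"
proof -
  obtain F :: "'n germ set set" and c :: "'n germ set \<Rightarrow> 'k" where
    F: "finite F" "\<And>U. U \<in> F \<Longrightarrow> compact_open_bisection A B U"
    and f_eq: "f = (\<lambda>\<gamma>. \<Sum>U\<in>F. c U * indicator U \<gamma>)"
    using f by (auto simp: singular_ideal_def steinberg_def)
  have int: "germ_topology A B interior_of {\<gamma> \<in> germs A B. f \<gamma> \<noteq> 0} = {}"
    using f by (simp add: singular_ideal_def)
  have germs: "U \<subseteq> germs A B" and inj: "inj_on germ_src U" if "U \<in> F" for U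
    using F(2)[OF that] by (auto simp: compact_open_bisection_def openin_germs_iff)
  obtain \<gamma> where \<gamma>: "f \<gamma> \<noteq> 0"
    using nz by blast
  then obtain U0 where "U0 \<in> F" "\<gamma> \<in> U0"
    unfolding f_eq by (metis (no_types, lifting) indicator_simps(2) mult_zero_right sum.neutral)
  then have "\<gamma> \<in> germs A B"
    using germs by blast
  then obtain s0 w where s0: "s0 \<in> selts A B" "w \<in> sdom A s0" "\<gamma> = germ A B s0 w"
    by (rule germs_cases)
  have winf: "w \<in> inf_paths A"
    using s0(2) by (rule sdom_inf_paths)
  define z where "z = rng (shd w)"
  have w: "ipath z w"
    using winf by (simp add: inf_paths_iff z_def)
  have "\<exists>n0. \<forall>n\<ge>n0. (\<forall>\<gamma>\<in>U. germ_src \<gamma> \<notin> cyl n w) \<or>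
    (\<exists>s\<in>selts A B. cyl n w \<subseteq> sdom A s \<and> (\<forall>y\<in>cyl n w. germ A B s y \<in> U))" if "U \<in> F" for U
    using bisection_near_path[OF F(2)[OF that], of w] by metis
  then obtain nU where nU: "\<And>U n. U \<in> F \<Longrightarrow> n \<ge> nU U \<Longrightarrow> (\<forall>\<gamma>\<in>U. germ_src \<gamma> \<notin> cyl n w) \<or>
    (\<exists>s\<in>selts A B. cyl n w \<subseteq> sdom A s \<and> (\<forall>y\<in>cyl n w. germ A B s y \<in> U))"
    by metis
  \<comment> \<open>At this length each bisection is known to be empty near \<open>w\<close> or given there by one
  element; those of the second kind form \<open>F'\<close>.\<close>
  define n1 where "n1 = Max (insert 0 (nU ` F))"
  have n1: "nU U \<le> n1" if "U \<in> F" for U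
    using F(1) that by (simp add: n1_def)
  define F' where "F' = {U \<in> F. \<exists>s\<in>selts A B. cyl n1 w \<subseteq> sdom A s \<and> (\<forall>y\<in>cyl n1 w. germ A B s y \<in> U)}"
  have F'F: "F' \<subseteq> F"
    by (auto simp: F'_def)
  have "\<forall>U\<in>F'. \<exists>s. s \<in> selts A B \<and> cyl n1 w \<subseteq> sdom A s \<and> (\<forall>y\<in>cyl n1 w. germ A B s y \<in> U)"
    unfolding F'_def by blast
  from bchoice[OF this] obtain S where S: "\<And>U. U \<in> F' \<Longrightarrow> S U \<in> selts A B \<and>
      cyl n1 w \<subseteq> sdom A (S U) \<and> (\<forall>y\<in>cyl n1 w. germ A B (S U) y \<in> U)"
    by blast
  have empty: "\<forall>\<gamma>\<in>U. germ_src \<gamma> \<notin> cyl n1 w" if "U \<in> F - F'" for U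
    using nU[OF _ n1, of U] that unfolding F'_def by blast
  obtain m0 v0 where m0: "\<And>n. n \<ge> m0 \<Longrightarrow> \<exists>xs a. local_form s0 w n v0 xs a"
    using ex_local_form[OF s0(1,2)] by metis
  have "\<exists>m v. \<forall>n\<ge>m. \<exists>xs a. local_form (S U) w n v xs a" if "U \<in> F'" for U
    using S[OF that] ex_local_form[of "S U" w] cyl_self[OF winf] by (metis subsetD)
  then obtain m v where mv: "\<And>U n. U \<in> F' \<Longrightarrow> n \<ge> m U \<Longrightarrow> \<exists>xs a. local_form (S U) w n (v U) xs a"
    by metis
  \<comment> \<open>At this length, in addition, all these elements are written with the same prefix of \<open>w\<close>.\<close>
  define n where "n = max (max n1 m0) (Max (insert 0 (m ` F')))"
  have "finite F'"
    using F(1) F'F finite_subset by blast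
  then have n: "n1 \<le> n" "m0 \<le> n" "\<And>U. U \<in> F' \<Longrightarrow> m U \<le> n"
    by (auto simp: n_def le_max_iff_disj)
  define ys where "ys = stake n w"
  define u where "u = path_src (z, ys)"
  have cyl: "cyl n w = cylinder A (z, ys)"
    unfolding ys_def using w by (rule cyl_eq)
  have cyl_le: "cyl n w \<subseteq> cyl n1 w"
    using n(1) by (rule cyl_antimono)
  have ys: "fpath z ys"
    unfolding ys_def using w by (rule ipath_stake)
  obtain x0 a0 where x0: "valid v0 x0 z ys"
    "\<And>y. y \<in> cyl n w \<Longrightarrow> germ A B s0 y = germ A B (elt v0 x0 a0 z ys) y"
    using m0[OF n(2)] unfolding local_form_def Let_def ys_def z_def by blast
  have "\<forall>U\<in>F'. \<exists>xs a. valid (v U) xs z ys \<and>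
      (\<forall>y\<in>cyl n w. germ A B (S U) y = germ A B (elt (v U) xs a z ys) y)"
    using mv n(3) unfolding local_form_def Let_def ys_def z_def by blast
  then obtain xs a where xs: "\<And>U. U \<in> F' \<Longrightarrow> valid (v U) (xs U) z ys"
    "\<And>U y. U \<in> F' \<Longrightarrow> y \<in> cyl n w \<Longrightarrow> germ A B (S U) y = germ A B (elt (v U) (xs U) (a U) z ys) y"
    by metis
  define I where "I = {U \<in> F'. v U = v0 \<and> xs U = x0}"
  have f_at: "f (germ A B (elt v0 x0 j z ys) (ys @- r)) = (\<Sum>U | U \<in> I \<and> a U - j \<in> Ninf u r. c U)"
    if r: "ipath u r" for j r
  proof -
    let ?\<gamma> = "germ A B (elt v0 x0 j z ys) (ys @- r)"
    have yr: "ys @- r \<in> cyl n w"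
      unfolding cyl using ys r unfolding u_def by (rule shift_in_cylinder)
    have sel: "elt v0 x0 j z ys \<in> selts A B" "ys @- r \<in> sdom A (elt v0 x0 j z ys)"
      using x0(1) yr by (simp_all add: elt_in_selts sdom_elt cyl)
    have src: "germ_src ?\<gamma> = ys @- r"
      using sel by (rule germ_src_germ)
    have mem: "?\<gamma> \<in> U \<longleftrightarrow> U \<in> I \<and> a U - j \<in> Ninf u r" if U: "U \<in> F" for U
    proof (cases "U \<in> F'")
      case True
      have SU: "germ A B (S U) (ys @- r) \<in> U" "germ_src (germ A B (S U) (ys @- r)) = ys @- r"
        using S[OF True] yr cyl_le germ_src_germ by blast+
      have "?\<gamma> \<in> U \<longleftrightarrow> germ A B (S U) (ys @- r) = ?\<gamma>"
        using SU src inj[OF U] unfolding inj_on_def by metis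
      also have "\<dots> \<longleftrightarrow> germ A B (elt (v U) (xs U) (a U) z ys) (ys @- r) = ?\<gamma>"
        using xs(2)[OF True yr] by simp
      also have "\<dots> \<longleftrightarrow> U \<in> I \<and> a U - j \<in> Ninf u r"
        unfolding germ_eq_same_dom[OF xs(1)[OF True] x0(1) r[unfolded u_def]]
        using True by (simp add: I_def u_def)
      finally show ?thesis .
    next
      case False
      then have "?\<gamma> \<notin> U"
        using empty[of U] U src yr cyl_le by (metis DiffI subsetD)
      then show ?thesis
        using False by (simp add: I_def)
    qed
    have IF: "I \<subseteq> F"
      using F'F by (auto simp: I_def)
    have "f ?\<gamma> = (\<Sum>U\<in>F. if U \<in> I \<and> a U - j \<in> Ninf u r then c U else 0)"
      unfolding f_eq using mem by (intro sum.cong refl) (auto simp: indicator_def)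
    also have "\<dots> = (\<Sum>U | U \<in> F \<and> U \<in> I \<and> a U - j \<in> Ninf u r. c U)"
      using F(1) by (simp add: sum.inter_filter)
    also have "{U. U \<in> F \<and> U \<in> I \<and> a U - j \<in> Ninf u r} = {U. U \<in> I \<and> a U - j \<in> Ninf u r}"
      using IF by blast
    finally show ?thesis .
  qed
  have "singular_data u (sdrop n w) I c (\<lambda>U. a U - a0)"
    unfolding singular_data_def
  proof (intro conjI allI impI)
    show "finite I"
      using \<open>finite F'\<close> by (simp add: I_def)
    show tail: "ipath u (sdrop n w)"
      unfolding u_def ys_def using w by (rule ipath_sdrop)
    have "\<gamma> = germ A B (elt v0 x0 a0 z ys) (ys @- sdrop n w)"
      using s0(3) x0(2)[OF cyl_self[OF winf]] by (simp add: ys_def stake_sdrop)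
    then show "(\<Sum>U | U \<in> I \<and> a U - a0 \<in> Ninf u (sdrop n w). c U) \<noteq> 0"
      using \<gamma> f_at[OF tail] by simp
    fix j y assume y: "fpath u y"
    then have zy: "fpath z (ys @ y)"
      using ys by (simp add: is_path_append u_def)
    obtain t where t: "t \<in> cylinder A (z, ys @ y)"
      using cylinder_nonempty[OF zy] by blast
    let ?s = "elt v0 x0 (j + a0) z ys"
    have s: "?s \<in> selts A B" "t \<in> sdom A ?s"
      using t x0(1) cylinder_antimono by (auto simp: elt_in_selts sdom_elt)
    have "{\<gamma> \<in> germs A B. f \<gamma> \<noteq> 0} \<subseteq> germs A B"
      by blast
    from int[unfolded interior_of_empty_iff[OF this], rule_format, OF s, of "length (ys @ y)"]
    obtain t' where t': "t' \<in> cyl (length (ys @ y)) t" "t' \<in> sdom A ?s"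
      "germ A B ?s t' \<notin> {\<gamma> \<in> germs A B. f \<gamma> \<noteq> 0}"
      by blast
    then have f0: "f (germ A B ?s t') = 0"
      using germ_in_germs[OF s(1)] by blast
    have t'c: "t' \<in> cylinder A (z, ys @ y)"
      using t'(1) cyl_subset_cylinder[OF t] by simp
    obtain r where r: "t' = (ys @ y) @- r" "ipath (path_src (z, ys @ y)) r"
      using t'c by (rule cylinderE)
    have yr: "y @- r \<in> cylinder A (u, y)"
      using y r(2) by (intro shift_in_cylinder) (simp_all add: u_def)
    have zero: "(\<Sum>U | U \<in> I \<and> a U - (j + a0) \<in> Ninf u (y @- r). c U) = 0"
      using f_at[of "y @- r" "j + a0"] yr f0 r(1) by (simp add: cylinder_iff)
    have "a U - a0 - j = a U - (j + a0)" for U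
      by simp
    then show "\<exists>r\<in>cylinder A (u, y). (\<Sum>U | U \<in> I \<and> a U - a0 - j \<in> Ninf u r. c U) = 0"
      by (intro bexI[OF _ yr]) (simp only: zero)
  qed
  then show ?thesis
    by (rule that)
qed

end



section \<open>A polynomial that is not divisible by \<open>t^m - 1\<close>\<close>

abbreviation root_poly :: "nat \<Rightarrow> 'a::comm_ring_1 poly" where
  "root_poly n \<equiv> Polynomial.monom 1 n - 1"

lemma root_poly_nonzero: "n > 0 \<Longrightarrow> root_poly n \<noteq> (0 :: 'a::comm_ring_1 poly)"
proof
  assume "n > 0" "root_poly n = (0 :: 'a poly)"
  then have "poly.coeff (root_poly n :: 'a poly) n = 0"
    by simp
  with \<open>n > 0\<close> show False
    by simp
qed

lemma degree_root_poly: "n > 0 \<Longrightarrow> Polynomial.degree (root_poly n :: 'a::comm_ring_1 poly) = n"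
proof -
  assume "n > 0"
  then have "Polynomial.degree (1 :: 'a poly) < Polynomial.degree (Polynomial.monom (1::'a) n)"
    by (simp add: degree_monom_eq)
  then show ?thesis
    using degree_add_eq_left[of "- 1" "Polynomial.monom (1::'a) n"] by (simp add: degree_monom_eq)
qed

text \<open>The derivative \<open>n t^(n-1)\<close> does not vanish at a root of unity, so such a root is simple.\<close>

lemma order_root_poly:
  fixes z :: "'a::field"
  assumes "z ^ n = 1" "of_nat n \<noteq> (0 :: 'a)"
  shows "Polynomial.order z (root_poly n) = 1"
proof -
  let ?p = "root_poly n :: 'a poly"
  have n: "n > 0"
    using assms(2) by (cases n) auto
  have p0: "?p \<noteq> 0"
    using n by (rule root_poly_nonzero)
  have z0: "z \<noteq> 0"
    using assms(1) n by (metis power_0_left less_irrefl zero_neq_one)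
  have "poly (pderiv ?p) z = of_nat n * z ^ (n - 1)"
    by (simp add: pderiv_diff pderiv_monom poly_monom)
  then have d: "poly (pderiv ?p) z \<noteq> 0"
    using assms(2) z0 by simp
  have "poly ?p z = 0"
    using assms(1) by (simp add: poly_monom)
  then have "Polynomial.order z ?p \<noteq> 0"
    using p0 order_root by blast
  moreover have "\<not> 2 \<le> Polynomial.order z ?p"
  proof
    assume "2 \<le> Polynomial.order z ?p"
    then have "[:- z, 1:] ^ 2 dvd ?p"
      using order_divides by blast
    then obtain q where "?p = [:- z, 1:] * ([:- z, 1:] * q)"
      by (metis dvdE power2_eq_square mult.assoc)
    then have "pderiv ?p = [:- z, 1:] * pderiv ([:- z, 1:] * q) + ([:- z, 1:] * q) * pderiv [:- z, 1:]"
      by (simp only: pderiv_mult)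
    then have "poly (pderiv ?p) z = 0"
      by simp
    with d show False ..
  qed
  ultimately show ?thesis
    by linarith
qed

lemma card_roots_of_unity:
  assumes "of_nat n \<noteq> (0 :: 'a::alg_closed_field)"
  shows "finite {z :: 'a::alg_closed_field. z ^ n = 1}" "card {z :: 'a. z ^ n = 1} = n"
proof -
  let ?p = "root_poly n :: 'a poly"
  have n: "n > 0"
    using assms by (cases n) auto
  then have p0: "?p \<noteq> 0"
    by (rule root_poly_nonzero)
  obtain M where M: "size M = Polynomial.degree ?p"
    "?p = Polynomial.smult (Polynomial.lead_coeff ?p) (\<Prod>x\<in>#M. [:-x, 1:])"
    using alg_closed_imp_factorization[OF p0] by blast
  have lc: "Polynomial.lead_coeff ?p \<noteq> 0"
    using p0 by (rule leading_coeff_neq_0)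
  have "poly ?p z = 0 \<longleftrightarrow> z \<in># M" for z
  proof -
    have "poly ?p z = Polynomial.lead_coeff ?p * (\<Prod>x\<in>#M. z - x)"
      by (subst M(2)) (simp add: poly_prod_mset)
    then show ?thesis
      using lc by (auto simp: prod_mset_zero_iff)
  qed
  then have set: "set_mset M = {z. z ^ n = 1}"
    by (auto simp: poly_monom)
  then show "finite {z :: 'a. z ^ n = 1}"
    by (metis finite_set_mset)
  have "count M z = 1" if z: "z \<in># M" for z
  proof (rule ccontr)
    assume "count M z \<noteq> 1"
    with z have "count (M - {#z#}) z \<noteq> 0"
      by (simp add: count_greater_zero_iff[symmetric] del: count_greater_zero_iff)
    then obtain M' where "M = add_mset z (add_mset z M')"
      using z by (metis count_eq_zero_iff insert_DiffM)
    then have "(\<Prod>x\<in>#M. [:-x, 1:]) = [:- z, 1:] ^ 2 * (\<Prod>x\<in>#M'. [:-x, 1:])"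
      by (simp only: image_mset_add_mset prod_mset.add_mset power2_eq_square mult.assoc)
    then have "[:- z, 1:] ^ 2 dvd ?p"
      by (metis M(2) dvd_smult dvd_triv_left)
    then have "2 \<le> Polynomial.order z ?p"
      using p0 order_divides by blast
    moreover have "z ^ n = 1"
      using z set by blast
    ultimately show False
      using order_root_poly[OF _ assms, of z] by simp
  qed
  then have "size M = card (set_mset M)"
    by (simp add: size_multiset_overloaded_eq)
  then show "card {z :: 'a. z ^ n = 1} = n"
    using M(1) n by (simp add: set degree_root_poly)
qed

lemma exact_order_least:
  fixes z :: "'a::field"
  assumes "n > 0" "z ^ n = 1"
  defines "d \<equiv> LEAST d. d > 0 \<and> z ^ d = 1"
  shows "d > 0" "z ^ d = 1" "d dvd n" "\<And>e. e > 0 \<Longrightarrow> z ^ e = 1 \<Longrightarrow> d \<le> e"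
proof -
  have d: "d > 0 \<and> z ^ d = 1"
    unfolding d_def by (rule LeastI[of _ n]) (use assms in auto)
  then show "d > 0" "z ^ d = 1"
    by auto
  show least: "d \<le> e" if "e > 0" "z ^ e = 1" for e
    unfolding d_def by (rule Least_le) (use that in auto)
  have "z ^ n = (z ^ d) ^ (n div d) * z ^ (n mod d)"
    by (metis mult_div_mod_eq power_add power_mult)
  then have "z ^ (n mod d) = 1"
    using assms(2) d by simp
  then show "d dvd n"
    using least[of "n mod d"] d by (metis dvd_eq_mod_eq_0 mod_less_divisor not_less gr0I)
qed

text \<open>
  The elements of order \<open>d\<close>, for \<open>d\<close> dividing \<open>n\<close>, partition the \<open>n\<close>-th roots of unity, so their
  numbers satisfy the recursion that determines Euler's totient.
\<close>

lemma ex_primitive_root: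
  assumes "of_nat n \<noteq> (0 :: 'a::alg_closed_field)"
  obtains z :: "'a::alg_closed_field" where "z ^ n = 1" "\<And>d. z ^ d = 1 \<Longrightarrow> n dvd d"
proof -
  define F where "F d = {z :: 'a. z ^ d = 1 \<and> (LEAST e. e > 0 \<and> z ^ e = 1) = d}" for d
  have "card (F n) = totient n"
    using assms
  proof (induction n rule: less_induct)
    case (less n)
    have n: "n > 0"
      using less.prems by (cases n) auto
    have fin: "finite {d. d dvd n}"
      using n by simp
    have dvd: "of_nat d \<noteq> (0 :: 'a)" if "d dvd n" for d
      using less.prems that by (metis dvdE mult_zero_left of_nat_mult)
    have "{z :: 'a. z ^ n = 1} = (\<Union>d\<in>{d. d dvd n}. F d)"
    proof (intro equalityI subsetI)
      fix z :: 'a assume "z \<in> {z. z ^ n = 1}"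
      then have "z ^ n = 1" by simp
      from exact_order_least[OF n this] show "z \<in> (\<Union>d\<in>{d. d dvd n}. F d)"
        by (auto simp: F_def)
    next
      fix z :: 'a assume "z \<in> (\<Union>d\<in>{d. d dvd n}. F d)"
      then show "z \<in> {z. z ^ n = 1}"
        by (auto simp: F_def power_mult)
    qed
    moreover have "card (\<Union>d\<in>{d. d dvd n}. F d) = (\<Sum>d | d dvd n. card (F d))"
    proof (rule card_UN_disjoint)
      show "\<forall>d\<in>{d. d dvd n}. finite (F d)"
        using card_roots_of_unity(1)[OF dvd] by (auto simp: F_def intro: finite_subset[rotated])
      show "\<forall>d\<in>{d. d dvd n}. \<forall>e\<in>{d. d dvd n}. d \<noteq> e \<longrightarrow> F d \<inter> F e = {}"
        by (auto simp: F_def)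
    qed (rule fin)
    ultimately have "(\<Sum>d | d dvd n. card (F d)) = n"
      using card_roots_of_unity(2)[OF less.prems] by simp
    also have "n = (\<Sum>d | d dvd n. totient d)"
      by (rule totient_divisor_sum[symmetric])
    finally have sums: "(\<Sum>d | d dvd n. card (F d)) = (\<Sum>d | d dvd n. totient d)" .
    have split: "{d. d dvd n} = insert n {d. d dvd n \<and> d < n}"
      using n by (auto dest: dvd_imp_le)
    have "(\<Sum>d | d dvd n \<and> d < n. card (F d)) = (\<Sum>d | d dvd n \<and> d < n. totient d)"
      using less.IH dvd by (intro sum.cong) auto
    moreover have "finite {d. d dvd n \<and> d < n}"
      by simp
    ultimately show ?case
      using sums unfolding split by simp
  qed
  moreover have "n > 0"
    using assms by (cases n) auto
  ultimately have "F n \<noteq> {}"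
    by (metis card.empty totient_0_iff less_irrefl)
  then obtain z where "z \<in> F n"
    by blast
  then have z: "z ^ n = 1" "(LEAST e. e > 0 \<and> z ^ e = 1) = n"
    by (simp_all add: F_def)
  show ?thesis
  proof (rule that[OF z(1)])
    fix d assume "z ^ d = 1"
    then show "n dvd d"
      using exact_order_least(3)[of d z] z(2) by (cases "d = 0") auto
  qed
qed

lemma order_prod:
  assumes "finite S" "\<And>i. i \<in> S \<Longrightarrow> f i \<noteq> 0"
  shows "Polynomial.order z (\<Prod>i\<in>S. f i :: 'a::idom poly) = (\<Sum>i\<in>S. Polynomial.order z (f i))"
  using assms
proof (induction S rule: finite_induct)
  case (insert i S)
  then have "(\<Prod>i\<in>insert i S. f i) \<noteq> 0"
    by (intro prod_zero_iff[THEN iffD2, rotated] notI) (auto simp: prod_zero_iff)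
  with insert show ?case
    by (simp add: order_mult)
qed simp

text \<open>
  Raising to a power of the characteristic is additive.  The case \<open>q = 1\<close> lets characteristic zero
  be treated in the same way.
\<close>

lemma root_poly_power:
  assumes "q = 1 \<or> (normalization_semidom_class.prime CHAR('a::comm_ring_1) \<and> (\<exists>k. q = CHAR('a) ^ k))"
  shows "root_poly (n * q) = (root_poly n :: 'a poly) ^ q"
  using assms
proof
  assume *: "normalization_semidom_class.prime CHAR('a) \<and> (\<exists>k. q = CHAR('a) ^ k)"
  then obtain k where k: "q = CHAR('a) ^ k"
    by blast
  have "(root_poly n + 1 :: 'a poly) ^ q = root_poly n ^ q + 1 ^ q"
    using * k by (intro freshmans_dream'[where n = k]) simp_all
  then have "Polynomial.monom 1 n ^ q = (root_poly n :: 'a poly) ^ q + 1"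
    by simp
  then show ?thesis
    by (simp add: monom_power)
qed simp

text \<open>
  Write \<open>m = q n\<close> with \<open>q\<close> a power of the characteristic and \<open>n\<close> invertible in the field.  A primitive
  \<open>n\<close>-th root of unity \<open>z\<close> is a root of multiplicity \<open>q\<close> of \<open>t^m - 1\<close>.  It is a root of
  \<open>1 - t^d\<close> only for \<open>d = n e\<close> with \<open>e\<close> dividing \<open>q\<close>, then of multiplicity \<open>e\<close>, and the
  proper divisors of the prime power \<open>q\<close> have a sum less than \<open>q\<close>.
\<close>

lemma root_poly_not_dvd_alg_closed:
  assumes m: "m > 0"
  shows "\<not> (root_poly m :: 'a::alg_closed_field poly) dvd
    (\<Prod>d | 1 \<le> d \<and> d < m \<and> d dvd m. 1 - Polynomial.monom 1 d)"
proof
  let ?D = "{d. 1 \<le> d \<and> d < m \<and> d dvd m}"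
  let ?P = "\<Prod>d\<in>?D. 1 - Polynomial.monom 1 d :: 'a poly"
  assume dvd: "(root_poly m :: 'a poly) dvd ?P"
  obtain q n where qn: "m = n * q" "of_nat n \<noteq> (0 :: 'a)" and
    q: "q = 1 \<or> (normalization_semidom_class.prime CHAR('a) \<and> (\<exists>k. q = CHAR('a) ^ k))"
  proof (cases "CHAR('a) = 0")
    case True
    then have "of_nat m \<noteq> (0 :: 'a)"
      using m by (simp add: of_nat_eq_0_iff_char_dvd)
    then show ?thesis
      using that[of m 1] by simp
  next
    case False
    then have p: "normalization_semidom_class.prime CHAR('a)"
      using prime_CHAR_semidom by blast
    obtain y where y: "m = CHAR('a) ^ multiplicity CHAR('a) m * y" "\<not> CHAR('a) dvd y"
      using multiplicity_decompose'[of m "CHAR('a)"] m p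
      by (metis not_prime_unit less_irrefl)
    then show ?thesis
      using that[of y "CHAR('a) ^ multiplicity CHAR('a) m"] p
      by (auto simp: of_nat_eq_0_iff_char_dvd mult.commute)
  qed
  have n: "n > 0" and q0: "q > 0"
    using m qn(1) by (cases n; cases q; simp)+
  obtain z :: 'a where z: "z ^ n = 1" "\<And>d. z ^ d = 1 \<Longrightarrow> n dvd d"
    using ex_primitive_root[OF qn(2)] by blast
  have order_n: "Polynomial.order z (root_poly (n * e) :: 'a poly) = e"
    if "e = 1 \<or> (normalization_semidom_class.prime CHAR('a) \<and> (\<exists>k. e = CHAR('a) ^ k))" for e
  proof -
    have "Polynomial.order z ((root_poly n :: 'a poly) ^ e) = e"
    proof (induction e)
      case (Suc e)
      have "(root_poly n :: 'a poly) ^ e \<noteq> 0" "root_poly n \<noteq> (0 :: 'a poly)"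
        using root_poly_nonzero[OF n] by auto
      then show ?case
        using Suc order_root_poly[OF z(1) qn(2)] by (simp add: order_mult)
    qed simp
    then show ?thesis
      using root_poly_power[OF that, of n] by simp
  qed
  have nz: "1 - Polynomial.monom 1 d \<noteq> (0 :: 'a poly)" if "d \<in> ?D" for d
    using root_poly_nonzero[of d] that by (metis (no_types, lifting) eq_iff_diff_eq_0 mem_Collect_eq
        less_le_trans zero_less_one)
  have P0: "?P \<noteq> 0"
    using nz by (subst prod_zero_iff) auto
  have order_d: "Polynomial.order z (1 - Polynomial.monom 1 d :: 'a poly) = (if n dvd d then d div n else 0)"
    if d: "d \<in> ?D" for d
  proof (cases "n dvd d")
    case True
    then obtain e where e: "d = n * e" ..
    then have "e dvd q"
      using d qn(1) n by (simp add: dvd_mult_cancel_left)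
    then have "e = 1 \<or> (normalization_semidom_class.prime CHAR('a) \<and> (\<exists>k. e = CHAR('a) ^ k))"
      using q divides_primepow_nat by (metis nat_dvd_1_iff_1)
    then have "Polynomial.order z (root_poly (n * e) :: 'a poly) = e"
      by (rule order_n)
    moreover have "Polynomial.order z (1 - Polynomial.monom 1 d) =
        Polynomial.order z (root_poly (n * e) :: 'a poly)"
      unfolding e by (metis minus_diff_eq order_uminus)
    ultimately show ?thesis
      using True n by (simp add: e)
  next
    case False
    then have "poly (1 - Polynomial.monom 1 d) z \<noteq> 0"
      using z(2)[of d] by (auto simp: poly_monom)
    then show ?thesis
      using False by (simp add: order_0I)
  qed
  have "q = Polynomial.order z (root_poly m :: 'a poly)"
    unfolding qn(1) by (rule order_n[OF q, symmetric])
  also have "\<dots> \<le> Polynomial.order z ?P"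
    using dvd P0 by (rule dvd_imp_order_le[rotated])
  also have "\<dots> = (\<Sum>d\<in>?D. Polynomial.order z (1 - Polynomial.monom 1 d :: 'a poly))"
    using nz by (intro order_prod) auto
  also have "\<dots> = (\<Sum>d\<in>?D. if n dvd d then d div n else 0)"
    using order_d by (intro sum.cong) auto
  also have "\<dots> = (\<Sum>d | d \<in> ?D \<and> n dvd d. d div n)"
    by (rule sum.inter_filter[symmetric]) simp
  also have "\<dots> = (\<Sum>e | e dvd q \<and> e < q. e)"
  proof (rule sum.reindex_bij_witness[of _ "\<lambda>e. n * e" "\<lambda>d. d div n"])
    fix e assume "e \<in> {e. e dvd q \<and> e < q}"
    then show "n * e \<in> {d. d \<in> ?D \<and> n dvd d}"
      using n q0 by (auto simp: qn(1) Suc_le_eq intro: Nat.gr0I)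
  qed (use n in \<open>auto simp: qn(1)\<close>)
  also have "\<dots> < q"
    using q
  proof
    assume "normalization_semidom_class.prime CHAR('a) \<and> (\<exists>k. q = CHAR('a) ^ k)"
    then obtain k where p: "normalization_semidom_class.prime CHAR('a)" and k: "q = CHAR('a) ^ k"
      by blast
    have "{e. e dvd q \<and> e < q} \<subseteq> (\<lambda>j. CHAR('a) ^ j) ` {..<k}"
    proof
      fix e assume e: "e \<in> {e. e dvd q \<and> e < q}"
      then obtain j where "j \<le> k" "e = CHAR('a) ^ j"
        using divides_primepow_nat[OF p] k by auto
      then show "e \<in> (\<lambda>j. CHAR('a) ^ j) ` {..<k}"
        using e k by (cases "j = k") auto
    qed
    then have "(\<Sum>e | e dvd q \<and> e < q. e) \<le> \<Sum>((\<lambda>j. CHAR('a) ^ j) ` {..<k})"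
      by (intro sum_mono2) auto
    also have "\<dots> = (\<Sum>j<k. CHAR('a) ^ j)"
      using prime_gt_1_nat[OF p] by (subst sum.reindex) (auto intro: inj_onI simp: power_inject_exp)
    also have "\<dots> < CHAR('a) ^ k"
    proof (induction k)
      case (Suc k)
      have "2 \<le> CHAR('a)"
        using p by (rule prime_ge_2_nat)
      then have "2 * CHAR('a) ^ k \<le> CHAR('a) ^ Suc k"
        by (simp only: power_Suc mult_le_mono1)
      with Suc show ?case
        by (simp only: sum.lessThan_Suc)
    qed simp
    finally show ?thesis
      by (simp add: k)
  qed simp
  finally show False
    by simp
qed

lemma map_poly_to_ac:
  fixes p r :: "'a::field poly"
  shows "map_poly to_ac (p * r) = map_poly to_ac p * map_poly to_ac r"
    and "map_poly to_ac (p - r) = map_poly to_ac p - map_poly to_ac r"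
    and "map_poly to_ac (Polynomial.monom 1 n :: 'a poly) = Polynomial.monom 1 n"
    and "map_poly to_ac (1 :: 'a poly) = 1"
  by (rule poly_eqI; simp add: coeff_map_poly coeff_mult to_ac_sum coeff_1)+

text \<open>Divisibility survives the passage to the algebraic closure.\<close>

lemma root_poly_not_dvd:
  assumes m: "m > 0"
  shows "\<not> (root_poly m :: 'a::field poly) dvd
    (\<Prod>d | 1 \<le> d \<and> d < m \<and> d dvd m. 1 - Polynomial.monom 1 d)"
proof
  let ?h = "map_poly to_ac :: 'a poly \<Rightarrow> 'a alg_closure poly"
  let ?D = "{d. 1 \<le> d \<and> d < m \<and> d dvd m}"
  have prod: "?h (\<Prod>d\<in>S. f d) = (\<Prod>d\<in>S. ?h (f d))" for f and S :: "nat set"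
    by (induction S rule: infinite_finite_induct) (simp_all add: map_poly_to_ac)
  assume "root_poly m dvd (\<Prod>d\<in>?D. 1 - Polynomial.monom 1 d :: 'a poly)"
  then obtain r :: "'a poly" where "(\<Prod>d\<in>?D. 1 - Polynomial.monom 1 d) = root_poly m * r" ..
  then have "?h (\<Prod>d\<in>?D. 1 - Polynomial.monom 1 d) = ?h (root_poly m * r)"
    by simp
  then have "(\<Prod>d\<in>?D. 1 - Polynomial.monom 1 d) = (root_poly m :: 'a alg_closure poly) * ?h r"
    unfolding prod map_poly_to_ac .
  then show False
    using root_poly_not_dvd_alg_closed[OF m] by (metis dvd_triv_left)
qed


section \<open>Polynomials acting on sequences\<close>

text \<open>
  The linear functional on polynomials with value \<open>x i\<close> at \<open>t^i\<close>.  Coefficients in the group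
  algebra, values at germs and coset sums are all of this form.
\<close>

definition apply_poly :: "(nat \<Rightarrow> 'a) \<Rightarrow> 'a poly \<Rightarrow> 'a::comm_ring_1" where
  "apply_poly x p = (\<Sum>i\<le>Polynomial.degree p. poly.coeff p i * x i)"

lemma apply_poly_bound:
  assumes "Polynomial.degree p \<le> n"
  shows "apply_poly x p = (\<Sum>i\<le>n. poly.coeff p i * x i)"
  unfolding apply_poly_def using assms
  by (intro sum.mono_neutral_left) (auto simp: coeff_eq_0)

lemma apply_poly_0 [simp]: "apply_poly x 0 = 0"
  by (simp add: apply_poly_def)

lemma apply_poly_add: "apply_poly x (p + q) = apply_poly x p + apply_poly x q"
  using apply_poly_bound[of "p + q" "max (Polynomial.degree p) (Polynomial.degree q)" x]
    apply_poly_bound[of p "max (Polynomial.degree p) (Polynomial.degree q)" x]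
    apply_poly_bound[of q "max (Polynomial.degree p) (Polynomial.degree q)" x]
  by (simp add: degree_add_le_max algebra_simps sum.distrib)

lemma apply_poly_smult: "apply_poly x (Polynomial.smult c p) = c * apply_poly x p"
  using apply_poly_bound[of "Polynomial.smult c p" "Polynomial.degree p" x]
  by (simp add: apply_poly_def degree_smult_le sum_distrib_left mult.assoc)

lemma apply_poly_diff: "apply_poly x (p - q) = apply_poly x p - apply_poly x q"
  using apply_poly_add[of x p "- q"] apply_poly_smult[of x "- 1" q] by simp

lemma apply_poly_pCons: "apply_poly x (pCons a p) = a * x 0 + apply_poly (\<lambda>i. x (Suc i)) p"
proof -
  have "apply_poly x (pCons a p) = (\<Sum>i\<le>Suc (Polynomial.degree p). poly.coeff (pCons a p) i * x i)"
    by (rule apply_poly_bound) (rule degree_pCons_le)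
  also have "\<dots> = a * x 0 + (\<Sum>i\<le>Polynomial.degree p. poly.coeff p i * x (Suc i))"
    by (subst sum.atMost_Suc_shift) simp
  finally show ?thesis
    by (simp add: apply_poly_def)
qed

lemma apply_poly_monom: "apply_poly x (Polynomial.monom c n) = c * x n"
  by (induction n arbitrary: x) (simp_all add: monom_0 monom_Suc apply_poly_pCons)

lemma apply_poly_1: "apply_poly x 1 = x 0"
  using apply_poly_monom[of x 1 0] by (simp add: monom_0 one_pCons)

lemma apply_poly_sum: "apply_poly x (\<Sum>i\<in>S. f i) = (\<Sum>i\<in>S. apply_poly x (f i))"
  by (induction S rule: infinite_finite_induct) (simp_all add: apply_poly_add)

lemma apply_poly_mult:
  "apply_poly x (p * q) = apply_poly (\<lambda>i. apply_poly (\<lambda>j. x (i + j)) q) p"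
proof (induction p arbitrary: x)
  case (pCons a p)
  have "apply_poly x (pCons a p * q) = a * apply_poly x q + apply_poly (\<lambda>i. x (Suc i)) (p * q)"
    by (simp add: apply_poly_add apply_poly_smult apply_poly_pCons)
  then show ?case
    by (simp add: pCons.IH apply_poly_pCons)
qed simp

text \<open>Multiplication by \<open>1 - t^d\<close> is dual to taking differences at distance \<open>d\<close>.\<close>

lemma apply_poly_periodic:
  assumes "\<And>i. x (i + d) = x i"
  shows "apply_poly x (p * (1 - Polynomial.monom 1 d)) = 0"
proof -
  have "apply_poly (\<lambda>j. x (i + j)) (1 - Polynomial.monom 1 d) = 0" for i
    by (simp add: apply_poly_diff apply_poly_1 apply_poly_monom assms)
  then have "apply_poly x (p * (1 - Polynomial.monom 1 d)) = apply_poly (\<lambda>i. 0) p"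
    by (simp add: apply_poly_mult)
  then show ?thesis
    by (simp add: apply_poly_def)
qed

lemma apply_poly_eq_0I: "(\<And>i. x i = 0) \<Longrightarrow> apply_poly x p = 0"
  by (simp add: apply_poly_def)

context katsura
begin

section \<open>The algebra of a finite cyclic subgroup\<close>

lemma generate_to_grp:
  assumes H: "H = generate (grp v) {to_grp v n}" and fin: "finite H"
  shows "H = range (\<lambda>i. to_grp v (i * n))" and "card H > 0"
    and "i * n \<in> ker v \<longleftrightarrow> int (card H) dvd i"
proof -
  interpret group "grp v"
    by (rule group_grp)
  show eq: "H = range (\<lambda>i. to_grp v (i * n))"
    unfolding H by (subst generate_pow) (auto simp: int_pow_to_grp)
  then show "card H > 0"
    using fin by (auto simp: card_gt_0_iff)
  have "card H = ord (to_grp v n)"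
    unfolding H by (rule generate_pow_card[symmetric]) simp
  then show "i * n \<in> ker v \<longleftrightarrow> int (card H) dvd i"
    using int_pow_eq_id[of "to_grp v n" i] by (simp add: int_pow_to_grp to_grp_eq_one_iff)
qed

abbreviation group_elt :: "'n \<Rightarrow> int \<Rightarrow> 'n selt" where
  "group_elt v k \<equiv> selt_of_group v (to_grp v k)"

lemma group_elt_eq: "group_elt v k = elt v [] k v []"
  by (simp add: selt_of_group_def elt_def vert_def)

lemma group_elt_eq_iff: "group_elt v j = group_elt v k \<longleftrightarrow> j - k \<in> ker v"
  by (simp add: group_elt_eq elt_eq_iff)

lemma valid_Nil: "valid v [] v []"
  by (simp add: valid_def)

lemma group_elt_selts: "group_elt v k \<in> selts A B"
  by (simp add: group_elt_eq elt_in_selts valid_Nil)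

lemma sdom_group_elt: "sdom A (group_elt v k) = cylinder A (vert v)"
  by (simp add: group_elt_eq sdom_elt vert_def)

lemma group_elt_mult: "selt_mult A B (group_elt v j) (group_elt v k) = Some (group_elt v (j + k))"
proof -
  have "path_act A B (to_grp v j) (v, []) = (v, [])" "sect A B (to_grp v j) (v, []) = to_grp v j"
    using path_act_to_grp[of v "[]" j] sect_to_grp[of v "[]" j] by simp_all
  then show ?thesis
    by (simp add: selt_of_group_def vert_def path_prefix_def path_rest_def path_append_def
        mult_to_grp Let_def)
qed

lemma one_group_algebra: "selt_of_path A B (vert v) = group_elt v 0"
  by (simp add: selt_of_path_def selt_of_group_def vert_def one_grp)

lemma germ_group_elt_eq_iff:
  assumes "ipath v w"
  shows "germ A B (group_elt v j) w = germ A B (group_elt v k) w \<longleftrightarrow> j - k \<in> Ninf v w"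
proof -
  have "ipath (path_src (v, [])) w"
    using assms by simp
  from germ_eq_same_dom[OF valid_Nil valid_Nil this, where a = j and a' = k] show ?thesis
    by (simp add: group_elt_eq)
qed

lemma germ_in_group_elt_image:
  assumes "ipath v w"
  shows "germ A B (group_elt v j) w \<in> germ A B (group_elt v k) ` sdom A (group_elt v k) \<longleftrightarrow>
    k - j \<in> Ninf v w"
proof -
  have "germ A B (group_elt v j) w \<in> germ A B (group_elt v k) ` sdom A (group_elt v k) \<longleftrightarrow>
      germ A B (group_elt v k) w = germ A B (group_elt v j) w"
  proof
    assume "germ A B (group_elt v j) w \<in> germ A B (group_elt v k) ` sdom A (group_elt v k)"
    then obtain z where z: "z \<in> sdom A (group_elt v k)"
      "germ A B (group_elt v j) w = germ A B (group_elt v k) z"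
      by blast
    then have "w = z"
      using germ_src_germ group_elt_selts assms sdom_group_elt by metis
    then show "germ A B (group_elt v k) w = germ A B (group_elt v j) w"
      using z by simp
  next
    assume "germ A B (group_elt v k) w = germ A B (group_elt v j) w"
    then show "germ A B (group_elt v j) w \<in> germ A B (group_elt v k) ` sdom A (group_elt v k)"
      using assms sdom_group_elt by (metis imageI)
  qed
  then show ?thesis
    using germ_group_elt_eq_iff[OF assms] by simp
qed

text \<open>Different elements may have the same set of germs, so coefficients are collected for each set.\<close>

lemma quotient_hom_carrier:
  fixes a :: "'n selt \<Rightarrow> 'k::field"
  assumes "a \<in> KS A B"
  shows "quotient_hom A B a \<in> carrier (steinberg A B)"
proof -
  define T where "T = {s. a s \<noteq> 0}"
  define U where "U s = germ A B s ` sdom A s" for s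
  have T: "finite T" "T \<subseteq> selts A B"
    using assms by (auto simp: KS_def T_def)
  have eq: "quotient_hom A B a = (\<lambda>\<gamma>. \<Sum>V\<in>U ` T. (\<Sum>s | s \<in> T \<and> U s = V. a s) * indicator V \<gamma>)"
  proof
    fix \<gamma>
    have "quotient_hom A B a \<gamma> = (\<Sum>s\<in>T. a s * indicator (U s) \<gamma>)"
      by (simp add: quotient_hom_def T_def U_def)
    also have "\<dots> = (\<Sum>V\<in>U ` T. \<Sum>s | s \<in> T \<and> U s = V. a s * indicator (U s) \<gamma>)"
      using T(1) by (rule sum.image_gen)
    also have "\<dots> = (\<Sum>V\<in>U ` T. (\<Sum>s | s \<in> T \<and> U s = V. a s) * indicator V \<gamma>)"
      unfolding sum_distrib_right by (intro sum.cong refl) auto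
    finally show "quotient_hom A B a \<gamma> = (\<Sum>V\<in>U ` T. (\<Sum>s | s \<in> T \<and> U s = V. a s) * indicator V \<gamma>)" .
  qed
  have "finite (U ` T)" "\<forall>V\<in>U ` T. compact_open_bisection A B V"
    using T compact_open_bisection_germ_image by (auto simp: U_def)
  then have "\<exists>F c. quotient_hom A B a = (\<lambda>\<gamma>. \<Sum>V\<in>F. c V * indicator V \<gamma>) \<and>
      finite F \<and> (\<forall>V\<in>F. compact_open_bisection A B V)"
    using eq by (intro exI[of _ "U ` T"] exI[of _ "\<lambda>V. \<Sum>s | s \<in> T \<and> U s = V. a s"] conjI)
  then show ?thesis
    by (simp add: steinberg_def)
qed

text \<open>Substitution of the generator \<open>g\<^sub>v\<^sup>n\<close> for \<open>t\<close>.\<close>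

definition eval_poly :: "'n \<Rightarrow> int \<Rightarrow> 'k::field poly \<Rightarrow> 'n selt \<Rightarrow> 'k" where
  "eval_poly v n p s = apply_poly (\<lambda>i. basis_elt (group_elt v (int i * n)) s) p"

lemma eval_poly_pairing:
  assumes "finite S" "\<And>i. group_elt v (int i * n) \<in> S"
  shows "(\<Sum>s\<in>S. eval_poly v n p s * y s) = apply_poly (\<lambda>i. y (group_elt v (int i * n))) p"
proof -
  have "(\<Sum>s\<in>S. eval_poly v n p s * y s) =
      (\<Sum>s\<in>S. \<Sum>i\<le>Polynomial.degree p. poly.coeff p i * (basis_elt (group_elt v (int i * n)) s * y s))"
    by (simp add: eval_poly_def apply_poly_def sum_distrib_right mult.assoc)
  also have "\<dots> = (\<Sum>i\<le>Polynomial.degree p. \<Sum>s\<in>S. poly.coeff p i * (basis_elt (group_elt v (int i * n)) s * y s))"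
    by (rule sum.swap)
  also have "\<dots> = (\<Sum>i\<le>Polynomial.degree p. poly.coeff p i * (\<Sum>s\<in>S. basis_elt (group_elt v (int i * n)) s * y s))"
    by (simp add: sum_distrib_left)
  also have "\<dots> = (\<Sum>i\<le>Polynomial.degree p. poly.coeff p i * y (group_elt v (int i * n)))"
  proof (intro sum.cong refl arg_cong2[where f = "(*)"])
    fix i
    have "basis_elt (group_elt v (int i * n)) s * y s =
        (if s = group_elt v (int i * n) then y s else 0)" for s
      by (simp add: basis_elt_def)
    then show "(\<Sum>s\<in>S. basis_elt (group_elt v (int i * n)) s * y s) = y (group_elt v (int i * n))"
      using assms by (simp add: sum.delta)
  qed
  finally show ?thesis
    by (simp add: apply_poly_def)
qed

lemma eval_poly_support:
  assumes "eval_poly v n p s \<noteq> 0"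
  shows "\<exists>i. s = group_elt v (int i * n)"
proof (rule ccontr)
  assume "\<not> ?thesis"
  then have "eval_poly v n p s = 0"
    unfolding eval_poly_def by (intro apply_poly_eq_0I) (auto simp: basis_elt_def)
  with assms show False ..
qed

lemma eval_poly_supported_sum:
  assumes "finite S" "\<And>i. group_elt v (int i * n) \<in> S"
  shows "(\<Sum>s | eval_poly v n p s \<noteq> 0. eval_poly v n p s * y s) =
    apply_poly (\<lambda>i. y (group_elt v (int i * n))) p"
proof -
  have "{s. eval_poly v n p s \<noteq> 0} \<subseteq> S"
    using eval_poly_support assms(2) by blast
  then have "(\<Sum>s | eval_poly v n p s \<noteq> 0. eval_poly v n p s * y s) = (\<Sum>s\<in>S. eval_poly v n p s * y s)"
    using assms(1) by (intro sum.mono_neutral_left) auto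
  then show ?thesis
    using eval_poly_pairing[OF assms] by simp
qed

lemma quotient_hom_eval_poly:
  assumes "finite S" "\<And>i. group_elt v (int i * n) \<in> S"
  shows "quotient_hom A B (eval_poly v n p) \<gamma> =
    apply_poly (\<lambda>i. indicator (germ A B (group_elt v (int i * n)) ` sdom A (group_elt v (int i * n))) \<gamma>) p"
  unfolding quotient_hom_def by (rule eval_poly_supported_sum[OF assms])

lemma quotient_hom_eval_poly_germ:
  assumes "finite S" "\<And>i. group_elt v (int i * n) \<in> S" "ipath v w"
  shows "quotient_hom A B (eval_poly v n p) (germ A B (group_elt v j) w) =
    apply_poly (\<lambda>i. of_bool (int i * n - j \<in> Ninf v w)) p"
  unfolding quotient_hom_eval_poly[OF assms(1,2)]
  by (simp add: indicator_def germ_in_group_elt_image[OF assms(3)] of_bool_def)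

lemma KS_mult_eval_poly:
  assumes S: "finite S" "\<And>i. group_elt v (int i * n) \<in> S"
  shows "KS_mult A B (eval_poly v n p) (eval_poly v n q) = eval_poly v n (p * q)"
proof
  fix u
  let ?a = "eval_poly v n p" and ?b = "eval_poly v n q"
  have sup: "{s. ?a s \<noteq> 0} \<subseteq> S" "{s. ?b s \<noteq> 0} \<subseteq> S"
    using eval_poly_support S(2) by blast+
  have "KS_mult A B ?a ?b u =
      (\<Sum>x \<in> {(s, t). ?a s \<noteq> 0 \<and> ?b t \<noteq> 0 \<and> selt_mult A B s t = Some u}. ?a (fst x) * ?b (snd x))"
    by (simp add: KS_mult_def case_prod_beta)
  also have "\<dots> = (\<Sum>x \<in> S \<times> S. ?a (fst x) * (?b (snd x) * of_bool (selt_mult A B (fst x) (snd x) = Some u)))"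
    using S(1) sup by (intro sum.mono_neutral_cong_left) auto
  also have "\<dots> = (\<Sum>s\<in>S. ?a s * (\<Sum>t\<in>S. ?b t * of_bool (selt_mult A B s t = Some u)))"
    by (simp add: sum.cartesian_product case_prod_beta sum_distrib_left)
  also have "\<dots> = apply_poly (\<lambda>i. apply_poly (\<lambda>j.
      of_bool (selt_mult A B (group_elt v (int i * n)) (group_elt v (int j * n)) = Some u)) q) p"
    by (simp only: eval_poly_pairing[OF S])
  also have "\<dots> = apply_poly (\<lambda>i. apply_poly (\<lambda>j. basis_elt (group_elt v (int (i + j) * n)) u) q) p"
    by (simp add: group_elt_mult basis_elt_def distrib_right of_bool_def eq_commute[of u])
  also have "\<dots> = eval_poly v n (p * q) u"
    by (simp add: eval_poly_def apply_poly_mult)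
  finally show "KS_mult A B ?a ?b u = eval_poly v n (p * q) u" .
qed

end

text \<open>
  The algebra \<open>KH\<close> of a cyclic group of order \<open>m\<close> with generator \<open>g\<^sub>v\<^sup>n\<close> as the image of the
  polynomial ring; its ring laws are inherited from there, and polynomials of degree less than \<open>m\<close>
  have distinct images.
\<close>

locale cyclic_subgroup = katsura A B for A B :: "int^'n^'n" +
  fixes v :: 'n and H :: "int set set" and n :: int
  assumes H_eq: "H = generate (vgroup A B v) {to_vgroup A B v n}" and finite_H: "finite H"
begin

abbreviation "m \<equiv> card H"

lemma H_range: "H = range (\<lambda>i. to_grp v (i * n))"
  by (rule generate_to_grp(1)[OF H_eq finite_H])

lemma m_pos: "m > 0"
  by (rule generate_to_grp(2)[OF H_eq finite_H])

lemma ker_iff_dvd: "i * n \<in> ker v \<longleftrightarrow> int m dvd i"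
  by (rule generate_to_grp(3)[OF H_eq finite_H])

abbreviation "S \<equiv> selt_of_group v ` H"

lemma S: "finite S" "group_elt v (int i * n) \<in> S"
  using finite_H by (auto simp: H_range)

lemma S_selts: "S \<subseteq> selts A B"
  using group_elt_selts by (auto simp: H_range)

lemma group_elt_mod: "group_elt v (i * n) = group_elt v (int (nat (i mod int m)) * n)"
proof -
  have "(i - i mod int m) * n \<in> ker v"
    by (simp add: ker_iff_dvd minus_mod_eq_mult_div)
  then show ?thesis
    using m_pos by (simp add: group_elt_eq_iff left_diff_distrib)
qed

lemma group_elt_eq_iff_mod:
  "group_elt v (int i * n) = group_elt v (int j * n) \<longleftrightarrow> int m dvd int i - int j"
  using ker_iff_dvd[of "int i - int j"] by (simp add: group_elt_eq_iff left_diff_distrib)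

lemma group_elt_inj:
  assumes "i < m" "j < m"
  shows "group_elt v (int i * n) = group_elt v (int j * n) \<longleftrightarrow> i = j"
  using assms unfolding group_elt_eq_iff_mod
  by (metis mod_eq_dvd_iff mod_less of_nat_eq_iff zmod_int)

lemma S_cases:
  assumes "s \<in> S"
  obtains i where "i < m" "s = group_elt v (int i * n)"
proof -
  obtain k where "s = group_elt v (k * n)"
    using assms by (auto simp: H_range)
  then have "s = group_elt v (int (nat (k mod int m)) * n)"
    using group_elt_mod by metis
  moreover have "nat (k mod int m) < m"
    using m_pos by (simp add: nat_less_iff)
  ultimately show ?thesis
    using that by blast
qed

abbreviation "KH \<equiv> group_algebra A B v H"

lemma eval_poly_carrier: "eval_poly v n p \<in> carrier KH"
proof -
  have "{s. eval_poly v n p s \<noteq> 0} \<subseteq> S"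
    using eval_poly_support S(2) by blast
  then show ?thesis
    using S_selts S(1) finite_subset by (auto simp: group_algebra_def KS_def)
qed

lemma eval_poly_surj:
  fixes a :: "'n selt \<Rightarrow> 'k::field"
  assumes "a \<in> carrier KH"
  obtains p where "a = eval_poly v n p"
proof
  show "a = eval_poly v n (\<Sum>i<m. Polynomial.monom (a (group_elt v (int i * n))) i)"
  proof
    fix s
    have eq: "eval_poly v n (\<Sum>i<m. Polynomial.monom (a (group_elt v (int i * n))) i) s =
        (\<Sum>i<m. a (group_elt v (int i * n)) * basis_elt (group_elt v (int i * n)) s)"
      by (simp add: eval_poly_def apply_poly_sum apply_poly_monom)
    show "a s = eval_poly v n (\<Sum>i<m. Polynomial.monom (a (group_elt v (int i * n))) i) s"
    proof (cases "s \<in> S")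
      case True
      then obtain j where j: "j < m" "s = group_elt v (int j * n)"
        by (rule S_cases)
      have b: "basis_elt (group_elt v (int i * n)) s = (if i = j then 1 else 0 :: 'k)" if "i < m" for i
        unfolding basis_elt_def j(2) using group_elt_inj[OF that j(1)] by auto
      have "(\<Sum>i<m. a (group_elt v (int i * n)) * basis_elt (group_elt v (int i * n)) s) =
          (\<Sum>i<m. if i = j then a s else 0)"
        by (intro sum.cong refl) (auto simp: b j(2)[symmetric])
      then show ?thesis
        unfolding eq using j(1) by simp
    next
      case False
      then have "a s = 0"
        using assms by (auto simp: group_algebra_def)
      moreover have "basis_elt (group_elt v (int i * n)) s = (0 :: 'k)" for i
        using False S(2) by (auto simp: basis_elt_def)
      ultimately show ?thesis
        unfolding eq by simp
    qed
  qed
qed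

lemma eval_poly_mult: "eval_poly v n p \<otimes>\<^bsub>KH\<^esub> eval_poly v n q = eval_poly v n (p * q)"
  using KS_mult_eval_poly[OF S] by (simp add: group_algebra_def)

lemma eval_poly_one: "eval_poly v n 1 = \<one>\<^bsub>KH\<^esub>"
  by (auto simp: group_algebra_def eval_poly_def apply_poly_1 one_group_algebra)

lemma comm_monoid_KH: "comm_monoid (KH :: ('n selt \<Rightarrow> 'k::field) ring)"
proof (rule comm_monoidI)
  fix x y z :: "'n selt \<Rightarrow> 'k"
  assume x: "x \<in> carrier KH" and y: "y \<in> carrier KH"
  obtain p where p: "x = eval_poly v n p"
    using x by (rule eval_poly_surj)
  obtain q where q: "y = eval_poly v n q"
    using y by (rule eval_poly_surj)
  show "x \<otimes>\<^bsub>KH\<^esub> y \<in> carrier KH"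
    unfolding p q eval_poly_mult by (rule eval_poly_carrier)
  show "x \<otimes>\<^bsub>KH\<^esub> y = y \<otimes>\<^bsub>KH\<^esub> x"
    unfolding p q eval_poly_mult by (simp add: mult.commute)
  show "\<one>\<^bsub>KH\<^esub> \<otimes>\<^bsub>KH\<^esub> x = x"
    unfolding p eval_poly_one[symmetric] eval_poly_mult by simp
  assume z: "z \<in> carrier KH"
  obtain r where r: "z = eval_poly v n r"
    using z by (rule eval_poly_surj)
  show "x \<otimes>\<^bsub>KH\<^esub> y \<otimes>\<^bsub>KH\<^esub> z = x \<otimes>\<^bsub>KH\<^esub> (y \<otimes>\<^bsub>KH\<^esub> z)"
    unfolding p q r eval_poly_mult by (simp add: mult.assoc)
next
  show "\<one>\<^bsub>KH\<^esub> \<in> carrier (KH :: ('n selt \<Rightarrow> 'k) ring)"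
    unfolding eval_poly_one[symmetric] by (rule eval_poly_carrier)
qed

lemma finprod_eval_poly:
  "finite D \<Longrightarrow> finprod KH (\<lambda>d. eval_poly v n (f d)) D = eval_poly v n (\<Prod>d\<in>D. f d)"
proof (induction D rule: finite_induct)
  case empty
  show ?case
    by (simp add: comm_monoid.finprod_empty[OF comm_monoid_KH] eval_poly_one)
next
  case (insert d D)
  then show ?case
    by (subst comm_monoid.finprod_insert[OF comm_monoid_KH])
       (auto simp: eval_poly_carrier eval_poly_mult)
qed

definition divisor_poly :: "'k::field poly" where
  "divisor_poly = (\<Prod>d | 1 \<le> d \<and> d < m \<and> d dvd m. 1 - Polynomial.monom 1 d)"

lemma divisor_product_eq:
  "(divisor_product A B v H n :: 'n selt \<Rightarrow> 'k::field) = eval_poly v n divisor_poly"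
proof -
  have eq: "(\<lambda>d s. basis_elt (selt_of_path A B (vert v)) s -
        basis_elt (selt_of_group v (vgen A B v [^]\<^bsub>grp v\<^esub> (int d * n))) s :: 'k) =
      (\<lambda>d. eval_poly v n (1 - Polynomial.monom 1 d))"
    by (intro ext) (simp add: eval_poly_def apply_poly_diff apply_poly_1 apply_poly_monom
        one_group_algebra vgen_def int_pow_to_grp)
  show ?thesis
    unfolding divisor_product_def divisor_poly_def eq by (rule finprod_eval_poly) simp
qed

text \<open>
  Reduction modulo \<open>t^m - 1\<close> does not change the value at an element of order \<open>m\<close>, and the coefficients of a
  remainder are its values at the \<open>m\<close> group elements.
\<close>

lemma eval_poly_zero_imp_dvd:
  fixes p :: "'k::field poly"
  assumes "\<And>s. eval_poly v n p s = 0"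
  shows "root_poly m dvd p"
proof -
  define r where "r = p mod root_poly m"
  have deg: "Polynomial.degree (root_poly m :: 'k poly) = m"
    using m_pos by (rule degree_root_poly)
  have deg_r: "Polynomial.degree r < m" if "r \<noteq> 0"
    using that degree_mod_less[OF root_poly_nonzero[OF m_pos], of p] unfolding r_def deg by blast
  have neg: "1 - Polynomial.monom 1 m = - (root_poly m :: 'k poly)"
    by simp
  have p: "p = r - (p div root_poly m) * (1 - Polynomial.monom 1 m)"
    unfolding neg r_def mult_minus_right diff_minus_eq_add by (rule mod_div_mult_eq[symmetric])
  have "poly.coeff r j = 0" for j
  proof (cases "j < m")
    case True
    let ?s = "group_elt v (int j * n)"
    have "basis_elt (group_elt v (int (i + m) * n)) ?s = (basis_elt (group_elt v (int i * n)) ?s :: 'k)" for i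
      using group_elt_eq_iff_mod[of "i + m" i] by simp
    then have "apply_poly (\<lambda>i. basis_elt (group_elt v (int i * n)) ?s)
        ((p div root_poly m) * (1 - Polynomial.monom 1 m)) = (0 :: 'k)"
      by (rule apply_poly_periodic)
    then have "eval_poly v n r ?s = eval_poly v n p ?s"
      using arg_cong[OF p, of "apply_poly (\<lambda>i. basis_elt (group_elt v (int i * n)) ?s)"]
      unfolding eval_poly_def apply_poly_diff by simp
    then have "eval_poly v n r ?s = 0"
      using assms by simp
    have "Polynomial.degree r \<le> m - 1"
      using deg_r m_pos by (cases "r = 0") auto
    then have "eval_poly v n r ?s = (\<Sum>i\<le>m - 1. poly.coeff r i * basis_elt (group_elt v (int i * n)) ?s)"
      unfolding eval_poly_def by (rule apply_poly_bound)
    also have "\<dots> = (\<Sum>i\<le>m - 1. if i = j then poly.coeff r i else 0)"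
    proof (intro sum.cong refl)
      fix i assume "i \<in> {..m - 1}"
      then have "i < m"
        using m_pos by auto
      then have "basis_elt (group_elt v (int i * n)) ?s = (if i = j then 1 else 0 :: 'k)"
        unfolding basis_elt_def using group_elt_inj[OF _ True, of i] by auto
      then show "poly.coeff r i * basis_elt (group_elt v (int i * n)) ?s =
          (if i = j then poly.coeff r i else 0)"
        by simp
    qed
    also have "\<dots> = poly.coeff r j"
      using True by simp
    finally show ?thesis
      using \<open>eval_poly v n r ?s = 0\<close> by simp
  next
    case False
    show ?thesis
    proof (cases "r = 0")
      case nz: False
      then have "Polynomial.degree r < m"
        by (rule deg_r)
      with False show ?thesis
        by (simp add: coeff_eq_0)
    qed simp
  qed
  then have "r = 0"
    by (simp add: poly_eq_iff)
  then show ?thesis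
    by (simp add: r_def dvd_eq_mod_eq_0)
qed

text \<open>
  If \<open>H\<close> meets the germ kernel of \<open>w\<close> trivially, then the germs of \<open>H\<close> at \<open>w\<close> are distinct, and the
  function takes there the coefficients of the product as values.
\<close>

lemma divisor_product_not_tight:
  assumes w: "ipath v w" and inj: "\<And>k. to_grp v k \<in> H \<Longrightarrow> k \<in> Ninf v w \<Longrightarrow> k \<in> ker v"
  shows "quotient_hom A B (divisor_product A B v H n :: 'n selt \<Rightarrow> 'k::field) \<noteq> (\<lambda>_. 0)"
proof
  assume "quotient_hom A B (divisor_product A B v H n :: 'n selt \<Rightarrow> 'k) = (\<lambda>_. 0)"
  then have zero: "quotient_hom A B (eval_poly v n (divisor_poly :: 'k poly)) \<gamma> = 0" for \<gamma>
    by (simp add: divisor_product_eq)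
  have "eval_poly v n (divisor_poly :: 'k poly) s = 0" for s
  proof (cases "s \<in> S")
    case True
    then obtain j where j: "s = group_elt v (int j * n)"
      by (rule S_cases)
    have "int i * n - int j * n \<in> Ninf v w \<longleftrightarrow> group_elt v (int i * n) = s" for i
    proof
      assume "int i * n - int j * n \<in> Ninf v w"
      moreover have "to_grp v (int i * n - int j * n) \<in> H"
        unfolding H_range by (metis left_diff_distrib rangeI)
      ultimately show "group_elt v (int i * n) = s"
        unfolding j group_elt_eq_iff using inj by blast
    next
      assume "group_elt v (int i * n) = s"
      then show "int i * n - int j * n \<in> Ninf v w"
        unfolding j group_elt_eq_iff using ker_subset_Ninf[OF w] by blast
    qed
    then have "eval_poly v n divisor_poly s =
        quotient_hom A B (eval_poly v n (divisor_poly :: 'k poly)) (germ A B (group_elt v (int j * n)) w)"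
      unfolding quotient_hom_eval_poly_germ[OF S w] eval_poly_def
      by (simp add: basis_elt_def of_bool_def eq_commute[of s])
    then show ?thesis
      by (simp add: zero)
  next
    case False
    then show ?thesis
      using eval_poly_support S(2) by blast
  qed
  then have "root_poly m dvd (divisor_poly :: 'k poly)"
    by (rule eval_poly_zero_imp_dvd)
  then show False
    unfolding divisor_poly_def using root_poly_not_dvd[OF m_pos] by blast
qed

text \<open>
  Among the extensions of a path choose one that is stabilized by as few elements of \<open>H\<close> as possible.
  These elements stabilize all further extensions, so by faithfulness their sections are trivial and
  they lie in the germ kernel.  As no orbit is free, some of them is nontrivial, and it generates the
  same subgroup of \<open>H\<close> as \<open>g\<^sub>v\<^sup>d\<^sup>n\<close> for a proper divisor \<open>d\<close> of \<open>m\<close>.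
\<close>

lemma no_free_orbit_kernel:
  assumes nofree: "\<not> has_free_orbit A B v H" and x: "fpath v x"
  obtains y d where "fpath v (x @ y)" "1 \<le> d" "d < m" "d dvd m" "int d * n \<in> N v (x @ y)"
proof -
  have sub: "subgroup H (grp v)"
    unfolding H_eq by (rule group.generate_is_subgroup[OF group_grp]) simp
  define T where "T xs = {h \<in> H. \<exists>k. to_grp v k = h \<and> act k xs = xs}" for xs
  have finT: "finite (T xs)" for xs
    using finite_H by (simp add: T_def)
  obtain y where y: "fpath v (x @ y)"
    and least: "\<And>z. fpath v (x @ z) \<Longrightarrow> card (T (x @ y)) \<le> card (T (x @ z))"
    using ex_has_least_nat[of "\<lambda>y. fpath v (x @ y)" "[]" "\<lambda>y. card (T (x @ y))"] x by auto
  define x' where "x' = x @ y"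
  obtain w where w: "w \<in> cylinder A (v, x')"
    using cylinder_nonempty[OF y] x'_def by blast
  have wp: "ipath v w" "stake (length x') w = x'"
    using w by (simp_all add: cylinder_iff)
  obtain k where k: "to_grp v k \<in> H" "stream_act A B k w = w" "k \<notin> ker v"
    using nofree wp(1) unfolding has_free_orbit_iff[OF sub] by blast
  have fix_x': "act k x' = x'"
    using k(2) wp(2) unfolding stream_act_fix_iff by metis
  have "sec k x' \<in> ker (path_src (v, x'))"
    unfolding ker_iff
  proof (intro allI impI)
    fix zs assume zs: "fpath (path_src (v, x')) zs"
    then have p: "fpath v (x' @ zs)"
      using y by (simp add: is_path_append x'_def)
    have "T (x' @ zs) \<subseteq> T x'"
      by (auto simp: T_def list_act_append)
    moreover have "card (T x') \<le> card (T (x' @ zs))"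
      using least[of "y @ zs"] p by (simp add: x'_def)
    ultimately have "T (x' @ zs) = T x'"
      using finT card_seteq by blast
    moreover have "to_grp v k \<in> T x'"
      using k(1) fix_x' by (auto simp: T_def)
    ultimately have "to_grp v k \<in> T (x' @ zs)"
      by simp
    then obtain k' where k': "to_grp v k' = to_grp v k" "act k' (x' @ zs) = x' @ zs"
      by (auto simp: T_def)
    then have "act k (x' @ zs) = x' @ zs"
      using act_cong_ker(1)[OF _ p, of k' k] by (simp add: to_grp_eq_iff)
    then show "act (sec k x') zs = zs"
      by (simp add: list_act_append)
  qed
  then have kN: "k \<in> N v x'"
    using fix_x' by (simp add: germ_kernel_def)
  have x'p: "fpath v x'"
    using y by (simp add: x'_def)
  have kerN: "ker v \<subseteq> N v x'"
    using x'p by (rule ker_subset_N)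
  obtain i where i: "k - i * n \<in> ker v"
    using k(1) by (auto simp: H_range to_grp_eq_iff)
  then have iN: "i * n \<in> N v x'"
    using N_diff[OF x'p kN, of "k - i * n"] kerN by auto
  define d where "d = nat (gcd i (int m))"
  have d: "int d = gcd i (int m)"
    by (simp add: d_def)
  have "\<not> int m dvd i"
    using i k(3) ker_add[of "k - i * n" v "i * n"] ker_iff_dvd by auto
  then have "int d \<noteq> int m"
    unfolding d by (metis gcd_dvd1)
  moreover have "int d dvd int m"
    unfolding d by simp
  then have "d dvd m"
    by simp
  moreover have "d \<le> m" "1 \<le> d"
    using \<open>d dvd m\<close> m_pos by (auto simp: dvd_imp_le Suc_le_eq intro: dvd_pos_nat)
  moreover have "int d * n \<in> N v x'"
  proof -
    obtain a b where ab: "a * i + b * int m = int d"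
      unfolding d using bezout_int by blast
    have "int m * n \<in> N v x'"
      using kerN ker_iff_dvd[of "int m"] by auto
    then have "- b * (int m * n) \<in> N v x'" "a * (i * n) \<in> N v x'"
      using N_mult[OF x'p] iN by blast+
    then have "a * (i * n) - (- b * (int m * n)) \<in> N v x'"
      by (intro N_diff[OF x'p])
    moreover have "a * (i * n) - (- b * (int m * n)) = int d * n"
      by (simp add: ab[symmetric] algebra_simps)
    ultimately show ?thesis
      by simp
  qed
  ultimately show ?thesis
    using that[OF y] unfolding x'_def by force
qed

text \<open>
  Only germs of elements of \<open>H\<close> matter.  Every cylinder contains a smaller one whose germ kernel contains
  \<open>g\<^sub>v\<^sup>d\<^sup>n\<close> for a proper divisor \<open>d\<close> of \<open>m\<close>; there the coset sums are periodic with period \<open>d\<close>, and the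
  factor \<open>1 - t^d\<close> makes them vanish.
\<close>

lemma divisor_product_singular:
  assumes nofree: "\<not> has_free_orbit A B v H"
  shows "(divisor_product A B v H n :: 'n selt \<Rightarrow> 'k::field) \<in> singular A B"
proof -
  let ?a = "eval_poly v n (divisor_poly :: 'k poly)"
  let ?f = "quotient_hom A B ?a"
  have a: "?a \<in> KS A B"
    using eval_poly_carrier[of "divisor_poly :: 'k poly"] by (simp add: group_algebra_def)
  have sub: "{\<gamma> \<in> germs A B. ?f \<gamma> \<noteq> 0} \<subseteq> germs A B"
    by blast
  have "germ_topology A B interior_of {\<gamma> \<in> germs A B. ?f \<gamma> \<noteq> 0} = {}"
    unfolding interior_of_empty_iff[OF sub]
  proof (intro ballI allI)
    fix s w k assume s: "s \<in> selts A B" "w \<in> sdom A s"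
    show "\<exists>z\<in>cyl k w \<inter> sdom A s. germ A B s z \<notin> {\<gamma> \<in> germs A B. ?f \<gamma> \<noteq> 0}"
    proof (cases "?f (germ A B s w) = 0")
      case True
      then show ?thesis
        using s cyl_self sdom_inf_paths by blast
    next
      case False
      have "\<exists>i. germ A B s w \<in> germ A B (group_elt v (int i * n)) ` sdom A (group_elt v (int i * n))"
      proof (rule ccontr)
        assume "\<not> ?thesis"
        then have "?f (germ A B s w) = 0"
          unfolding quotient_hom_eval_poly[OF S] by (intro apply_poly_eq_0I) (simp add: indicator_def)
        with False show False ..
      qed
      then obtain i w' where i: "germ A B s w = germ A B (group_elt v (int i * n)) w'"
          "w' \<in> sdom A (group_elt v (int i * n))"
        by blast
      then have "w' = w"
        using germ_src_germ[OF s] germ_src_germ[OF group_elt_selts] by metis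
      then have wd: "w \<in> sdom A (group_elt v (int i * n))"
        and eq: "germ A B s w = germ A B (group_elt v (int i * n)) w"
        using i by simp_all
      then have w: "ipath v w"
        by (simp add: sdom_group_elt)
      obtain l where l: "cyl l w \<subseteq> sdom A s"
        "\<And>z. z \<in> cyl l w \<Longrightarrow> germ A B s z = germ A B (group_elt v (int i * n)) z"
        using germ_eq_nearby[OF s group_elt_selts wd eq] by metis
      define x where "x = stake (max k l) w"
      have "fpath v x"
        unfolding x_def using w by (rule ipath_stake)
      then obtain y d where y: "fpath v (x @ y)" and d: "1 \<le> d" "d < m" "d dvd m"
        "int d * n \<in> N v (x @ y)"
        using no_free_orbit_kernel[OF nofree] by blast
      obtain z where z: "z \<in> cylinder A (v, x @ y)"
        using cylinder_nonempty[OF y] by blast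
      then have zp: "ipath v z" "stake (length (x @ y)) z = x @ y"
        unfolding cylinder_iff by blast+
      have "z \<in> cylinder A (v, x)"
        using z cylinder_antimono by blast
      then have "z \<in> cyl (max k l) w"
        by (simp add: cyl_eq[OF w] x_def)
      then have zc: "z \<in> cyl k w" "z \<in> cyl l w"
        using cyl_antimono[of k "max k l" w] cyl_antimono[of l "max k l" w] by auto
      have dN: "int d * n \<in> Ninf v z"
        using d(4) N_subset_Ninf[of v "length (x @ y)" z] unfolding zp(2) by blast
      have "(1 - Polynomial.monom 1 d :: 'k poly) dvd divisor_poly"
        unfolding divisor_poly_def using d by (intro dvd_prodI) auto
      then obtain q :: "'k poly" where q: "divisor_poly = q * (1 - Polynomial.monom 1 d)"
        by (metis dvdE mult.commute)
      have per: "int (j + d) * n - int i * n \<in> Ninf v z \<longleftrightarrow> int j * n - int i * n \<in> Ninf v z" for j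
      proof -
        have e: "int (j + d) * n - int i * n = (int j * n - int i * n) + int d * n"
          by (simp add: algebra_simps)
        show ?thesis
          unfolding e using Ninf_add[OF zp(1) _ dN, of "int j * n - int i * n"]
            Ninf_diff[OF zp(1) _ dN, of "(int j * n - int i * n) + int d * n"] by auto
      qed
      have "?f (germ A B s z) = ?f (germ A B (group_elt v (int i * n)) z)"
        using l(2)[OF zc(2)] by simp
      also have "\<dots> = apply_poly (\<lambda>j. of_bool (int j * n - int i * n \<in> Ninf v z)) divisor_poly"
        by (rule quotient_hom_eval_poly_germ[OF S zp(1)])
      also have "\<dots> = 0"
        unfolding q by (rule apply_poly_periodic) (simp only: per)
      finally show ?thesis
        using zc l(1) by blast
    qed
  qed
  then show ?thesis
    unfolding divisor_product_eq singular_def singular_ideal_def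
    using a quotient_hom_carrier[OF a] by simp
qed

end

context katsura
begin

section \<open>Stable subgroups act freely on germs along the cycle\<close>

text \<open>
  The section map of a stable subgroup along the cycle is injective, hence so are its iterates, and
  along \<open>c c c \<dots>\<close> nothing but the identity becomes trivial.
\<close>

lemma stable_subgroup_periodic_path:
  assumes c: "fpath v es" "path_src (v, es) = v" "es \<noteq> []"
    and H: "stable_subgroup A B (v, es) H"
  obtains w where "ipath v w" "\<And>k. to_grp v k \<in> H \<Longrightarrow> k \<in> Ninf v w \<Longrightarrow> k \<in> ker v"
proof -
  define w where "w = cycle es"
  define p where "p r = concat (replicate r es)" for r
  have p_Suc: "p (Suc r) = es @ p r" for r
    by (simp add: p_def)
  have p: "fpath v (p r)" "path_src (v, p r) = v" "r \<le> length (p r)" "stake (length (p r)) w = p r" for r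
  proof (induction r)
    case (Suc r)
    {
      case 1
      show ?case
        using Suc c by (simp add: p_Suc is_path_append)
    next
      case 2
      show ?case
        using Suc c by (simp add: p_Suc)
    next
      case 3
      show ?case
        using Suc c by (cases es) (simp_all add: p_Suc)
    next
      case 4
      have "w = es @- w"
        unfolding w_def using c(3) by (rule cycle_decomp)
      then have "stake (length (p (Suc r))) w = stake (length (p (Suc r))) (es @- w)"
        by simp
      also have "\<dots> = es @ stake (length (p r)) w"
        by (simp add: p_Suc stake_shift)
      finally show ?case
        using Suc by (simp add: p_Suc)
    }
  qed (simp_all add: p_def)
  have w: "ipath v w"
    unfolding ipath_iff
  proof
    fix r
    obtain ys where "stake (length (p r)) w = stake r w @ ys"
      using stake_prefix[OF p(3)] by blast
    then show "fpath v (stake r w)"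
      using p(1)[of r] p(4)[of r] by (simp add: is_path_append)
  qed
  have stable: "subgroup H (grp v)" "\<And>k. to_grp v k \<in> H \<Longrightarrow> act k es = es"
    "bij_betw (\<lambda>h. sect A B h (v, es)) H H"
    using H unfolding stable_subgroup_iff[OF c(1,2)] by blast+
  have sect: "sect A B (to_grp v k) (v, es) = to_grp v (sec k es)" for k
    using sect_to_grp[OF c(1)] c(2) by simp
  have ker: "k \<in> ker v" if "to_grp v k \<in> H" "k \<in> N v (p r)" for k r
    using that
  proof (induction r arbitrary: k)
    case 0
    then show ?case
      by (simp add: germ_kernel_def p_def)
  next
    case (Suc r)
    have "sec k es \<in> N v (p r)"
      using Suc.prems(2) stable(2)[OF Suc.prems(1)] c(2)
      by (simp add: germ_kernel_def p_Suc list_act_append list_sect_append)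
    moreover have "to_grp v (sec k es) \<in> H"
      using stable(3) Suc.prems(1) sect by (metis bij_betwE)
    ultimately have "sec k es \<in> ker v"
      using Suc.IH by blast
    then have "sect A B (to_grp v k) (v, es) = sect A B (to_grp v 0) (v, es)"
      unfolding sect using sec_zero[OF c(1)] by (simp add: to_grp_eq_iff)
    moreover have "to_grp v 0 \<in> H"
      using subgroup.one_closed[OF stable(1)] by (simp add: one_grp)
    ultimately have "to_grp v k = to_grp v 0"
      using stable(3) Suc.prems(1) unfolding bij_betw_def inj_on_def by blast
    then show ?case
      by (simp add: to_grp_eq_iff)
  qed
  show ?thesis
  proof (rule that[OF w])
    fix k assume k: "to_grp v k \<in> H" "k \<in> Ninf v w"
    then obtain r where "k \<in> N v (stake r w)"
      by (auto simp: inf_germ_kernel_def)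
    then have "k \<in> N v (p r)"
      using N_stake_mono[OF w p(3)[of r]] p(4)[of r] by auto
    then show "k \<in> ker v"
      using ker k(1) by blast
  qed
qed

text \<open>The exponents of the elements of \<open>H\<close> form a subgroup of \<open>\<int>\<close>.\<close>

lemma subgroup_generator:
  assumes H: "subgroup H (grp v)"
  obtains n where "H = generate (grp v) {vgen A B v [^]\<^bsub>grp v\<^esub> (n :: int)}"
proof -
  have "0 \<in> {k. to_grp v k \<in> H}"
    using subgroup.one_closed[OF H] by (simp add: one_grp)
  moreover have "a - b \<in> {k. to_grp v k \<in> H}"
    if "a \<in> {k. to_grp v k \<in> H}" "b \<in> {k. to_grp v k \<in> H}" for a b
    using subgroup.m_closed[OF H, of "to_grp v a" "to_grp v (- b)"]
      subgroup.m_inv_closed[OF H, of "to_grp v b"] that by (simp add: mult_to_grp inv_to_grp)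
  ultimately obtain n where n: "{k. to_grp v k \<in> H} = {k. n dvd k}"
    using int_subgroup_generator[of "{k. to_grp v k \<in> H}"] by metis
  have "H \<subseteq> range (to_grp v)"
    using subgroup.subset[OF H] by (simp add: carrier_grp)
  then have "H = to_grp v ` {k. n dvd k}"
    unfolding n[symmetric] by blast
  also have "\<dots> = {to_grp v n [^]\<^bsub>grp v\<^esub> (i :: int) | i. i \<in> UNIV}"
    by (auto simp: int_pow_to_grp dvd_def mult.commute)
  also have "\<dots> = generate (grp v) {to_grp v n}"
    by (rule group.generate_pow[OF group_grp, symmetric]) simp
  also have "to_grp v n = vgen A B v [^]\<^bsub>grp v\<^esub> n"
    by (simp add: vgen_def int_pow_to_grp)
  finally show ?thesis
    by (rule that)
qed

lemma divisor_product_properties: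
  fixes n :: int
  assumes fin: "finite (carrier (grp v))" and c: "simple_cycle A c" "path_rng c = v"
    and nofree: "\<not> has_free_orbit A B v (max_stable A B c)"
    and gen: "max_stable A B c = generate (grp v) {vgen A B v [^]\<^bsub>grp v\<^esub> n}"
  defines "a \<equiv> divisor_product A B v (max_stable A B c) n :: 'n selt \<Rightarrow> 'k::field"
  shows "a \<in> carrier (group_algebra A B v (max_stable A B c))" "a \<in> singular A B" "a \<notin> tight A B"
    "quotient_hom A B a \<in> singular_ideal A B" "quotient_hom A B a \<noteq> (\<lambda>_. 0)"
proof -
  define es where "es = snd c"
  have c_eq: "c = (v, es)"
    using c(2) by (simp add: es_def path_rng_def prod_eq_iff)
  have es: "fpath v es" "path_src (v, es) = v" "es \<noteq> []"
    using c(1) by (simp_all add: simple_cycle_def cycle_path_def c_eq paths_def path_rng_def)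
  define H where "H = max_stable A B c"
  have stable: "stable_subgroup A B (v, es) H"
    unfolding H_def c_eq by (rule max_stable(1)[OF es(1,2) fin])
  then have sub: "subgroup H (grp v)"
    by (simp add: stable_subgroup_iff[OF es(1,2)])
  have finH: "finite H"
    using fin subgroup.subset[OF sub] finite_subset by blast
  interpret cyclic_subgroup A B v H n
  proof
    show "H = generate (grp v) {to_grp v n}"
      using gen by (simp add: H_def vgen_def int_pow_to_grp)
  qed (rule finH)
  have a: "a = eval_poly v n divisor_poly"
    unfolding a_def using divisor_product_eq by (simp add: H_def)
  show "a \<in> carrier (group_algebra A B v (max_stable A B c))"
    unfolding a H_def[symmetric] by (rule eval_poly_carrier)
  show sing: "a \<in> singular A B"
    using divisor_product_singular nofree unfolding a_def H_def[symmetric] by blast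
  then show "quotient_hom A B a \<in> singular_ideal A B"
    by (simp add: singular_def)
  obtain w where "ipath v w" "\<And>k. to_grp v k \<in> H \<Longrightarrow> k \<in> Ninf v w \<Longrightarrow> k \<in> ker v"
    using stable_subgroup_periodic_path[OF es stable] by metis
  then show nz: "quotient_hom A B a \<noteq> (\<lambda>_. 0)"
    unfolding a_def H_def[symmetric] by (rule divisor_product_not_tight)
  then show "a \<notin> tight A B"
    by (simp add: tight_def steinberg_def)
qed

lemma zero_in_singular_ideal: "(\<lambda>_. 0) \<in> singular_ideal A B"
proof -
  have "(\<lambda>_. 0) \<in> carrier (steinberg A B)"
    unfolding steinberg_def by (force intro!: exI[of _ "{}"])
  then show ?thesis
    by (simp add: singular_ideal_def)
qed

end

theorem theorem6p14:
  fixes A B :: "int^'n^'n"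
  assumes "Katsura_pair A B"
  shows "((singular_ideal A B :: ('n germ \<Rightarrow> 'k::field) set) \<noteq> {\<zero>\<^bsub>steinberg A B\<^esub>} \<longleftrightarrow>
           (\<exists>v c. finite (carrier (vgroup A B v)) \<and> simple_cycle A c \<and> path_rng c = v \<and>
                  \<not> has_free_orbit A B v (max_stable A B c)))
         \<and>
         (\<forall>v c (n::int).
           finite (carrier (vgroup A B v)) \<and> simple_cycle A c \<and> path_rng c = v \<and>
           \<not> has_free_orbit A B v (max_stable A B c) \<and>
           max_stable A B c = generate (vgroup A B v) {vgen A B v [^]\<^bsub>vgroup A B v\<^esub> n} \<longrightarrow>
           (let a = divisor_product A B v (max_stable A B c) n :: 'n selt \<Rightarrow> 'k in
            a \<in> carrier (group_algebra A B v (max_stable A B c)) \<and>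
            a \<in> singular A B \<and> a \<notin> tight A B))"
proof -
  interpret katsura A B
    using assms by unfold_locales
  have zero: "\<zero>\<^bsub>steinberg A B\<^esub> = (\<lambda>_ :: 'n germ. 0 :: 'k)"
    by (simp add: steinberg_def)
  show ?thesis
  proof (intro conjI iffI allI impI)
    assume "(singular_ideal A B :: ('n germ \<Rightarrow> 'k) set) \<noteq> {\<zero>\<^bsub>steinberg A B\<^esub>}"
    then obtain f :: "'n germ \<Rightarrow> 'k" where "f \<in> singular_ideal A B" "f \<noteq> (\<lambda>_. 0)"
      unfolding zero using zero_in_singular_ideal by blast
    then obtain u w and I :: "'n germ set set" and c :: "'n germ set \<Rightarrow> 'k" and k
      where "singular_data u w I c k"
      by (rule singular_ideal_imp_singular_data)
    then show "\<exists>v c. finite (carrier (vgroup A B v)) \<and> simple_cycle A c \<and> path_rng c = v \<and>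
                  \<not> has_free_orbit A B v (max_stable A B c)"
      by (rule singular_data_imp_cycle)
  next
    assume "\<exists>v c. finite (carrier (vgroup A B v)) \<and> simple_cycle A c \<and> path_rng c = v \<and>
                  \<not> has_free_orbit A B v (max_stable A B c)"
    then obtain v c where vc: "finite (carrier (vgroup A B v))" "simple_cycle A c" "path_rng c = v"
      "\<not> has_free_orbit A B v (max_stable A B c)"
      by blast
    from vc(3) obtain es where c: "c = (v, es)"
      by (cases c) (simp add: path_rng_def)
    have "fpath v es" "path_src (v, es) = v"
      using vc(2) by (simp_all add: c simple_cycle_def cycle_path_def paths_def path_rng_def)
    then have "subgroup (max_stable A B c) (grp v)"
      using max_stable(1)[of v es] vc(1) by (simp add: c stable_subgroup_iff)
    then obtain n where "max_stable A B c = generate (grp v) {vgen A B v [^]\<^bsub>grp v\<^esub> (n :: int)}"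
      by (rule subgroup_generator)
    from divisor_product_properties(4,5)[OF vc this, where 'k = 'k]
    show "(singular_ideal A B :: ('n germ \<Rightarrow> 'k) set) \<noteq> {\<zero>\<^bsub>steinberg A B\<^esub>}"
      unfolding zero by blast
  next
    fix v c and n :: int
    assume "finite (carrier (vgroup A B v)) \<and> simple_cycle A c \<and> path_rng c = v \<and>
           \<not> has_free_orbit A B v (max_stable A B c) \<and>
           max_stable A B c = generate (vgroup A B v) {vgen A B v [^]\<^bsub>vgroup A B v\<^esub> n}"
    then show "let a = divisor_product A B v (max_stable A B c) n :: 'n selt \<Rightarrow> 'k in
            a \<in> carrier (group_algebra A B v (max_stable A B c)) \<and>
            a \<in> singular A B \<and> a \<notin> tight A B"
      unfolding Let_def using divisor_product_properties(1-3)[of v c n, where 'k = 'k] by blast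
  qed
qed

end
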